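(* Let $p,m,m_0\ge1$ be integers with $m\ge m_0$, let $f\colon\mathbb{R}^p\to\mathbb{R}$ be $2m$-times continuously differentiable, and let $F\colon\mathbb{R}^p\to\mathbb{R}$ be any antiderivative of $f$ that is $2m_0$-times continuously differentiable. Suppose that $$F^{(\boldsymbol{\alpha})}(\mathbf{x})\to0\ \text{ as }\ \max(x_1,\dots,x_p)\to\infty,\quad\text{for each }\boldsymbol{\alpha}\in\mathbb{Z}_+^p\text{ with }\|\boldsymbol{\alpha}\|=2m_0,$$ and that, for each $\boldsymbol{\alpha}\in\mathbb{Z}_+^p$ with $\|\boldsymbol{\alpha}\|=2m$, the series $\sum_{\mathbf{k}=\mathbf{0}}^{\infty\mathbf{1}}f^{(\boldsymbol{\alpha})}(\mathbf{k}+\mathbf{u})$ converges uniformly in $\mathbf{u}\in[-m\mathbf{1}/2,m\mathbf{1}/2]$, in the sense that $\sum_{\mathbf{k}=\mathbf{0}}^{\mathbf{n}-\mathbf{1}}f^{(\boldsymbol{\alpha})}(\mathbf{k}+\mathbf{u})$ converges uniformly in such $\mathbf{u}$ as $\wedge\mathbf{n}\to\infty$. Take any $\mathbf{c}\in\mathbb{Z}_+^p$. Then $$\sum_{\mathbf{k}\ge\mathbf{0}}^{\mathsf{Alt}}f(\mathbf{k})=\sum_{\mathbf{k}=\mathbf{0}}^{\mathbf{c}-\mathbf{1}}f(\mathbf{k})-\tilde A_{m,F}(\mathbf{c})-R_{m,f,\mathbf{c}}(\infty),$$ where $$R_{m,f,\mathbf{c}}(\infty):=-\sum_{\emptyset\ne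 J\subseteq[p]}(-1)^{|J|}R_{m,f_{\mathbf{c}\mathbf{1}_J}}(\infty).$$
   Context: Notation. $\mathbb{Z}_+:=\mathbb{Z}\cap[0,\infty)$, $[p]:=\{1,\dots,p\}$, $|J|$ is the cardinality of $J\subseteq[p]$, and $\mathbf{1}_J\in\{0,1\}^p$ is the vector whose $r$th coordinate is $1$ if $r\in J$ and $0$ otherwise. Boldface letters denote vectors with $p$ coordinates, the coordinates being denoted by the corresponding non-bold letters with indices. $\mathbf{1}:=(1,\dots,1)$, $\mathbf{0}:=(0,\dots,0)$, $\wedge\mathbf{n}:=\min(n_1,\dots,n_p)$. For $\boldsymbol{\alpha}\in\mathbb{Z}_+^p$: $\|\boldsymbol{\alpha}\|:=\alpha_1+\dots+\alpha_p$, $\boldsymbol{\alpha}!:=\alpha_1!\cdots\alpha_p!$, $\mathbf{x}^{\boldsymbol{\alpha}}:=x_1^{\alpha_1}\cdots x_p^{\alpha_p}$, and $h^{(\boldsymbol{\alpha})}$ is the corresponding partial derivative of a function $h$. $|\boldsymbol{\beta}|:=(|\beta_1|,\dots,|\beta_p|)$ for $\boldsymbol{\beta}\in\mathbb{Z}^p$. Products of vectors such as $\mathbf{j}\mathbf{v}$, $\mathbf{n}\mathbf{1}_J$, $\mathbf{c}\mathbf{1}_J$ are coordinatewise, and inequalities between vectors are coordinatewise. $[\mathbf{u},\mathbf{v}]:=\prod_r[u_r,v_r]$. $\sum_{\mathbf{i}=\mathbf{a}}^{\mathbf{b}}$ is the sum over all $\mathbf{i}\in\mathbb{Z}^p$ with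 $\mathbf{a}\le\mathbf{i}\le\mathbf{b}$ (an empty sum is $0$); $\sum_{\mathbf{k}=\mathbf{0}}^{\infty\mathbf{1}}$ is the limit of $\sum_{\mathbf{k}=\mathbf{0}}^{\mathbf{n}-\mathbf{1}}$ as $\wedge\mathbf{n}\to\infty$; $\sum_{\|\boldsymbol{\alpha}\|=2m}$ is over $\boldsymbol{\alpha}\in\mathbb{Z}_+^p$. A function $F$ on $\mathbb{R}^p$ is an antiderivative of $f$ if $F^{(\mathbf{1})}=f$, that is, $\partial^pF/(\partial x_1\cdots\partial x_p)=f$. For a function $h$ on $\mathbb{R}^p$ and $\mathbf{a}\in\mathbb{R}^p$, the shift $h_{\mathbf{a}}$ is defined by $h_{\mathbf{a}}(\mathbf{x}):=h(\mathbf{x}+\mathbf{a})$. Coefficients: for integers $j\ge1$, $$\gamma_{m,j}:=(-1)^{j-1}\frac2j\binom{2m}{m+j}\Big/\binom{2m}{m},\qquad \tau_{m,j}:=\sum_{\beta=0}^{\infty}\gamma_{m,j+2\beta}$$ (with $\binom{2m}{m+j}=0$ for $j>m$), and for $\mathbf{j}\in\mathbb{Z}_+^p$ with $\mathbf{j}\ge\mathbf{1}$, $\gamma_{m,\mathbf{j}}:=\prod_{r=1}^p\gamma_{m,j_r}$ and $\tau_{m,\mathbf{j}}:=\prod_{r=1}^p\tau_{m,j_r}$. For $\mathbf{n}\in\mathbb{Z}_+^p$ and $J\subseteq[p]$, $$A^J_{m,F}(\mathbf{n}):=\sum_{\boldsymbol{\beta}=(1-m)\mathbf{1}}^{(m-1)\mathbf{1}}\tau_{m,\mathbf{1}+|\boldsymbol{\beta}|}F(\mathbf{n}\mathbf{1}_J-\mathbf{1}/2-\boldsymbol{\beta}/2),\qquad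 \tilde A_{m,F}(\mathbf{n}):=\sum_{\emptyset\ne J\subseteq[p]}(-1)^{p-|J|}A^J_{m,F}(\mathbf{n}),$$ and similarly with $m_0$ in place of $m$. The generalized sum is $$\sum_{\mathbf{k}\ge\mathbf{0}}^{\mathsf{Alt}}f(\mathbf{k}):=\lim_{\wedge\mathbf{n}\to\infty}\Big(\sum_{\mathbf{k}=\mathbf{0}}^{\mathbf{n}-\mathbf{1}}f(\mathbf{k})-\tilde A_{m_0,F}(\mathbf{n})\Big).$$ For a function $h$ (here $h=f_{\mathbf{c}\mathbf{1}_J}$), $$R_{m,h}(\infty):=\frac{m}{2^{2m+p-1}}\sum_{\|\boldsymbol{\alpha}\|=2m}\frac1{\boldsymbol{\alpha}!}\int_0^1ds\,(1-s)^{2m-1}\int_{[-1,1]^p}d\mathbf{v}\,\mathbf{v}^{\boldsymbol{\alpha}}\sum_{\mathbf{j}=\mathbf{1}}^{m\mathbf{1}}\gamma_{m,\mathbf{j}}\,\mathbf{j}^{\boldsymbol{\alpha}+\mathbf{1}}\sum_{\mathbf{k}=\mathbf{0}}^{\infty\mathbf{1}}h^{(\boldsymbol{\alpha})}(\mathbf{k}+s\mathbf{j}\mathbf{v}/2).$$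
   Formalization: The generalized sum is proved to exist; the equation is stated assuming each R_{m,f_{c1_J}}(∞) is defined (its series over k converge pointwise, its integrals exist), since for p≥2, c≠0 the stated uniform convergence does not ensure this. *)

theory Defs
  imports "HOL-Analysis.Analysis"
begin

text \<open>
  The coordinate set \<open>[p]\<close> is a finite linearly ordered type \<open>'p\<close>, so that
  \<open>p = CARD('p) \<ge> 1\<close>. Vectors are elements of \<open>real ^ 'p\<close>, \<open>nat ^ 'p\<close> and \<open>int ^ 'p\<close>;
  their order and their \<open>0\<close> and \<open>1\<close> are coordinatewise. The linear order on \<open>'p\<close>
  only fixes the order in which partial derivatives are taken.
\<close>


section \<open>Vectors and multi-indices\<close>

definition rvec :: "nat ^ 'p \<Rightarrow> real ^ 'p" where
  "rvec k = (\<chi> r. real (k $ r))"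

text \<open>\<open>restr n J\<close> is the coordinatewise product of \<open>n\<close> and the indicator vector of \<open>J\<close>.\<close>

definition restr :: "nat ^ 'p \<Rightarrow> 'p set \<Rightarrow> nat ^ 'p" where
  "restr n J = (\<chi> r. if r \<in> J then n $ r else 0)"

definition mi_norm :: "nat ^ 'p::finite \<Rightarrow> nat" where
  "mi_norm \<alpha> = (\<Sum>r\<in>UNIV. \<alpha> $ r)"

definition mi_fact :: "nat ^ 'p::finite \<Rightarrow> real" where
  "mi_fact \<alpha> = (\<Prod>r\<in>UNIV. fact (\<alpha> $ r))"

definition mi_power :: "real ^ 'p::finite \<Rightarrow> nat ^ 'p \<Rightarrow> real" where
  "mi_power x \<alpha> = (\<Prod>r\<in>UNIV. (x $ r) ^ (\<alpha> $ r))"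

definition multi_indices :: "nat \<Rightarrow> (nat ^ 'p::finite) set" where
  "multi_indices d = {\<alpha>. mi_norm \<alpha> = d}"

text \<open>The indices \<open>0 \<le> k \<le> n - 1\<close>; written with \<open><\<close> since subtraction on \<open>nat\<close> truncates.
  The box is empty as soon as some coordinate of \<open>n\<close> vanishes.\<close>

definition box_below :: "nat ^ 'p \<Rightarrow> (nat ^ 'p) set" where
  "box_below n = {k. \<forall>r. k $ r < n $ r}"

definition min_at_top :: "(nat ^ 'p::finite) filter" where
  "min_at_top = filtercomap (\<lambda>n. Min (range (\<lambda>r. n $ r))) at_top"

definition max_at_top :: "(real ^ 'p::finite) filter" where
  "max_at_top = filtercomap (\<lambda>x. Max (range (\<lambda>r. x $ r))) at_top"

definition shift :: "(real ^ 'p \<Rightarrow> real) \<Rightarrow> real ^ 'p \<Rightarrow> (real ^ 'p \<Rightarrow> real)" where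
  "shift h a = (\<lambda>x. h (x + a))"


section \<open>Partial derivatives\<close>

definition has_partial :: "'p::finite \<Rightarrow> (real ^ 'p \<Rightarrow> real) \<Rightarrow> bool" where
  "has_partial r h \<longleftrightarrow> (\<forall>x. (\<lambda>t. h (x + t *\<^sub>R axis r 1)) differentiable (at 0))"

definition partial :: "'p::finite \<Rightarrow> (real ^ 'p \<Rightarrow> real) \<Rightarrow> (real ^ 'p \<Rightarrow> real)" where
  "partial r h = (\<lambda>x. deriv (\<lambda>t. h (x + t *\<^sub>R axis r 1)) 0)"

primrec cont_diff :: "nat \<Rightarrow> (real ^ 'p::finite \<Rightarrow> real) \<Rightarrow> bool" where
  "cont_diff 0 h \<longleftrightarrow> continuous_on UNIV h"
| "cont_diff (Suc k) h \<longleftrightarrow>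
     continuous_on UNIV h \<and> (\<forall>r. has_partial r h \<and> cont_diff k (partial r h))"

primrec iter_partial :: "'p list \<Rightarrow> (real ^ 'p::finite \<Rightarrow> real) \<Rightarrow> (real ^ 'p \<Rightarrow> real)" where
  "iter_partial [] h = h"
| "iter_partial (r # rs) h = partial r (iter_partial rs h)"

primrec has_iter_partial :: "'p list \<Rightarrow> (real ^ 'p::finite \<Rightarrow> real) \<Rightarrow> bool" where
  "has_iter_partial [] h \<longleftrightarrow> True"
| "has_iter_partial (r # rs) h \<longleftrightarrow> has_iter_partial rs h \<and> has_partial r (iter_partial rs h)"

text \<open>\<open>r\<^sub>1, \<dots>, r\<^sub>1, r\<^sub>2, \<dots>, r\<^sub>2, \<dots>\<close> with the coordinates \<open>r\<^sub>i\<close> in increasing order and each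
  \<open>r\<close> repeated \<open>\<alpha> $ r\<close> times; \<open>iter_partial\<close> applies the last entry first.\<close>

definition directions :: "nat ^ 'p::{finite,linorder} \<Rightarrow> 'p list" where
  "directions \<alpha> = concat (map (\<lambda>r. replicate (\<alpha> $ r) r) (sorted_list_of_set UNIV))"

definition mderiv ::
    "nat ^ 'p::{finite,linorder} \<Rightarrow> (real ^ 'p::{finite,linorder} \<Rightarrow> real) \<Rightarrow> (real ^ 'p::{finite,linorder} \<Rightarrow> real)" where
  "mderiv \<alpha> h = iter_partial (directions \<alpha>) h"

text \<open>Existence of the mixed derivative has to be demanded separately, because \<open>deriv\<close> is total
  and \<open>p\<close> may exceed the order of smoothness of \<open>F\<close>.\<close>

definition antiderivative ::
    "(real ^ 'p::{finite,linorder} \<Rightarrow> real) \<Rightarrow> (real ^ 'p::{finite,linorder} \<Rightarrow> real) \<Rightarrow> bool" where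
  "antiderivative F f \<longleftrightarrow> has_iter_partial (directions 1) F \<and> mderiv 1 F = f"


section \<open>Coefficients and the generalized sum\<close>

definition gam :: "nat \<Rightarrow> nat \<Rightarrow> real" where
  "gam m j = (- 1) ^ (j - 1) * (2 / real j) * real ((2 * m) choose (m + j)) / real ((2 * m) choose m)"

definition tau :: "nat \<Rightarrow> nat \<Rightarrow> real" where
  "tau m j = (\<Sum>\<beta>. gam m (j + 2 * \<beta>))"

definition gam_vec :: "nat \<Rightarrow> nat ^ 'p::finite \<Rightarrow> real" where
  "gam_vec m j = (\<Prod>r\<in>UNIV. gam m (j $ r))"

definition tau_vec :: "nat \<Rightarrow> nat ^ 'p::finite \<Rightarrow> real" where
  "tau_vec m j = (\<Prod>r\<in>UNIV. tau m (j $ r))"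

definition A_J :: "nat \<Rightarrow> (real ^ 'p::finite \<Rightarrow> real) \<Rightarrow> 'p set \<Rightarrow> nat ^ 'p \<Rightarrow> real" where
  "A_J m F J n =
     (\<Sum>\<beta> \<in> {(\<chi> r. 1 - int m) .. (\<chi> r. int m - 1)}.
        tau_vec m (\<chi> r. 1 + nat \<bar>\<beta> $ r\<bar>) *
        F (\<chi> r. real (restr n J $ r) - 1 / 2 - of_int (\<beta> $ r) / 2))"

definition A_tilde :: "nat \<Rightarrow> (real ^ 'p::finite \<Rightarrow> real) \<Rightarrow> nat ^ 'p \<Rightarrow> real" where
  "A_tilde m F n = (\<Sum>J \<in> {J. J \<noteq> {}}. (- 1) ^ (CARD('p) - card J) * A_J m F J n)"

definition alt_partial ::
    "nat \<Rightarrow> (real ^ 'p::finite \<Rightarrow> real) \<Rightarrow> (real ^ 'p \<Rightarrow> real) \<Rightarrow> nat ^ 'p \<Rightarrow> real" where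
  "alt_partial m0 F f n = (\<Sum>k \<in> box_below n. f (rvec k)) - A_tilde m0 F n"

definition alt_sum :: "nat \<Rightarrow> (real ^ 'p::finite \<Rightarrow> real) \<Rightarrow> (real ^ 'p \<Rightarrow> real) \<Rightarrow> real" where
  "alt_sum m0 F f = Lim min_at_top (alt_partial m0 F f)"


section \<open>The remainder\<close>

definition half_cube :: "nat \<Rightarrow> (real ^ 'p::finite) set" where
  "half_cube m = cbox (\<chi> r. - real m / 2) (\<chi> r. real m / 2)"

definition lattice_sum :: "(real ^ 'p::finite \<Rightarrow> real) \<Rightarrow> nat ^ 'p \<Rightarrow> real ^ 'p \<Rightarrow> real" where
  "lattice_sum g n u = (\<Sum>k \<in> box_below n. g (rvec k + u))"

definition lattice_series :: "(real ^ 'p::finite \<Rightarrow> real) \<Rightarrow> real ^ 'p \<Rightarrow> real" where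
  "lattice_series g u = Lim min_at_top (\<lambda>n. lattice_sum g n u)"

definition R_integrand ::
    "nat \<Rightarrow> (real ^ 'p::{finite,linorder} \<Rightarrow> real) \<Rightarrow> nat ^ 'p::{finite,linorder} \<Rightarrow> real \<Rightarrow> real ^ 'p::{finite,linorder} \<Rightarrow> real" where
  "R_integrand m h \<alpha> s v = mi_power v \<alpha> *
     (\<Sum>j \<in> {1 .. (\<chi> r. m)}. gam_vec m j * mi_power (rvec j) (\<alpha> + 1) *
        lattice_series (mderiv \<alpha> h) (\<chi> r. s * real (j $ r) * v $ r / 2))"

definition R_inf :: "nat \<Rightarrow> (real ^ 'p::{finite,linorder} \<Rightarrow> real) \<Rightarrow> real" where
  "R_inf m h = real m / 2 ^ (2 * m + CARD('p) - 1) *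
     (\<Sum>\<alpha> \<in> multi_indices (2 * m). 1 / mi_fact \<alpha> *
        integral {0..1} (\<lambda>s. (1 - s) ^ (2 * m - 1) *
          integral (cbox (- 1) 1) (R_integrand m h \<alpha> s)))"

text \<open>
  \<open>Lim\<close> and \<open>integral\<close> are total, so \<open>R_inf m h\<close> denotes the remainder only if the inner series
  converge and the integrals exist, which is what \<open>R_inf_exists\<close> says. The arguments
  \<open>s j v / 2\<close> of the series range exactly over \<open>half_cube m\<close>.
\<close>

definition R_inf_exists :: "nat \<Rightarrow> (real ^ 'p::{finite,linorder} \<Rightarrow> real) \<Rightarrow> bool" where
  "R_inf_exists m h \<longleftrightarrow>
     (\<forall>\<alpha> \<in> multi_indices (2 * m).
        (\<forall>u \<in> half_cube m. \<exists>l. ((\<lambda>n. lattice_sum (mderiv \<alpha> h) n u) \<longlongrightarrow> l) min_at_top) \<and>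
        (\<forall>s \<in> {0..1}. R_integrand m h \<alpha> s integrable_on cbox (- 1) 1) \<and>
        (\<lambda>s. (1 - s) ^ (2 * m - 1) * integral (cbox (- 1) 1) (R_integrand m h \<alpha> s))
          integrable_on {0..1})"

definition R_shifted :: "nat \<Rightarrow> (real ^ 'p::{finite,linorder} \<Rightarrow> real) \<Rightarrow> nat ^ 'p::{finite,linorder} \<Rightarrow> real" where
  "R_shifted m f c =
     - (\<Sum>J \<in> {J. J \<noteq> {}}. (- 1) ^ card J * R_inf m (shift f (rvec (restr c J))))"

text \<open>
  Uniform convergence of the series for \<open>f\<close> does not give convergence of the series for the
  shifts of \<open>f\<close> by \<open>rvec (restr c J)\<close>: a multiple series that converges over boxes may have
  divergent slices (unless \<open>p = 1\<close> or \<open>c = 0\<close>). Hence this separate predicate, which says that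
  every term of \<open>R_shifted\<close> is meaningful.
\<close>

definition R_shifted_exists ::
    "nat \<Rightarrow> (real ^ 'p::{finite,linorder} \<Rightarrow> real) \<Rightarrow> nat ^ 'p::{finite,linorder} \<Rightarrow> bool" where
  "R_shifted_exists m f c \<longleftrightarrow>
     (\<forall>J. J \<noteq> {} \<longrightarrow> R_inf_exists m (shift f (rvec (restr c J))))"

end

theory Submission
  imports Defs
begin

text \<open>
In one variable, the combination \<open>\<Sum>j. gam m j * integral {k - j / 2..k + j / 2} f\<close> reproduces
\<open>f k\<close> for all polynomials \<open>f\<close> of degree below
\<open>2 * m\<close>: odd powers of \<open>x - k\<close> integrate to zero, and the even power \<open>2 * i\<close> contributes a multiple
of \<open>\<Sum>j. gam m j * j ^ (2 * i + 1)\<close>, which vanishes for \<open>0 < i < m\<close>. The product of these quadratures over the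
coordinates reproduces polynomials of total degree below \<open>2 * m\<close>, so Taylor's formula with
integral remainder expresses \<open>f k\<close> as the quadrature minus a remainder that is linear in the
derivatives of order \<open>2 * m\<close> (\<open>central_quadrature\<close>). The integral of \<open>f\<close> over a box is an
alternating sum of corner values of \<open>F\<close> (\<open>has_integral_iter_partial\<close>). On summing over
\<open>0 \<le> k < n\<close> these alternating sums telescope in each coordinate and produce the coefficients
\<open>tau\<close>. This is the finite formula \<open>finite_summation_formula\<close>:
\<open>(\<Sum>k < n. f k) + R(n) = A_tilde m F n + (-1) ^ p * A_J m F {} 0\<close>, whose last term does not depend
on \<open>n\<close>.

Here \<open>R(n)\<close> is one linear functional, \<open>R_functional m\<close>, applied to the partial lattice sums of the
derivatives of \<open>f\<close>. The functional is bounded with respect to the supremum norm on \<open>half_cube m\<close>,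
so by uniform convergence \<open>R(n)\<close> tends to its value \<open>R\<close> at the limit series. Moreover
\<open>A_tilde m F n - A_tilde m0 F n\<close> tends to \<open>0\<close>: both are weighted means of \<open>F\<close> whose weights have the
same moments of degree below \<open>2 * m0\<close> (\<open>tau_vec_moment_independent\<close>), so only Taylor remainders of
order \<open>2 * m0\<close> of \<open>F\<close> are left, and these vanish at infinity by the decay of the derivatives of
\<open>F\<close>. Hence the generalized sum is \<open>(-1) ^ p * A_J m F {} 0 - R\<close>.

For the stated form, the finite formula is used a second time with \<open>n = c\<close>. It remains to
see that \<open>R_shifted m f c = R - R(c)\<close>. By inclusion and exclusion over the sets \<open>J\<close>, the
alternating sum of the series over the shifted orthants \<open>k \<ge> restr c J\<close>, \<open>J \<noteq> {}\<close>, equals the sum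
over \<open>0 \<le> k < c\<close> minus the full series (\<open>lattice_series_signed_orthants\<close>); this is a pointwise identity
of limits, and \<open>R_functional m\<close> is linear on the functions for which its integrals exist. For
this it suffices that the shifted series converge pointwise, as provided by \<open>R_shifted_exists\<close>.
\<close>


section \<open>The coefficients in one dimension\<close>

text \<open>
The \<open>n\<close>-th finite difference of a polynomial of degree less than \<open>n\<close> vanishes: Pascal's rule
lowers \<open>n\<close>, and taking one difference lowers the degree.
\<close>

lemma alternating_binomial_power_sum:
  fixes x :: "'a::comm_ring_1"
  assumes "d < n"
  shows "(\<Sum>k\<le>n. (-1) ^ k * of_nat (n choose k) * (of_nat k + x) ^ d) = 0"
  using assms
proof (induction n arbitrary: d x)
  case 0
  then show ?case by simp
next
  case (Suc n)
  have pascal: "(\<Sum>k\<le>Suc n. (-1) ^ k * of_nat (Suc n choose k) * h k) =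
      (\<Sum>k\<le>n. (-1) ^ k * of_nat (n choose k) * (h k - h (Suc k)))" for h :: "nat \<Rightarrow> 'a"
  proof -
    have "(\<Sum>k\<le>Suc n. (-1) ^ k * of_nat (Suc n choose k) * h k) =
        h 0 + (\<Sum>k\<le>n. (-1) ^ Suc k * of_nat (Suc n choose Suc k) * h (Suc k))"
      by (subst sum.atMost_Suc_shift) simp
    also have "\<dots> = h 0 + (\<Sum>k\<le>n. (-1) ^ Suc k * of_nat (n choose Suc k) * h (Suc k))
        - (\<Sum>k\<le>n. (-1) ^ k * of_nat (n choose k) * h (Suc k))"
      by (simp add: algebra_simps sum.distrib sum_negf sum_subtractf)
    also have "h 0 + (\<Sum>k\<le>n. (-1) ^ Suc k * of_nat (n choose Suc k) * h (Suc k)) =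
        (\<Sum>k\<le>Suc n. (-1) ^ k * of_nat (n choose k) * h k)"
      by (subst sum.atMost_Suc_shift) simp
    also have "\<dots> = (\<Sum>k\<le>n. (-1) ^ k * of_nat (n choose k) * h k)"
      by (simp add: binomial_eq_0)
    finally show ?thesis by (simp add: algebra_simps sum_subtractf)
  qed
  have expand: "(of_nat k + x) ^ d - (of_nat (Suc k) + x) ^ d =
      - (\<Sum>i<d. of_nat (d choose i) * (of_nat k + x) ^ i)" for k
  proof -
    have "(of_nat (Suc k) + x) ^ d = ((of_nat k + x) + 1) ^ d" by (simp add: algebra_simps)
    also have "\<dots> = (\<Sum>i\<le>d. of_nat (d choose i) * (of_nat k + x) ^ i)"
      by (subst binomial_ring) simp
    also have "\<dots> = (\<Sum>i<d. of_nat (d choose i) * (of_nat k + x) ^ i) + (of_nat k + x) ^ d"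
      by (simp flip: lessThan_Suc_atMost)
    finally show ?thesis by simp
  qed
  have "(\<Sum>k\<le>Suc n. (-1) ^ k * of_nat (Suc n choose k) * (of_nat k + x) ^ d) =
      (\<Sum>k\<le>n. (-1) ^ k * of_nat (n choose k) * - (\<Sum>i<d. of_nat (d choose i) * (of_nat k + x) ^ i))"
    by (subst pascal) (simp only: expand)
  also have "\<dots> = - (\<Sum>i<d. of_nat (d choose i) *
      (\<Sum>k\<le>n. (-1) ^ k * of_nat (n choose k) * (of_nat k + x) ^ i))"
    unfolding sum_distrib_left mult_minus_right sum_negf
    by (subst sum.swap) (simp add: mult_ac)
  also have "\<dots> = 0"
    using Suc.prems by (simp add: Suc.IH)
  finally show ?case .
qed

text \<open>
Up to the factor \<open>(-1) ^ m\<close>, the \<open>2 * m\<close>-th finite difference of the even polynomial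
\<open>(k - m) ^ (2 * i)\<close> consists of two equal halves, \<open>k < m\<close> and \<open>k > m\<close>, and of the central term, which
is nonzero only for \<open>i = 0\<close>. Since the whole difference is zero, the central term determines the
halves.
\<close>

lemma gam_odd_moment:
  assumes "i < m"
  shows "(\<Sum>j=1..m. gam m j * real j ^ (2 * i + 1)) = of_bool (i = 0)"
proof -
  \<comment> \<open>\<open>t j\<close> is the term \<open>k = m + j\<close> of the finite difference, without the sign \<open>(-1) ^ m\<close>.\<close>
  define t where "t j = (-1) ^ j * real ((2 * m) choose (m + j)) * real j ^ (2 * i)" for j
  define w where "w k = (-1) ^ k * real ((2 * m) choose k) * (real k - real m) ^ (2 * i)" for k
  have "(\<Sum>k\<le>2 * m. w k) = 0"
    using alternating_binomial_power_sum[of "2 * i" "2 * m" "- real m"] assms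
    by (simp add: w_def)
  moreover have "{..2 * m} = insert m ({..<m} \<union> {m<..2 * m})"
    by auto
  moreover have "(\<Sum>k\<in>{..<m} \<union> {m<..2 * m}. w k) = (\<Sum>k<m. w k) + (\<Sum>k\<in>{m<..2 * m}. w k)"
    by (rule sum.union_disjoint) auto
  ultimately have "0 = (\<Sum>k<m. w k) + w m + (\<Sum>k\<in>{m<..2 * m}. w k)"
    by simp
  also have "(\<Sum>k\<in>{m<..2 * m}. w k) = (\<Sum>j=1..m. (-1) ^ m * t j)"
    by (rule sum.reindex_bij_witness[where i = "\<lambda>j. m + j" and j = "\<lambda>k. k - m"])
      (auto simp: w_def t_def power_add of_nat_diff minus_one_power_iff)
  also have "(\<Sum>k<m. w k) = (\<Sum>j=1..m. (-1) ^ m * t j)"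
  proof (rule sum.reindex_bij_witness[where i = "\<lambda>j. m - j" and j = "\<lambda>k. m - k"])
    fix k assume "k \<in> {..<m}"
    then have k: "k < m" by simp
    then have "(2 * m) choose k = (2 * m) choose (m + (m - k))"
      by (subst binomial_symmetric) (auto simp: mult_2)
    moreover have "(real k - real m) ^ (2 * i) = real (m - k) ^ (2 * i)"
      using k by (simp add: of_nat_diff power_mult power2_commute)
    moreover have "(-1 :: real) ^ m * (-1) ^ (m - k) = (-1) ^ k"
      using k by (simp add: minus_one_power_iff)
    ultimately show "(-1) ^ m * t (m - k) = w k"
      by (simp add: w_def t_def flip: mult.assoc)
  qed auto
  also have "w m = (-1) ^ m * (of_bool (i = 0) * real ((2 * m) choose m))"
    by (simp add: w_def power_0_left)
  finally have "(-1) ^ m * (2 * (\<Sum>j=1..m. t j) + of_bool (i = 0) * real ((2 * m) choose m)) = 0"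
    by (simp add: algebra_simps sum_distrib_left)
  then have *: "2 * (\<Sum>j=1..m. t j) = - of_bool (i = 0) * real ((2 * m) choose m)"
    by simp
  have pos: "real ((2 * m) choose m) \<noteq> 0" by (simp add: binomial_eq_0_iff)
  have "(\<Sum>j=1..m. gam m j * real j ^ (2 * i + 1)) = (\<Sum>j=1..m. - 2 * t j / real ((2 * m) choose m))"
  proof (rule sum.cong)
    fix j assume "j \<in> {1..m}"
    then have j: "real j \<noteq> 0" and "(-1 :: real) ^ (j - 1) = - ((-1) ^ j)"
      by (auto simp: power_eq_if)
    then show "gam m j * real j ^ (2 * i + 1) = - 2 * t j / real ((2 * m) choose m)"
      unfolding gam_def t_def by (simp add: field_simps)
  qed simp
  also have "\<dots> = - (2 * (\<Sum>j=1..m. t j)) / real ((2 * m) choose m)"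
    by (simp add: sum_distrib_left sum_divide_distrib sum_negf)
  also have "\<dots> = of_bool (i = 0)"
    using pos unfolding * by simp
  finally show ?thesis .
qed

lemma gam_central_difference_power:
  assumes "e \<le> 2 * m" and "1 \<le> m"
  shows "(\<Sum>j=1..m. gam m j * ((real j / 2) ^ e - (- (real j / 2)) ^ e)) = of_bool (e = 1)"
proof (cases "even e")
  case True
  then show ?thesis by auto
next
  case False
  then obtain i where e: "e = 2 * i + 1" by (elim oddE)
  have "(\<Sum>j=1..m. gam m j * ((real j / 2) ^ e - (- (real j / 2)) ^ e)) =
      2 / 2 ^ e * (\<Sum>j=1..m. gam m j * real j ^ (2 * i + 1))"
    using False unfolding sum_distrib_left
    by (intro sum.cong) (auto simp: e power_divide field_simps)
  also have "\<dots> = of_bool (e = 1)"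
    using assms gam_odd_moment[of i m] e by auto
  finally show ?thesis .
qed

lemma gam_eq_0: "j > m \<Longrightarrow> gam m j = 0"
  by (simp add: gam_def binomial_eq_0)

text \<open>
Since \<open>tau\<close> sums \<open>gam\<close> over indices of one parity, \<open>tau m (1 + \<bar>b\<bar>)\<close> collects \<open>gam m j\<close> for exactly
those \<open>j\<close> for which \<open>b\<close> is one of \<open>j - 1, j - 3, \<dots>, 1 - j\<close>.
\<close>

lemma sum_tau_eq_sum_gam:
  fixes H :: "int \<Rightarrow> real"
  shows "(\<Sum>b\<in>{1 - int m..int m - 1}. tau m (1 + nat \<bar>b\<bar>) * H b) =
         (\<Sum>j=1..m. gam m j * (\<Sum>i<j. H (int j - 1 - 2 * int i)))"
proof -
  \<comment> \<open>\<open>P b j\<close>: the coefficient \<open>gam m j\<close> occurs in \<open>tau m (1 + \<bar>b\<bar>)\<close>.\<close>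
  define P where "P b j \<longleftrightarrow> nat \<bar>b\<bar> < j \<and> even (j + 1 + nat \<bar>b\<bar>)" for b :: int and j :: nat
  have tau: "tau m (1 + nat \<bar>b\<bar>) = (\<Sum>j | j \<in> {1..m} \<and> P b j. gam m j)" for b
  proof -
    have "tau m (1 + nat \<bar>b\<bar>) = (\<Sum>\<beta><m. gam m (1 + nat \<bar>b\<bar> + 2 * \<beta>))"
      unfolding tau_def by (rule suminf_finite) (auto simp: gam_eq_0)
    also have "\<dots> = (\<Sum>\<beta> | \<beta> < m \<and> 1 + nat \<bar>b\<bar> + 2 * \<beta> \<le> m. gam m (1 + nat \<bar>b\<bar> + 2 * \<beta>))"
      by (rule sum.mono_neutral_right) (use gam_eq_0 not_le_imp_less in auto)
    also have "\<dots> = (\<Sum>j | j \<in> {1..m} \<and> P b j. gam m j)"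
    proof (rule sum.reindex_bij_witness[where i = "\<lambda>j. (j - 1 - nat \<bar>b\<bar>) div 2"
            and j = "\<lambda>\<beta>. 1 + nat \<bar>b\<bar> + 2 * \<beta>"])
      fix j assume "j \<in> {j. j \<in> {1..m} \<and> P b j}"
      then have "nat \<bar>b\<bar> < j" "even (j + 1 + nat \<bar>b\<bar>)" "j \<le> m"
        by (auto simp: P_def)
      moreover have "\<exists>\<beta>. j = 1 + c + 2 * \<beta>" if "c < j" "even (j + 1 + c)" for c
        using that by presburger
      ultimately obtain \<beta> where "j = 1 + nat \<bar>b\<bar> + 2 * \<beta>" "j \<le> m"
        by blast
      then show "1 + nat \<bar>b\<bar> + 2 * ((j - 1 - nat \<bar>b\<bar>) div 2) = j"
        and "(j - 1 - nat \<bar>b\<bar>) div 2 \<in> {\<beta>. \<beta> < m \<and> 1 + nat \<bar>b\<bar> + 2 * \<beta> \<le> m}"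
        by auto
    qed (auto simp: P_def)
    finally show ?thesis .
  qed
  have inner: "(\<Sum>b | b \<in> {1 - int m..int m - 1} \<and> P b j. H b) = (\<Sum>i<j. H (int j - 1 - 2 * int i))"
    if "j \<in> {1..m}" for j
  proof (rule sum.reindex_bij_witness[where i = "\<lambda>i. int j - 1 - 2 * int i"
          and j = "\<lambda>b. nat ((int j - 1 - b) div 2)"])
    fix b assume "b \<in> {b. b \<in> {1 - int m..int m - 1} \<and> P b j}"
    then have b: "\<bar>b\<bar> < int j" "even (int j - 1 - b)"
      unfolding P_def by (auto simp: even_nat_iff)
    then obtain i where i: "int j - 1 - b = 2 * i" by (elim evenE)
    with b show *: "int j - 1 - 2 * int (nat ((int j - 1 - b) div 2)) = b"
      by auto
    show "nat ((int j - 1 - b) div 2) \<in> {..<j}"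
      using b i by auto
    show "H (int j - 1 - 2 * int (nat ((int j - 1 - b) div 2))) = H b"
      by (simp only: *)
  next
    fix i assume i: "i \<in> {..<j}"
    then show "nat ((int j - 1 - (int j - 1 - 2 * int i)) div 2) = i" by simp
    show "int j - 1 - 2 * int i \<in> {b. b \<in> {1 - int m..int m - 1} \<and> P b j}"
      using i that unfolding P_def by (auto simp: even_nat_iff)
  qed
  have "(\<Sum>b\<in>{1 - int m..int m - 1}. tau m (1 + nat \<bar>b\<bar>) * H b) =
      (\<Sum>b\<in>{1 - int m..int m - 1}. \<Sum>j | j \<in> {1..m} \<and> P b j. gam m j * H b)"
    by (simp only: tau sum_distrib_right)
  also have "\<dots> = (\<Sum>j=1..m. \<Sum>b | b \<in> {1 - int m..int m - 1} \<and> P b j. gam m j * H b)"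
    by (rule sum.swap_restrict) auto
  also have "\<dots> = (\<Sum>j=1..m. gam m j * (\<Sum>i<j. H (int j - 1 - 2 * int i)))"
    by (intro sum.cong refl) (simp only: inner flip: sum_distrib_left)
  finally show ?thesis .
qed

text \<open>
A central difference of width \<open>j\<close> is a sum of \<open>j\<close> differences of width one, each of which telescopes
in \<open>k\<close>; the boundary points \<open>n - j / 2 + i\<close> with \<open>i < j\<close> are the points
\<open>n - 1 / 2 - b / 2\<close> of the right-hand side.
\<close>

lemma sum_central_differences_telescope:
  fixes G :: "real \<Rightarrow> real"
  shows "(\<Sum>k<n. \<Sum>j=1..m. gam m j * (G (real k + real j / 2) - G (real k - real j / 2))) =
    (\<Sum>b\<in>{1 - int m..int m - 1}. tau m (1 + nat \<bar>b\<bar>) *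
       (G (real n - 1 / 2 - of_int b / 2) - G (- 1 / 2 - of_int b / 2)))"
proof -
  have 1: "G (real k + real j / 2) - G (real k - real j / 2) =
      (\<Sum>i<j. G (real (Suc k) - real j / 2 + real i) - G (real k - real j / 2 + real i))" for k j
  proof -
    have "(\<Sum>i<j. G (real k - real j / 2 + real (Suc i)) - G (real k - real j / 2 + real i)) =
      G (real k - real j / 2 + real j) - G (real k - real j / 2 + real 0)"
      by (rule sum_lessThan_telescope)
    then show ?thesis by (simp add: algebra_simps)
  qed
  have "(\<Sum>k<n. \<Sum>j=1..m. gam m j * (G (real k + real j / 2) - G (real k - real j / 2))) =
      (\<Sum>j=1..m. gam m j * (\<Sum>i<j. \<Sum>k<n. G (real (Suc k) - real j / 2 + real i) - G (real k - real j / 2 + real i)))"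
    unfolding 1
    by (subst sum.swap) (simp only: flip: sum_distrib_left, subst (2) sum.swap, rule refl)
  also have "\<dots> = (\<Sum>j=1..m. gam m j * (\<Sum>i<j. G (real n - real j / 2 + real i) - G (real 0 - real j / 2 + real i)))"
    by (intro sum.cong refl arg_cong2[where f = "(*)"])
      (rule sum_lessThan_telescope[where f = "\<lambda>k. G (real k - real j / 2 + real i)" for j i])
  also have "\<dots> = (\<Sum>b\<in>{1 - int m..int m - 1}. tau m (1 + nat \<bar>b\<bar>) *
       (G (real n - 1 / 2 - of_int b / 2) - G (- 1 / 2 - of_int b / 2)))"
    unfolding sum_tau_eq_sum_gam
    by (intro sum.cong refl arg_cong2[where f = "(*)"])
       (auto intro!: arg_cong2[where f = "(-)"] arg_cong[where f = G] simp: field_simps)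
  finally show ?thesis .
qed

text \<open>
The telescoping identity with \<open>n = 1\<close>, applied to \<open>G y = (y + 1 / 2) ^ (d + 1)\<close>. The shift by \<open>1 / 2\<close>
turns the values of \<open>G\<close> on the \<open>tau\<close> side into powers of \<open>- b / 2 + 1\<close> and \<open>- b / 2\<close>, and on the \<open>gam\<close>
side the central differences return the derivative of \<open>G\<close> at \<open>0\<close>.
\<close>

lemma tau_moment_recursion:
  assumes "d < 2 * m"
  shows "(\<Sum>i\<le>d. real (Suc d choose i) *
      (\<Sum>b\<in>{1 - int m..int m - 1}. tau m (1 + nat \<bar>b\<bar>) * (- of_int b / 2) ^ i)) = real (Suc d) / 2 ^ d"
proof -
  have m: "1 \<le> m" using assms by simp
  define G where "G y = (y + 1 / 2) ^ Suc d" for y :: real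
  have G: "G y = (\<Sum>e\<le>Suc d. real (Suc d choose e) * (1 / 2) ^ (Suc d - e) * y ^ e)" for y
    unfolding G_def by (subst binomial_ring) (simp add: mult_ac)
  have "(\<Sum>j=1..m. gam m j * (G (real j / 2) - G (- (real j / 2)))) =
     (\<Sum>e\<le>Suc d. real (Suc d choose e) * (1 / 2) ^ (Suc d - e) *
        (\<Sum>j=1..m. gam m j * ((real j / 2) ^ e - (- (real j / 2)) ^ e)))"
    unfolding G sum_distrib_left sum_subtractf[symmetric]
    by (subst sum.swap) (intro sum.cong refl, simp add: algebra_simps)
  also have "\<dots> = (\<Sum>e\<le>Suc d. real (Suc d choose e) * (1 / 2) ^ (Suc d - e) * of_bool (e = 1))"
    using assms m by (intro sum.cong refl) (subst gam_central_difference_power, auto)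
  also have "\<dots> = (\<Sum>e\<in>{1}. real (Suc d choose e) * (1 / 2) ^ (Suc d - e) * of_bool (e = 1))"
    by (rule sum.mono_neutral_right) auto
  also have "\<dots> = real (Suc d) / 2 ^ d"
    by (simp add: power_divide)
  finally have lhs: "(\<Sum>j=1..m. gam m j * (G (real j / 2) - G (- (real j / 2)))) = real (Suc d) / 2 ^ d" .
  have diff: "G (1 - 1 / 2 - of_int b / 2) - G (- 1 / 2 - of_int b / 2) =
      (\<Sum>i\<le>d. real (Suc d choose i) * (- of_int b / 2) ^ i)" for b :: int
  proof -
    have "G (1 - 1 / 2 - of_int b / 2) = (- of_int b / 2 + 1) ^ Suc d"
      by (simp add: G_def algebra_simps)
    also have "\<dots> = (\<Sum>i\<le>Suc d. real (Suc d choose i) * (- of_int b / 2) ^ i)"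
      by (subst binomial_ring) simp
    also have "\<dots> = (\<Sum>i\<le>d. real (Suc d choose i) * (- of_int b / 2) ^ i) + (- of_int b / 2) ^ Suc d"
      by simp
    also have "(- of_int b / 2) ^ Suc d = G (- 1 / 2 - of_int b / 2)"
      by (simp add: G_def algebra_simps)
    finally show ?thesis by simp
  qed
  have "(\<Sum>i\<le>d. real (Suc d choose i) *
      (\<Sum>b\<in>{1 - int m..int m - 1}. tau m (1 + nat \<bar>b\<bar>) * (- of_int b / 2) ^ i)) =
      (\<Sum>b\<in>{1 - int m..int m - 1}. tau m (1 + nat \<bar>b\<bar>) *
       (G (1 - 1 / 2 - of_int b / 2) - G (- 1 / 2 - of_int b / 2)))"
    unfolding diff sum_distrib_left by (subst sum.swap) (simp add: mult_ac)
  also have "\<dots> = real (Suc d) / 2 ^ d"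
    using sum_central_differences_telescope[where n = 1 and m = m and G = G] lhs by simp
  finally show ?thesis .
qed

text \<open>
The recursion determines the moments successively and does not mention \<open>m\<close>.
\<close>

lemma tau_moment_independent:
  assumes "d < 2 * m" and "d < 2 * m'"
  shows "(\<Sum>b\<in>{1 - int m..int m - 1}. tau m (1 + nat \<bar>b\<bar>) * (- of_int b / 2) ^ d) =
         (\<Sum>b\<in>{1 - int m'..int m' - 1}. tau m' (1 + nat \<bar>b\<bar>) * (- of_int b / 2) ^ d)"
  using assms
proof (induction d rule: less_induct)
  case (less d)
  define N where "N m i = (\<Sum>b\<in>{1 - int m..int m - 1}. tau m (1 + nat \<bar>b\<bar>) * (- of_int b / 2) ^ i)"
    for m i
  have split: "real (Suc d) * N k d = real (Suc d) / 2 ^ d - (\<Sum>i<d. real (Suc d choose i) * N k i)"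
    if "d < 2 * k" for k
  proof -
    have "(\<Sum>i\<le>d. real (Suc d choose i) * N k i) = real (Suc d) / 2 ^ d"
      using tau_moment_recursion[OF that] by (simp only: N_def)
    then show ?thesis
      by (simp add: lessThan_Suc_atMost[symmetric])
  qed
  have "(\<Sum>i<d. real (Suc d choose i) * N m i) = (\<Sum>i<d. real (Suc d choose i) * N m' i)"
    unfolding N_def
    by (intro sum.cong refl arg_cong2[where f = "(*)"] less.IH) (use less.prems in auto)
  then have "real (Suc d) * N m d = real (Suc d) * N m' d"
    using split less.prems by metis
  then show ?case by (simp add: N_def)
qed


section \<open>Sums over products of coordinate sets\<close>

lemma vec_box_eq_image: "{k :: 'a ^ 'p::finite. \<forall>r. k $ r \<in> S r} = vec_lambda ` PiE UNIV S"
proof (intro equalityI subsetI)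
  fix k :: "'a ^ 'p" assume "k \<in> {k. \<forall>r. k $ r \<in> S r}"
  then have "k = vec_lambda (($) k)" "($) k \<in> PiE UNIV S"
    by auto
  then show "k \<in> vec_lambda ` PiE UNIV S" by blast
qed auto

lemma finite_vec_box: "(\<And>r. finite (S r)) \<Longrightarrow> finite {k :: 'a ^ 'p::finite. \<forall>r. k $ r \<in> S r}"
  unfolding vec_box_eq_image by (intro finite_imageI finite_PiE) auto

lemma sum_vec_box_prod:
  fixes g :: "'p::finite \<Rightarrow> 'a \<Rightarrow> real"
  assumes "\<And>r. finite (S r)"
  shows "(\<Sum>k | \<forall>r. k $ r \<in> S r. \<Prod>r\<in>UNIV. g r (k $ r)) = (\<Prod>r\<in>UNIV. \<Sum>i\<in>S r. g r i)"
proof -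
  have "inj_on vec_lambda (PiE UNIV S)"
    by (simp add: inj_on_def vec_lambda_inject)
  then have "(\<Sum>k | \<forall>r. k $ r \<in> S r. \<Prod>r\<in>UNIV. g r (k $ r)) =
      (\<Sum>h\<in>PiE UNIV S. \<Prod>r\<in>UNIV. g r (h r))"
    unfolding vec_box_eq_image by (simp add: sum.reindex)
  also have "\<dots> = (\<Prod>r\<in>UNIV. \<Sum>i\<in>S r. g r i)"
    using assms by (subst prod_sum_PiE) auto
  finally show ?thesis .
qed

lemma vec_atLeastAtMost_eq: "{a..b :: 'a::order ^ 'p::finite} = {j. \<forall>r. j $ r \<in> {a $ r..b $ r}}"
  by (auto simp: less_eq_vec_def)

lemma finite_nat_vec_interval: "finite {a..b :: nat ^ 'p::finite}"
  unfolding vec_atLeastAtMost_eq by (rule finite_vec_box) simp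

lemma finite_box_below: "finite (box_below n :: (nat ^ 'p::finite) set)"
  unfolding box_below_def using finite_vec_box[of "\<lambda>r. {..<n $ r}"] by simp

lemma sum_signed_subsets_prod:
  fixes x y :: "'p \<Rightarrow> real"
  assumes "finite S"
  shows "(\<Sum>J\<in>Pow S. (-1) ^ card (S - J) * (\<Prod>r\<in>S. if r \<in> J then x r else y r)) =
    (\<Prod>r\<in>S. x r - y r)"
proof -
  have "(\<Prod>r\<in>S. x r - y r) = (\<Prod>r\<in>S. x r + - y r)"
    by simp
  also have "\<dots> = (\<Sum>J\<in>Pow S. prod x J * (\<Prod>r\<in>S - J. - y r))"
    by (rule prod_add[OF assms])
  also have "\<dots> = (\<Sum>J\<in>Pow S. (-1) ^ card (S - J) * (\<Prod>r\<in>S. if r \<in> J then x r else y r))"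
  proof (rule sum.cong)
    fix J assume "J \<in> Pow S"
    then have J: "J \<subseteq> S" by simp
    then have "S \<inter> {r. r \<in> J} = J" "S \<inter> - {r. r \<in> J} = S - J"
      by auto
    then have "(\<Prod>r\<in>S. if r \<in> J then x r else y r) = prod x J * prod y (S - J)"
      using assms by (simp add: prod.If_cases)
    then show "prod x J * (\<Prod>r\<in>S - J. - y r) =
        (-1) ^ card (S - J) * (\<Prod>r\<in>S. if r \<in> J then x r else y r)"
      by (simp add: prod_uminus)
  qed simp
  finally show ?thesis by simp
qed

lemma sum_split_empty_set:
  fixes h :: "'p::finite set \<Rightarrow> real"
  shows "(\<Sum>J\<in>UNIV. h J) = h {} + (\<Sum>J\<in>{J. J \<noteq> {}}. h J)"
proof -
  have "UNIV - {{}} = {J :: 'p set. J \<noteq> {}}" by auto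
  then show ?thesis using sum.remove[of UNIV "{}" h] by simp
qed

text \<open>
Identities between tensor products of one-dimensional functionals need to be checked on product
functions only: on the finitely many points involved, every function is a linear combination of the
indicators of these points, and such an indicator is a product over the coordinates.
\<close>

lemma product_functions_suffice:
  fixes P :: "'a \<Rightarrow> 'c ^ 'p::finite" and P' :: "'b \<Rightarrow> 'c ^ 'p" and W W' :: "_ \<Rightarrow> real"
  assumes fin: "finite A" "finite B"
    and prod: "\<And>G :: 'p \<Rightarrow> 'c \<Rightarrow> real.
      (\<Sum>a\<in>A. W a * (\<Prod>r\<in>UNIV. G r (P a $ r))) = (\<Sum>b\<in>B. W' b * (\<Prod>r\<in>UNIV. G r (P' b $ r)))"
  shows "(\<Sum>a\<in>A. W a * F (P a)) = (\<Sum>b\<in>B. W' b * F (P' b))"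
proof -
  define Y where "Y = P ` A \<union> P' ` B"
  have finY: "finite Y" using fin by (simp add: Y_def)
  have F: "F x = (\<Sum>y\<in>Y. F y * (\<Prod>r\<in>UNIV. of_bool (x $ r = y $ r)))" if "x \<in> Y" for x
  proof -
    have eq: "(\<Prod>r\<in>UNIV. of_bool (x $ r = y $ r) :: real) = of_bool (x = y)" for y
    proof (cases "x = y")
      case False
      then obtain r where "x $ r \<noteq> y $ r" by (auto simp: vec_eq_iff)
      then have "(\<Prod>r\<in>UNIV. of_bool (x $ r = y $ r) :: real) = 0"
        by (intro prod_zero) auto
      then show ?thesis using False by simp
    qed simp
    have "(\<Sum>y\<in>Y. F y * of_bool (x = y)) = (\<Sum>y\<in>Y. if y = x then F y else 0)"
      by (intro sum.cong) auto
    then show ?thesis unfolding eq using finY that by simp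
  qed
  have "(\<Sum>a\<in>A. W a * F (P a)) = (\<Sum>a\<in>A. W a * (\<Sum>y\<in>Y. F y * (\<Prod>r\<in>UNIV. of_bool (P a $ r = y $ r))))"
    by (intro sum.cong refl arg_cong2[where f = "(*)"] F) (simp add: Y_def)
  also have "\<dots> = (\<Sum>y\<in>Y. F y * (\<Sum>a\<in>A. W a * (\<Prod>r\<in>UNIV. of_bool (P a $ r = y $ r))))"
    unfolding sum_distrib_left by (subst sum.swap) (simp add: mult_ac)
  also have "\<dots> = (\<Sum>y\<in>Y. F y * (\<Sum>b\<in>B. W' b * (\<Prod>r\<in>UNIV. of_bool (P' b $ r = y $ r))))"
    using prod[of "\<lambda>r c. of_bool (c = y $ r)" for y] by simp
  also have "\<dots> = (\<Sum>b\<in>B. W' b * (\<Sum>y\<in>Y. F y * (\<Prod>r\<in>UNIV. of_bool (P' b $ r = y $ r))))"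
    unfolding sum_distrib_left by (subst sum.swap) (simp add: mult_ac)
  also have "\<dots> = (\<Sum>b\<in>B. W' b * F (P' b))"
    by (intro sum.cong refl arg_cong2[where f = "(*)"] F[symmetric]) (simp add: Y_def)
  finally show ?thesis .
qed


section \<open>Corner differences and integrals over boxes\<close>

definition upd_coord :: "'p \<Rightarrow> 'a \<Rightarrow> 'a ^ 'p \<Rightarrow> 'a ^ 'p" where
  "upd_coord r t x = (\<chi> s. if s = r then t else x $ s)"

lemma upd_coord_nth: "upd_coord r t x $ s = (if s = r then t else x $ s)"
  by (simp add: upd_coord_def)

text \<open>
The alternating sum of the values of \<open>F\<close> at the corners of the box from \<open>a\<close> to \<open>b\<close> in the
coordinates of \<open>S\<close>, the other coordinates being those of \<open>x\<close>. Equivalently, the composition of the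
one-dimensional differences over \<open>S\<close>, which is visibly independent of their order.
\<close>

definition box_diff :: "'p::finite set \<Rightarrow> real ^ 'p \<Rightarrow> real ^ 'p \<Rightarrow> (real ^ 'p \<Rightarrow> real) \<Rightarrow> real ^ 'p \<Rightarrow> real" where
  "box_diff S a b F x = (\<Sum>J\<in>Pow S. (-1) ^ card (S - J) *
     F (\<chi> r. if r \<in> J then b $ r else if r \<in> S then a $ r else x $ r))"

lemma box_diff_empty: "box_diff {} a b F x = F x"
  by (simp add: box_diff_def)

lemma box_diff_insert:
  assumes "r \<notin> S"
  shows "box_diff (insert r S) a b F x = box_diff S a b F (upd_coord r (b $ r) x) - box_diff S a b F (upd_coord r (a $ r) x)"
proof -
  have disj: "Pow S \<inter> insert r ` Pow S = {}" using assms by auto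
  have inj: "inj_on (insert r) (Pow S)"
    using assms by (auto simp: inj_on_def)
  let ?g = "\<lambda>J. (-1) ^ card (insert r S - J) *
     F (\<chi> s. if s \<in> J then b $ s else if s \<in> insert r S then a $ s else x $ s)"
  have "box_diff (insert r S) a b F x = sum ?g (insert r ` Pow S) + sum ?g (Pow S)"
    unfolding box_diff_def Pow_insert using disj by (subst sum.union_disjoint) auto
  also have "sum ?g (insert r ` Pow S) = box_diff S a b F (upd_coord r (b $ r) x)"
    unfolding box_diff_def sum.reindex[OF inj] o_def
  proof (intro sum.cong refl arg_cong2[where f = "(*)"] arg_cong[where f = F])
    fix J assume J: "J \<in> Pow S"
    then have "insert r S - insert r J = S - J" using assms by auto
    then show "(-1 :: real) ^ card (insert r S - insert r J) = (-1) ^ card (S - J)" by simp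
  qed (use assms in \<open>auto simp: vec_eq_iff upd_coord_nth\<close>)
  also have "sum ?g (Pow S) = - box_diff S a b F (upd_coord r (a $ r) x)"
    unfolding box_diff_def sum_negf[symmetric] minus_mult_left
  proof (intro sum.cong refl arg_cong2[where f = "(*)"] arg_cong[where f = F])
    fix J assume J: "J \<in> Pow S"
    then have "insert r S - J = insert r (S - J)" using assms by auto
    then show "(-1 :: real) ^ card (insert r S - J) = - ((-1) ^ card (S - J))"
      using assms by simp
  qed (use assms in \<open>auto simp: vec_eq_iff upd_coord_nth\<close>)
  finally show ?thesis by simp
qed

lemma box_diff_cong:
  assumes "\<And>r. r \<in> S \<Longrightarrow> a $ r = a' $ r" "\<And>r. r \<in> S \<Longrightarrow> b $ r = b' $ r"
    and "\<And>r. r \<notin> S \<Longrightarrow> x $ r = x' $ r"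
  shows "box_diff S a b F x = box_diff S a' b' F x'"
  unfolding box_diff_def using assms
  by (intro sum.cong refl arg_cong2[where f = "(*)"] arg_cong[where f = F]) (auto simp: vec_eq_iff)

lemma has_partial_line:
  assumes "has_partial r F"
  shows "((\<lambda>t. F (x + t *\<^sub>R axis r 1)) has_real_derivative partial r F (x + t *\<^sub>R axis r 1)) (at t)"
proof -
  have "((\<lambda>s. F (x + t *\<^sub>R axis r 1 + s *\<^sub>R axis r 1)) has_real_derivative
      partial r F (x + t *\<^sub>R axis r 1)) (at (t - t))"
    using assms unfolding has_partial_def partial_def
    by (simp add: DERIV_deriv_iff_real_differentiable)
  then have "((\<lambda>s. F (x + t *\<^sub>R axis r 1 + (s - t) *\<^sub>R axis r 1)) has_real_derivative
      partial r F (x + t *\<^sub>R axis r 1) * 1) (at t)"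
    by (rule DERIV_chain2) (auto intro!: derivative_eq_intros)
  moreover have "x + t *\<^sub>R axis r 1 + (s - t) *\<^sub>R axis r 1 = x + s *\<^sub>R axis r 1" for s
    by (simp add: scaleR_diff_left)
  ultimately show ?thesis by simp
qed

lemma has_partial_upd_coord:
  assumes "has_partial r F"
  shows "((\<lambda>t. F (upd_coord r t x)) has_real_derivative partial r F (upd_coord r t x)) (at t)"
proof -
  have eq: "upd_coord r 0 x + t *\<^sub>R axis r 1 = upd_coord r t x" for t
    by (auto simp: vec_eq_iff upd_coord_nth axis_def)
  show ?thesis using has_partial_line[OF assms, of "upd_coord r 0 x" t] unfolding eq .
qed

lemma box_diff_has_derivative:
  assumes "has_partial r F" "r \<notin> S"
  shows "((\<lambda>t. box_diff S a b F (upd_coord r t x)) has_real_derivative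
    box_diff S a b (partial r F) (upd_coord r t x)) (at t)"
proof -
  have eq: "(\<chi> s. if s \<in> J then b $ s else if s \<in> S then a $ s else upd_coord r t x $ s) =
      upd_coord r t (\<chi> s. if s \<in> J then b $ s else if s \<in> S then a $ s else x $ s)"
    if "J \<in> Pow S" for J t
    using that assms(2) by (auto simp: vec_eq_iff upd_coord_nth)
  have "box_diff S a b F (upd_coord r t x) = (\<Sum>J\<in>Pow S. (-1) ^ card (S - J) *
     F (upd_coord r t (\<chi> r. if r \<in> J then b $ r else if r \<in> S then a $ r else x $ r)))" for t F
    unfolding box_diff_def
    by (intro sum.cong refl arg_cong2[where f = "(*)"] arg_cong[where f = F] eq)
  then show ?thesis
    by (simp only:) (intro DERIV_sum DERIV_cmult has_partial_upd_coord assms(1))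
qed

lemma iter_partial_snoc: "iter_partial (rs @ [r]) F = iter_partial rs (partial r F)"
  by (induction rs) auto

lemma has_iter_partial_snoc:
  "has_iter_partial (rs @ [r]) F \<longleftrightarrow> has_partial r F \<and> has_iter_partial rs (partial r F)"
  by (induction rs) (auto simp: iter_partial_snoc)

text \<open>
The mean value theorem in each coordinate, from the innermost derivative outwards. The
iterated derivatives need to exist in the order in which they are taken, which is all that
\<open>antiderivative\<close> provides. The lemma serves both for integrating \<open>f\<close> and for the symmetry of second derivatives.
\<close>

lemma box_diff_mean_value:
  assumes "distinct rs" "has_iter_partial rs F" "\<And>r. r \<in> set rs \<Longrightarrow> a $ r \<le> b $ r"
  shows "\<exists>\<xi>. (\<forall>r\<in>set rs. a $ r \<le> \<xi> $ r \<and> \<xi> $ r \<le> b $ r) \<and> (\<forall>r. r \<notin> set rs \<longrightarrow> \<xi> $ r = x $ r) \<and>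
     box_diff (set rs) a b F x = (\<Prod>r\<in>set rs. b $ r - a $ r) * iter_partial rs F \<xi>"
  using assms
proof (induction rs arbitrary: F x rule: rev_induct)
  case Nil
  then show ?case by (auto simp: box_diff_empty intro!: exI[of _ x])
next
  case (snoc r rs)
  have r: "r \<notin> set rs" "distinct rs" using snoc.prems by auto
  have F: "has_partial r F" "has_iter_partial rs (partial r F)"
    using snoc.prems by (auto simp: has_iter_partial_snoc)
  define H where "H t = box_diff (set rs) a b F (upd_coord r t x)" for t
  have H': "(H has_real_derivative box_diff (set rs) a b (partial r F) (upd_coord r t x)) (at t)" for t
    unfolding H_def by (rule box_diff_has_derivative[OF F(1) r(1)])
  \<comment> \<open>A degenerate side has to be treated apart: there any \<open>t\<close> will do, since both sides vanish.\<close>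
  obtain t where t: "a $ r \<le> t" "t \<le> b $ r"
    "H (b $ r) - H (a $ r) = (b $ r - a $ r) * box_diff (set rs) a b (partial r F) (upd_coord r t x)"
  proof (cases "a $ r = b $ r")
    case True
    then show ?thesis using that by auto
  next
    case False
    then have "a $ r < b $ r" using snoc.prems(3)[of r] by auto
    then obtain t where "a $ r < t" "t < b $ r"
        "H (b $ r) - H (a $ r) = (b $ r - a $ r) * box_diff (set rs) a b (partial r F) (upd_coord r t x)"
      using MVT2[of "a $ r" "b $ r" H "\<lambda>t. box_diff (set rs) a b (partial r F) (upd_coord r t x)"] H'
      by blast
    then show ?thesis using that[of t] by simp
  qed
  obtain \<xi> where \<xi>: "\<forall>s\<in>set rs. a $ s \<le> \<xi> $ s \<and> \<xi> $ s \<le> b $ s"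
      "\<forall>s. s \<notin> set rs \<longrightarrow> \<xi> $ s = upd_coord r t x $ s"
      "box_diff (set rs) a b (partial r F) (upd_coord r t x) =
         (\<Prod>s\<in>set rs. b $ s - a $ s) * iter_partial rs (partial r F) \<xi>"
    using snoc.IH[OF r(2) F(2), of "upd_coord r t x"] snoc.prems(3) by auto
  have "box_diff (set (rs @ [r])) a b F x = H (b $ r) - H (a $ r)"
    unfolding H_def by (simp add: box_diff_insert r)
  also have "\<dots> = (\<Prod>s\<in>set (rs @ [r]). b $ s - a $ s) * iter_partial (rs @ [r]) F \<xi>"
    using r by (simp add: t(3) \<xi>(3) iter_partial_snoc)
  finally have "box_diff (set (rs @ [r])) a b F x =
      (\<Prod>s\<in>set (rs @ [r]). b $ s - a $ s) * iter_partial (rs @ [r]) F \<xi>" .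
  moreover have "\<forall>s\<in>set (rs @ [r]). a $ s \<le> \<xi> $ s \<and> \<xi> $ s \<le> b $ s"
    using \<xi>(1,2) r t(1,2) by (auto simp: upd_coord_nth)
  moreover have "\<forall>s. s \<notin> set (rs @ [r]) \<longrightarrow> \<xi> $ s = x $ s"
    using \<xi>(2) by (auto simp: upd_coord_nth)
  ultimately show ?case by blast
qed

text \<open>
The fundamental theorem of calculus on boxes. Corner differences are additive when a box is cut,
so over a tagged division they add up to the corner difference of the whole box. On each small tile
the mean value theorem replaces the corner difference by volume times a value of the
derivative, which by uniform continuity is close to the value at the tag. Thus Riemann sums converge
to the corner difference.
\<close>

lemma has_integral_iter_partial:
  fixes F :: "real ^ 'p::finite \<Rightarrow> real"
  assumes rs: "distinct rs" "set rs = UNIV" and F: "has_iter_partial rs F"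
    and cont: "continuous_on (cbox a b) (iter_partial rs F)" and ab: "\<And>r. a $ r \<le> b $ r"
  shows "(iter_partial rs F has_integral box_diff UNIV a b F x) (cbox a b)"
proof -
  define f where "f = iter_partial rs F"
  \<comment> \<open>The corner difference as a function of the box; the case of the empty box makes it well defined on all sets \<open>cbox u v\<close>.\<close>
  define \<Psi> where "\<Psi> K = (if K = {} then 0 else
      box_diff UNIV (interval_lowerbound K) (interval_upperbound K) F x)" for K :: "(real ^ 'p) set"
  have bounds: "interval_lowerbound (cbox u v) = u" "interval_upperbound (cbox u v) = v"
    if "\<And>r. u $ r \<le> v $ r" for u v :: "real ^ 'p"
    using that by (subst interval_lowerbound interval_upperbound; auto simp: Basis_vec_def inner_axis)+
  have \<Psi>_cbox: "\<Psi> (cbox u v) = box_diff UNIV u v F x" if "\<And>r. u $ r \<le> v $ r" for u v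
    using that interval_ne_empty_cart(1)[of u v] by (auto simp: \<Psi>_def bounds)
  have \<Psi>_split: "box_diff UNIV u v F x =
      box_diff (UNIV - {r}) u v F (upd_coord r (v $ r) x) - box_diff (UNIV - {r}) u v F (upd_coord r (u $ r) x)"
    for u v r
    using box_diff_insert[of r "UNIV - {r}" u v F x] by (simp add: insert_absorb)
  interpret op: operative "(+)" 0 \<Psi>
  proof
    fix u v :: "real ^ 'p" assume "box u v = {}"
    then obtain r where r: "v $ r \<le> u $ r"
      by (auto simp: interval_eq_empty_cart)
    show "\<Psi> (cbox u v) = 0"
    proof (cases "cbox u v = {}")
      case True
      then show ?thesis by (simp add: \<Psi>_def)
    next
      case False
      then have le: "u $ s \<le> v $ s" for s by (simp add: interval_ne_empty_cart)
      with r have "u $ r = v $ r" by (simp add: antisym)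
      then show ?thesis using le by (simp add: \<Psi>_cbox \<Psi>_split[of u v r])
    qed
  next
    fix u v :: "real ^ 'p" and c k assume "k \<in> (Basis :: (real ^ 'p) set)"
    then obtain r where k: "k = axis r 1" by (auto simp: Basis_vec_def)
    have L: "cbox u v \<inter> {x. x \<bullet> k \<le> c} = cbox u (upd_coord r (min (v $ r) c) v)"
      and R: "cbox u v \<inter> {x. c \<le> x \<bullet> k} = cbox (upd_coord r (max (u $ r) c) u) v"
      using interval_split_cart[where a = u and b = v and k = r and c = c]
      by (simp_all add: k inner_axis upd_coord_def interval_cbox_cart)
    have coord: "u $ r \<le> y \<bullet> k \<and> y \<bullet> k \<le> v $ r" if "y \<in> cbox u v" for y
      using that by (simp add: mem_box_cart k inner_axis)
    consider "cbox u v = {}" | "cbox u v \<noteq> {}" "c < u $ r" | "cbox u v \<noteq> {}" "v $ r < c"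
      | "cbox u v \<noteq> {}" "u $ r \<le> c" "c \<le> v $ r"
      by linarith
    then show "\<Psi> (cbox u v) = \<Psi> (cbox u v \<inter> {x. x \<bullet> k \<le> c}) + \<Psi> (cbox u v \<inter> {x. x \<bullet> k \<ge> c})"
    proof cases
      case 1
      then show ?thesis by (simp add: \<Psi>_def)
    next
      case 2
      then have "cbox u v \<inter> {x. x \<bullet> k \<le> c} = {}" "cbox u v \<inter> {x. c \<le> x \<bullet> k} = cbox u v"
        using coord by force+
      then show ?thesis by (simp add: \<Psi>_def)
    next
      case 3
      then have "cbox u v \<inter> {x. x \<bullet> k \<le> c} = cbox u v" "cbox u v \<inter> {x. c \<le> x \<bullet> k} = {}"
        using coord by force+
      then show ?thesis by (simp add: \<Psi>_def)
    next
      case 4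
      then have le: "u $ s \<le> v $ s" for s by (simp add: interval_ne_empty_cart)
      have c: "min (v $ r) c = c" "max (u $ r) c = c" using 4 by auto
      have "\<Psi> (cbox u v \<inter> {x. x \<bullet> k \<le> c}) = box_diff UNIV u (upd_coord r c v) F x"
        unfolding L c using le 4 by (intro \<Psi>_cbox) (simp add: upd_coord_nth)
      also have "\<dots> = box_diff (UNIV - {r}) u v F (upd_coord r c x) - box_diff (UNIV - {r}) u v F (upd_coord r (u $ r) x)"
        unfolding \<Psi>_split[of _ _ r]
        by (intro arg_cong2[where f = "(-)"] box_diff_cong) (auto simp: upd_coord_nth)
      finally have 1: "\<Psi> (cbox u v \<inter> {x. x \<bullet> k \<le> c}) = \<dots>" .
      have "\<Psi> (cbox u v \<inter> {x. x \<bullet> k \<ge> c}) = box_diff UNIV (upd_coord r c u) v F x"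
        unfolding R c using le 4 by (intro \<Psi>_cbox) (simp add: upd_coord_nth)
      also have "\<dots> = box_diff (UNIV - {r}) u v F (upd_coord r (v $ r) x) - box_diff (UNIV - {r}) u v F (upd_coord r c x)"
        unfolding \<Psi>_split[of _ _ r]
        by (intro arg_cong2[where f = "(-)"] box_diff_cong) (auto simp: upd_coord_nth)
      finally show ?thesis
        using le by (simp add: 1 \<Psi>_cbox \<Psi>_split[of u v r])
    qed
  qed
  have "(f has_integral box_diff UNIV a b F x) (cbox a b)"
    unfolding has_integral
  proof (intro allI impI)
    fix e :: real assume e: "e > 0"
    define e' where "e' = e / (measure lborel (cbox a b) + 1)"
    have e': "e' > 0" "e' * measure lborel (cbox a b) < e"
    proof -
      have "measure lborel (cbox a b) + 1 > 0"
        using measure_nonneg[of lborel "cbox a b"] by linarith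
      then show "e' > 0" "e' * measure lborel (cbox a b) < e"
        using e by (auto simp: e'_def field_simps)
    qed
    have "uniformly_continuous_on (cbox a b) f"
      using cont unfolding f_def by (intro compact_uniformly_continuous) auto
    then obtain d where d: "d > 0" "\<And>x y. x \<in> cbox a b \<Longrightarrow> y \<in> cbox a b \<Longrightarrow> dist y x < d \<Longrightarrow> dist (f y) (f x) < e'"
      using e'(1) unfolding uniformly_continuous_on_def by meson
    show "\<exists>\<gamma>. gauge \<gamma> \<and> (\<forall>\<D>. \<D> tagged_division_of cbox a b \<and> \<gamma> fine \<D> \<longrightarrow>
        norm ((\<Sum>(x, k)\<in>\<D>. measure lborel k *\<^sub>R f x) - box_diff UNIV a b F x) < e)"
    proof (intro exI[of _ "\<lambda>x. ball x d"] conjI allI impI)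
      fix \<D> assume D: "\<D> tagged_division_of cbox a b \<and> (\<lambda>x. ball x d) fine \<D>"
      have tile: "\<bar>measure lborel K * f y - \<Psi> K\<bar> \<le> e' * measure lborel K" if yK: "(y, K) \<in> \<D>" for y K
      proof -
        have "y \<in> K" "K \<subseteq> cbox a b" "\<exists>u v. K = cbox u v"
          using D yK tagged_division_ofD(2-4)[of \<D> "cbox a b" y K] by auto
        moreover have "K \<subseteq> ball y d"
          using D yK by (auto simp: fine_def)
        ultimately obtain u v where K: "K = cbox u v" "y \<in> K" "K \<subseteq> cbox a b" "K \<subseteq> ball y d"
          by blast
        then have le: "u $ r \<le> v $ r" for r
          using interval_ne_empty_cart(1)[of u v] by auto
        obtain \<xi> where \<xi>: "\<forall>r. u $ r \<le> \<xi> $ r \<and> \<xi> $ r \<le> v $ r"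
            "box_diff UNIV u v F x = (\<Prod>r\<in>UNIV. v $ r - u $ r) * f \<xi>"
          using box_diff_mean_value[OF rs(1) F, of u v x] le unfolding rs(2) f_def by auto
        have "\<xi> \<in> K" using \<xi>(1) by (simp add: K mem_box_cart)
        then have "dist (f \<xi>) (f y) < e'"
          using K by (intro d) (auto simp: dist_commute)
        then have fe: "\<bar>f y - f \<xi>\<bar> \<le> e'" by (simp add: dist_real_def)
        have "\<Psi> K = measure lborel K * f \<xi>"
          using le K interval_ne_empty_cart(1)[of u v] by (simp add: \<Psi>_cbox \<xi>(2) content_cbox_cart)
        then have "\<bar>measure lborel K * f y - \<Psi> K\<bar> = measure lborel K * \<bar>f y - f \<xi>\<bar>"
          by (simp add: abs_mult flip: right_diff_distrib)
        also have "\<dots> \<le> e' * measure lborel K"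
          using mult_right_mono[OF fe measure_nonneg[of lborel K]] by (simp add: mult.commute)
        finally show ?thesis .
      qed
      have "box_diff UNIV a b F x = (\<Sum>(y, K)\<in>\<D>. \<Psi> K)"
        using op.tagged_division[of \<D> a b, folded sum_def] D ab by (simp add: \<Psi>_cbox)
      then have "(\<Sum>(y, K)\<in>\<D>. measure lborel K *\<^sub>R f y) - box_diff UNIV a b F x =
          (\<Sum>(y, K)\<in>\<D>. measure lborel K * f y - \<Psi> K)"
        by (simp add: case_prod_unfold sum_subtractf)
      also have "norm \<dots> \<le> (\<Sum>(y, K)\<in>\<D>. e' * measure lborel K)"
        unfolding real_norm_def using tile by (intro order_trans[OF sum_abs] sum_mono) auto
      also have "\<dots> = e' * measure lborel (cbox a b)"
        using additive_content_tagged_division[of \<D> a b] D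
        by (simp add: case_prod_unfold flip: sum_distrib_left)
      also have "\<dots> < e" by (rule e'(2))
      finally show "norm ((\<Sum>(x, k)\<in>\<D>. measure lborel k *\<^sub>R f x) - box_diff UNIV a b F x) < e" .
    qed (use d(1) in auto)
  qed
  then show ?thesis by (simp add: f_def)
qed


section \<open>Symmetry of higher derivatives\<close>

lemma cont_diff_continuous: "cont_diff k h \<Longrightarrow> continuous_on S h"
  by (cases k) (auto intro: continuous_on_subset)

lemma cont_diff_mono: "cont_diff k h \<Longrightarrow> l \<le> k \<Longrightarrow> cont_diff l h"
proof (induction l arbitrary: k h)
  case 0
  then show ?case using cont_diff_continuous by auto
next
  case (Suc l)
  then obtain k' where "k = Suc k'" "l \<le> k'" by (cases k) auto
  with Suc show ?case by auto
qed

lemma cont_diff_iter_partial: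
  assumes "cont_diff (length rs + k) h"
  shows "cont_diff k (iter_partial rs h) \<and> has_iter_partial rs h"
  using assms
proof (induction rs arbitrary: k)
  case (Cons r rs)
  then have "cont_diff (Suc k) (iter_partial rs h) \<and> has_iter_partial rs h"
    using Cons.IH[of "Suc k"] Cons.prems by (simp del: cont_diff.simps)
  then show ?case by simp
qed simp

text \<open>
Divide the corner difference over a square with sides \<open>1 / (n + 1)\<close> in the directions \<open>r\<close> and \<open>s\<close> by
the area. By the mean value theorem in the two possible orders, the quotient is a value of
each of the two mixed derivatives, at points that tend to \<open>x\<close>.
\<close>

lemma partial_commute:
  fixes h :: "real ^ 'p::finite \<Rightarrow> real"
  assumes h: "cont_diff 2 h"
  shows "partial r (partial s h) = partial s (partial r h)"
proof (cases "r = s")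
  case False
  show ?thesis
  proof
    fix x :: "real ^ 'p"
    define b :: "nat \<Rightarrow> real ^ 'p" where "b n = (\<chi> i. x $ i + 1 / real (Suc n))" for n
    have xb: "x $ i \<le> b n $ i" for i n by (simp add: b_def)
    have mean: "\<exists>\<xi>. \<xi> \<longlonglongrightarrow> x \<and>
        (\<forall>n. box_diff {r, s} x (b n) h x = (1 / real (Suc n))\<^sup>2 * partial r (partial s h) (\<xi> n))"
      if rs: "r \<noteq> s" for r s
    proof -
      have part: "has_iter_partial [r, s] h" using h by (auto simp: numeral_2_eq_2)
      have "\<exists>\<xi>. (\<forall>i. x $ i \<le> \<xi> $ i \<and> \<xi> $ i \<le> b n $ i) \<and>
          box_diff {r, s} x (b n) h x = (1 / real (Suc n))\<^sup>2 * partial r (partial s h) \<xi>" for n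
      proof -
        obtain \<xi> where \<xi>: "\<forall>i\<in>set [r, s]. x $ i \<le> \<xi> $ i \<and> \<xi> $ i \<le> b n $ i"
            "\<forall>i. i \<notin> set [r, s] \<longrightarrow> \<xi> $ i = x $ i"
            "box_diff (set [r, s]) x (b n) h x =
               (\<Prod>i\<in>set [r, s]. b n $ i - x $ i) * iter_partial [r, s] h \<xi>"
          using box_diff_mean_value[OF _ part, of x "b n" x] xb rs by auto
        have "x $ i \<le> \<xi> $ i \<and> \<xi> $ i \<le> b n $ i" for i
          using \<xi>(1,2) xb by (cases "i \<in> set [r, s]") auto
        then show ?thesis using \<xi>(3) rs by (auto simp: b_def power2_eq_square)
      qed
      then obtain \<xi> where \<xi>: "\<forall>n. (\<forall>i. x $ i \<le> \<xi> n $ i \<and> \<xi> n $ i \<le> b n $ i) \<and>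
          box_diff {r, s} x (b n) h x = (1 / real (Suc n))\<^sup>2 * partial r (partial s h) (\<xi> n)"
        using choice[of "\<lambda>n \<xi>. (\<forall>i. x $ i \<le> \<xi> $ i \<and> \<xi> $ i \<le> b n $ i) \<and>
          box_diff {r, s} x (b n) h x = (1 / real (Suc n))\<^sup>2 * partial r (partial s h) \<xi>"] by blast
      have "\<xi> \<longlonglongrightarrow> x"
      proof (rule vec_tendstoI)
        fix i
        have lim: "(\<lambda>n. x $ i + 1 / real (Suc n)) \<longlonglongrightarrow> x $ i"
          using tendsto_add[OF tendsto_const LIMSEQ_inverse_real_of_nat, of "x $ i"]
          by (simp add: inverse_eq_divide)
        have "x $ i \<le> \<xi> n $ i" "\<xi> n $ i \<le> b n $ i" for n
          using \<xi> by blast+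
        then show "(\<lambda>n. \<xi> n $ i) \<longlonglongrightarrow> x $ i"
          by (intro real_tendsto_sandwich[OF _ _ tendsto_const lim]) (simp_all add: b_def)
      qed
      with \<xi> show ?thesis by blast
    qed
    obtain \<xi> \<eta> where lim: "\<xi> \<longlonglongrightarrow> x" "\<eta> \<longlonglongrightarrow> x"
      and \<xi>: "\<And>n. box_diff {r, s} x (b n) h x = (1 / real (Suc n))\<^sup>2 * partial r (partial s h) (\<xi> n)"
      and \<eta>: "\<And>n. box_diff {s, r} x (b n) h x = (1 / real (Suc n))\<^sup>2 * partial s (partial r h) (\<eta> n)"
      using mean[of r s] mean[of s r] False by blast
    have cont: "continuous_on UNIV (partial r (partial s h))" "continuous_on UNIV (partial s (partial r h))"
      using h by (auto simp: numeral_2_eq_2)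
    have "(\<lambda>n. partial r (partial s h) (\<xi> n)) \<longlonglongrightarrow> partial r (partial s h) x"
      by (rule continuous_on_tendsto_compose[OF cont(1) lim(1)]) auto
    moreover have "(\<lambda>n. partial s (partial r h) (\<eta> n)) \<longlonglongrightarrow> partial s (partial r h) x"
      by (rule continuous_on_tendsto_compose[OF cont(2) lim(2)]) auto
    moreover have "partial r (partial s h) (\<xi> n) = partial s (partial r h) (\<eta> n)" for n
      using \<xi>[of n] \<eta>[of n] by (simp add: insert_commute)
    ultimately show "partial r (partial s h) x = partial s (partial r h) x"
      using LIMSEQ_unique by simp
  qed
qed simp

lemma partial_iter_partial_commute:
  assumes "cont_diff (Suc (length rs)) h"
  shows "partial r (iter_partial rs h) = iter_partial rs (partial r h)"
  using assms
proof (induction rs)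
  case (Cons s rs)
  have "cont_diff 2 (iter_partial rs h)"
    using Cons.prems cont_diff_iter_partial[of rs 2 h] by (simp add: numeral_2_eq_2)
  then have "partial r (iter_partial (s # rs) h) = partial s (partial r (iter_partial rs h))"
    using partial_commute by simp
  also have "\<dots> = partial s (iter_partial rs (partial r h))"
    using Cons cont_diff_mono[of "Suc (length (s # rs))" h "Suc (length rs)"] by simp
  finally show ?case by simp
qed simp

lemma iter_partial_append: "iter_partial (xs @ ys) h = iter_partial xs (iter_partial ys h)"
  by (induction xs) auto

lemma iter_partial_permute:
  assumes "mset rs = mset rs'" "cont_diff (length rs) h"
  shows "iter_partial rs h = iter_partial rs' h"
  using assms
proof (induction rs arbitrary: rs')
  case (Cons r rs)
  then have "r \<in> set rs'" by (metis list.set_intros(1) mset_eq_setD)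
  then obtain xs ys where rs': "rs' = xs @ r # ys" by (auto simp: in_set_conv_decomp)
  then have eq: "mset rs = mset (xs @ ys)" using Cons.prems by simp
  then have len: "length rs = length xs + length ys"
    by (metis length_append mset_eq_length)
  have "cont_diff (Suc (length xs)) (iter_partial ys h)"
    using Cons.prems(2) cont_diff_iter_partial[of ys "Suc (length xs)" h] len by (simp add: add.commute)
  then have "iter_partial rs' h = partial r (iter_partial (xs @ ys) h)"
    by (simp add: rs' iter_partial_append partial_iter_partial_commute)
  also have "iter_partial (xs @ ys) h = iter_partial rs h"
    using Cons.IH[OF eq] Cons.prems(2) cont_diff_mono[of "Suc (length rs)" h "length rs"] by simp
  finally show ?case by simp
qed simp

lemma count_directions: "count (mset (directions \<alpha>)) s = \<alpha> $ s"
proof -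
  have "distinct L \<Longrightarrow> count (mset (concat (map (\<lambda>r. replicate (\<alpha> $ r) r) L))) s = (if s \<in> set L then \<alpha> $ s else 0)"
    for L by (induction L) auto
  from this[of "sorted_list_of_set UNIV"] show ?thesis by (simp add: directions_def)
qed

lemma length_directions: "length (directions \<alpha>) = mi_norm \<alpha>"
  by (simp add: directions_def mi_norm_def length_concat o_def
      sum_list_distinct_conv_sum_set)

lemma directions_1: "distinct (directions (1 :: nat ^ 'p::{finite,linorder}))" "set (directions (1 :: nat ^ 'p::{finite,linorder})) = UNIV"
proof -
  have "directions (1 :: nat ^ 'p::{finite,linorder}) = concat (map (\<lambda>r. [r]) (sorted_list_of_set UNIV))"
    by (simp add: directions_def)
  then have eq: "directions (1 :: nat ^ 'p::{finite,linorder}) = sorted_list_of_set UNIV" by simp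
  show "distinct (directions (1 :: nat ^ 'p::{finite,linorder}))" "set (directions (1 :: nat ^ 'p::{finite,linorder})) = UNIV"
    unfolding eq by simp_all
qed

lemma mi_norm_add_axis: "mi_norm (\<alpha> + axis r 1) = Suc (mi_norm \<alpha>)"
  by (simp add: mi_norm_def sum.distrib axis_def)

text \<open>
Symmetry of the derivatives in the form in which it is used: a further derivative in direction \<open>r\<close>
may be sorted into its place among \<open>directions \<alpha>\<close>.
\<close>

lemma mderiv_add_axis:
  assumes "cont_diff (Suc (mi_norm \<alpha>)) h"
  shows "partial r (mderiv \<alpha> h) = mderiv (\<alpha> + axis r 1) h"
proof -
  have "mset (r # directions \<alpha>) = mset (directions (\<alpha> + axis r 1))"
    by (rule multiset_eqI) (simp add: count_directions axis_def)
  then have "iter_partial (r # directions \<alpha>) h = iter_partial (directions (\<alpha> + axis r 1)) h"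
    using assms by (intro iter_partial_permute) (auto simp: length_directions)
  then show ?thesis by (simp add: mderiv_def)
qed

lemma cont_diff_mderiv:
  assumes "cont_diff (mi_norm \<alpha> + k) h"
  shows "cont_diff k (mderiv \<alpha> h)"
  using assms cont_diff_iter_partial[of "directions \<alpha>" k h] by (simp add: mderiv_def length_directions)

lemma continuous_on_mderiv:
  assumes "cont_diff k f" "\<alpha> \<in> multi_indices k"
  shows "continuous_on S (mderiv \<alpha> f)"
  using assms cont_diff_mderiv[of \<alpha> 0 f] cont_diff_continuous[of 0 "mderiv \<alpha> f"]
  by (simp add: multi_indices_def)


section \<open>Taylor's formula\<close>

text \<open>
Induction on the set of coordinates in which the direction \<open>u\<close> may be nonzero. One more
coordinate is split off as a second variable \<open>b\<close>, and the function of the two variables is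
differentiable on the diagonal because one of its partial derivatives is continuous.
\<close>

lemma cont_diff_line_derivative:
  fixes h :: "real ^ 'p::finite \<Rightarrow> real"
  assumes h: "cont_diff 1 h"
  shows "((\<lambda>t. h (x + t *\<^sub>R u)) has_real_derivative (\<Sum>r\<in>UNIV. u $ r * partial r h (x + t *\<^sub>R u))) (at t)"
proof -
  have part: "has_partial r h" and contp: "continuous_on S (partial r h)" for r S
    using h by (auto intro: continuous_on_subset)
  have "\<forall>u x t. (\<forall>r. r \<notin> S \<longrightarrow> u $ r = 0) \<longrightarrow>
      ((\<lambda>t. h (x + t *\<^sub>R u)) has_real_derivative (\<Sum>r\<in>S. u $ r * partial r h (x + t *\<^sub>R u))) (at t)"
    if "finite S" for S
    using that
  proof (induction S)
    case empty
    show ?case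
    proof (intro allI impI)
      fix u x :: "real ^ 'p" and t :: real assume "\<forall>r. r \<notin> {} \<longrightarrow> u $ r = 0"
      then have "u = 0" by (simp add: vec_eq_iff)
      then show "((\<lambda>t. h (x + t *\<^sub>R u)) has_real_derivative (\<Sum>r\<in>{}. u $ r * partial r h (x + t *\<^sub>R u))) (at t)"
        by simp
    qed
  next
    case (insert r S)
    show ?case
    proof (intro allI impI)
      fix u x :: "real ^ 'p" and t :: real assume u: "\<forall>s. s \<notin> insert r S \<longrightarrow> u $ s = 0"
      \<comment> \<open>\<open>a\<close> moves along the old coordinates, \<open>b\<close> along the new one; the diagonal \<open>a = b\<close> is the line.\<close>
      define v where "v = upd_coord r 0 u"
      define H where "H a b = h (x + a *\<^sub>R v + (b * u $ r) *\<^sub>R axis r 1)" for a b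
      have diag: "x + a *\<^sub>R v + (a * u $ r) *\<^sub>R axis r 1 = x + a *\<^sub>R u" for a
        by (auto simp: vec_eq_iff v_def upd_coord_nth axis_def)
      have v: "\<forall>s. s \<notin> S \<longrightarrow> v $ s = 0" using u by (auto simp: v_def upd_coord_nth)
      have vS: "(\<Sum>s\<in>S. v $ s * partial s h y) = (\<Sum>s\<in>S. u $ s * partial s h y)" for y
        using insert.hyps by (intro sum.cong) (auto simp: v_def upd_coord_nth)
      let ?A = "\<Sum>s\<in>S. u $ s * partial s h (x + t *\<^sub>R u)"
      let ?B = "\<lambda>a b. u $ r * partial r h (x + a *\<^sub>R v + (b * u $ r) *\<^sub>R axis r 1)"
      have "((\<lambda>a. h ((x + (t * u $ r) *\<^sub>R axis r 1) + a *\<^sub>R v)) has_real_derivative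
          (\<Sum>s\<in>S. v $ s * partial s h ((x + (t * u $ r) *\<^sub>R axis r 1) + t *\<^sub>R v))) (at t)"
        using insert.IH v by blast
      then have A: "((\<lambda>a. H a t) has_derivative (*) ?A) (at t within UNIV)"
        unfolding vS has_field_derivative_def H_def by (simp add: algebra_simps flip: diag)
      have B: "((\<lambda>b. H a b) has_derivative blinfun_apply (?B a b *\<^sub>R id_blinfun)) (at b within UNIV)" for a b
      proof -
        have "((\<lambda>b. h (x + a *\<^sub>R v + (b * u $ r) *\<^sub>R axis r 1)) has_real_derivative
            partial r h (x + a *\<^sub>R v + (b * u $ r) *\<^sub>R axis r 1) * u $ r) (at b)"
          by (rule DERIV_chain2[OF has_partial_line[OF part]]) (auto intro!: derivative_eq_intros)
        moreover have "blinfun_apply (c *\<^sub>R id_blinfun) = (*) c" for c :: real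
          by (auto simp: fun_eq_iff blinfun.scaleR_left)
        ultimately show ?thesis
          by (simp add: has_field_derivative_def H_def mult.commute)
      qed
      have "continuous_on UNIV (\<lambda>(a, b). ?B a b *\<^sub>R (id_blinfun :: real \<Rightarrow>\<^sub>L real))"
        unfolding case_prod_beta
        by (intro continuous_intros continuous_on_compose2[OF contp[of UNIV]]) auto
      then have "continuous (at (t, t) within UNIV \<times> UNIV) (\<lambda>(a, b). ?B a b *\<^sub>R (id_blinfun :: real \<Rightarrow>\<^sub>L real))"
        by (simp add: continuous_on_eq_continuous_at)
      from has_derivative_partialsI[OF A B this]
      have "((\<lambda>(a, b). H a b) has_derivative (\<lambda>(da, db). ?A * da + blinfun_apply (?B t t *\<^sub>R id_blinfun) db)) (at (t, t))"
        by simp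
      moreover have "((\<lambda>t. (t, t)) has_derivative (\<lambda>d. (d, d))) (at t)"
        by (auto intro!: derivative_eq_intros)
      ultimately have "((\<lambda>t. H t t) has_derivative (\<lambda>d. ?A * d + ?B t t * d)) (at t)"
        using has_derivative_compose[where f = "\<lambda>t. (t, t)" and g = "\<lambda>(a, b). H a b"]
        by (fastforce simp: blinfun.scaleR_left)
      then have "((\<lambda>t. H t t) has_real_derivative (?A + ?B t t)) (at t)"
        unfolding has_field_derivative_def distrib_right[symmetric] .
      then show "((\<lambda>t. h (x + t *\<^sub>R u)) has_real_derivative (\<Sum>s\<in>insert r S. u $ s * partial s h (x + t *\<^sub>R u))) (at t)"
        using insert.hyps by (simp add: H_def diag add.commute)
    qed
  qed
  from this[of UNIV] show ?thesis by simp
qed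

lemma finite_multi_indices: "finite (multi_indices d :: (nat ^ 'p::finite) set)"
proof (rule finite_subset)
  show "multi_indices d \<subseteq> {\<alpha> :: nat ^ 'p. \<forall>r. \<alpha> $ r \<in> {..d}}"
    by (auto simp: multi_indices_def mi_norm_def intro!: member_le_sum)
  show "finite {\<alpha> :: nat ^ 'p. \<forall>r. \<alpha> $ r \<in> {..d}}"
    by (rule finite_vec_box) simp
qed

lemma mi_power_add_axis: "mi_power u (\<alpha> + axis r 1) = u $ r * mi_power u \<alpha>"
proof -
  have "mi_power u (\<alpha> + axis r 1) = (\<Prod>s\<in>UNIV. (if s = r then u $ r else 1) * (u $ s) ^ (\<alpha> $ s))"
    unfolding mi_power_def by (intro prod.cong) (auto simp: axis_def)
  then show ?thesis by (simp add: prod.distrib mi_power_def)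
qed

lemma mi_fact_add_axis: "mi_fact (\<alpha> + axis r 1) = real (Suc (\<alpha> $ r)) * mi_fact \<alpha>"
proof -
  have "mi_fact (\<alpha> + axis r 1) = (\<Prod>s\<in>UNIV. (if s = r then real (Suc (\<alpha> $ r)) else 1) * fact (\<alpha> $ s))"
    unfolding mi_fact_def by (intro prod.cong) (auto simp: axis_def)
  then show ?thesis by (simp add: prod.distrib mi_fact_def)
qed

lemma mi_fact_pos: "mi_fact \<alpha> > 0"
  by (simp add: mi_fact_def prod_pos)

text \<open>
Each \<open>\<beta>\<close> of order \<open>k + 1\<close> arises as \<open>\<alpha> + axis r 1\<close> once for every \<open>r\<close> with \<open>\<beta> $ r > 0\<close>, with the weight
\<open>\<beta> $ r / mi_fact \<beta>\<close>; the numbers \<open>\<beta> $ r\<close> add up to \<open>k + 1\<close>.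
\<close>

lemma sum_multi_indices_Suc:
  fixes u :: "real ^ 'p::finite"
  shows "(\<Sum>\<alpha>\<in>multi_indices k. \<Sum>r\<in>UNIV. u $ r * (mi_power u \<alpha> / mi_fact \<alpha> * G (\<alpha> + axis r 1))) =
   real (Suc k) * (\<Sum>\<beta>\<in>multi_indices (Suc k). mi_power u \<beta> / mi_fact \<beta> * G \<beta>)"
proof -
  have one: "(\<Sum>\<alpha>\<in>multi_indices k. u $ r * (mi_power u \<alpha> / mi_fact \<alpha> * G (\<alpha> + axis r 1))) =
     (\<Sum>\<beta>\<in>multi_indices (Suc k). real (\<beta> $ r) * (mi_power u \<beta> / mi_fact \<beta> * G \<beta>))" for r
  proof -
    have "(\<Sum>\<alpha>\<in>multi_indices k. u $ r * (mi_power u \<alpha> / mi_fact \<alpha> * G (\<alpha> + axis r 1))) =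
       (\<Sum>\<beta> | \<beta> \<in> multi_indices (Suc k) \<and> \<beta> $ r \<noteq> 0. real (\<beta> $ r) * (mi_power u \<beta> / mi_fact \<beta> * G \<beta>))"
    proof (rule sum.reindex_bij_witness[where i = "\<lambda>\<beta>. \<beta> - axis r 1" and j = "\<lambda>\<alpha>. \<alpha> + axis r 1"])
      fix \<beta> assume \<beta>: "\<beta> \<in> {\<beta> \<in> multi_indices (Suc k). \<beta> $ r \<noteq> 0}"
      then show *: "\<beta> - axis r 1 + axis r 1 = \<beta>"
        by (auto simp: vec_eq_iff axis_def)
      show "\<beta> - axis r 1 \<in> multi_indices k"
        using \<beta> mi_norm_add_axis[of "\<beta> - axis r 1" r, unfolded *] by (simp add: multi_indices_def)
    next
      fix \<alpha> :: "nat ^ 'p" assume \<alpha>: "\<alpha> \<in> multi_indices k"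
      show "\<alpha> + axis r 1 - axis r 1 = \<alpha>" by (auto simp: vec_eq_iff axis_def)
      show "\<alpha> + axis r 1 \<in> {\<beta> \<in> multi_indices (Suc k). \<beta> $ r \<noteq> 0}"
        using \<alpha> mi_norm_add_axis[of \<alpha> r] by (simp add: multi_indices_def)
      show "real ((\<alpha> + axis r 1) $ r) * (mi_power u (\<alpha> + axis r 1) / mi_fact (\<alpha> + axis r 1) * G (\<alpha> + axis r 1)) =
          u $ r * (mi_power u \<alpha> / mi_fact \<alpha> * G (\<alpha> + axis r 1))"
        using mi_fact_pos[of \<alpha>] unfolding mi_power_add_axis mi_fact_add_axis
        by (simp add: axis_def del: of_nat_Suc)
    qed
    also have "\<dots> = (\<Sum>\<beta>\<in>multi_indices (Suc k). real (\<beta> $ r) * (mi_power u \<beta> / mi_fact \<beta> * G \<beta>))"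
      by (rule sum.mono_neutral_left) (auto simp: finite_multi_indices)
    finally show ?thesis .
  qed
  have "(\<Sum>\<alpha>\<in>multi_indices k. \<Sum>r\<in>UNIV. u $ r * (mi_power u \<alpha> / mi_fact \<alpha> * G (\<alpha> + axis r 1))) =
     (\<Sum>\<beta>\<in>multi_indices (Suc k). \<Sum>r\<in>UNIV. real (\<beta> $ r) * (mi_power u \<beta> / mi_fact \<beta> * G \<beta>))"
    by (subst sum.swap, simp only: one, subst sum.swap, rule refl)
  also have "\<dots> = (\<Sum>\<beta>\<in>multi_indices (Suc k). real (Suc k) * (mi_power u \<beta> / mi_fact \<beta> * G \<beta>))"
  proof (rule sum.cong)
    fix \<beta> :: "nat ^ 'p" assume "\<beta> \<in> multi_indices (Suc k)"
    then have "(\<Sum>r\<in>UNIV. real (\<beta> $ r)) = real (Suc k)"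
      by (simp add: multi_indices_def mi_norm_def flip: of_nat_sum)
    then show "(\<Sum>r\<in>UNIV. real (\<beta> $ r) * (mi_power u \<beta> / mi_fact \<beta> * G \<beta>)) =
        real (Suc k) * (mi_power u \<beta> / mi_fact \<beta> * G \<beta>)"
      by (simp only: flip: sum_distrib_right)
  qed simp
  finally show ?thesis by (simp add: sum_distrib_left)
qed

text \<open>
The one-dimensional formula along the segment from \<open>x\<close> to \<open>x + u\<close>: the \<open>k\<close>-th derivative of
\<open>s \<mapsto> h (x + s *\<^sub>R u)\<close> is \<open>k!\<close> times the homogeneous part of degree \<open>k\<close>
of the expansion at \<open>x + s *\<^sub>R u\<close>.
\<close>

lemma multivariate_Taylor:
  fixes h :: "real ^ 'p::{finite,linorder} \<Rightarrow> real"
  assumes N: "0 < N" and h: "cont_diff N h"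
  shows "((\<lambda>s. real N * (1 - s) ^ (N - 1) *
      (\<Sum>\<alpha>\<in>multi_indices N. mi_power u \<alpha> / mi_fact \<alpha> * mderiv \<alpha> h (x + s *\<^sub>R u))) has_integral
    h (x + u) - (\<Sum>k<N. \<Sum>\<alpha>\<in>multi_indices k. mi_power u \<alpha> / mi_fact \<alpha> * mderiv \<alpha> h x)) {0..1}"
proof -
  define D where "D k s = fact k * (\<Sum>\<alpha>\<in>multi_indices k. mi_power u \<alpha> / mi_fact \<alpha> * mderiv \<alpha> h (x + s *\<^sub>R u))"
    for k s
  have D: "(D k has_vector_derivative D (Suc k) s) (at s within {0..1})" if "k < N" for k s
  proof -
    have "((\<lambda>s. mderiv \<alpha> h (x + s *\<^sub>R u)) has_real_derivative
        (\<Sum>r\<in>UNIV. u $ r * mderiv (\<alpha> + axis r 1) h (x + s *\<^sub>R u))) (at s)"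
      if \<alpha>: "\<alpha> \<in> multi_indices k" for \<alpha>
    proof -
      have "cont_diff (Suc (mi_norm \<alpha>)) h"
        using cont_diff_mono[OF h, of "Suc k"] \<alpha> \<open>k < N\<close> by (simp add: multi_indices_def del: cont_diff.simps)
      then show ?thesis
        using cont_diff_line_derivative[OF cont_diff_mderiv[of \<alpha> 1 h], of x u s]
        by (simp add: mderiv_add_axis)
    qed
    then have "(D k has_real_derivative fact k * (\<Sum>\<alpha>\<in>multi_indices k. mi_power u \<alpha> / mi_fact \<alpha> *
        (\<Sum>r\<in>UNIV. u $ r * mderiv (\<alpha> + axis r 1) h (x + s *\<^sub>R u)))) (at s)"
      unfolding D_def by (intro DERIV_cmult DERIV_sum)
    also have "(\<Sum>\<alpha>\<in>multi_indices k. mi_power u \<alpha> / mi_fact \<alpha> *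
        (\<Sum>r\<in>UNIV. u $ r * mderiv (\<alpha> + axis r 1) h (x + s *\<^sub>R u))) =
        real (Suc k) * (\<Sum>\<beta>\<in>multi_indices (Suc k). mi_power u \<beta> / mi_fact \<beta> * mderiv \<beta> h (x + s *\<^sub>R u))"
      by (subst sum_multi_indices_Suc[symmetric]) (simp add: sum_distrib_left mult_ac)
    also have "fact k * \<dots> = D (Suc k) s"
      by (simp add: D_def algebra_simps)
    finally show ?thesis
      by (auto simp: has_real_derivative_iff_has_vector_derivative intro: has_vector_derivative_at_within)
  qed
  have zero: "D 0 1 = h (x + u)"
  proof -
    have mi0: "multi_indices 0 = {0 :: nat ^ 'p::{finite,linorder}}"
      by (auto simp: multi_indices_def mi_norm_def vec_eq_iff)
    have "directions (0 :: nat ^ 'p::{finite,linorder}) = []"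
      using length_directions[of "0 :: nat ^ 'p::{finite,linorder}"] by (simp add: mi_norm_def)
    then show ?thesis
      by (simp add: D_def mi0 mi_power_def mi_fact_def mderiv_def)
  qed
  have "((\<lambda>s. ((1 - s) ^ (N - 1) / fact (N - 1)) *\<^sub>R D N s) has_integral
      D 0 1 - (\<Sum>i<N. ((1 - 0) ^ i / fact i) *\<^sub>R D i 0)) {0..1}"
    using D by (intro Taylor_has_integral N) auto
  moreover have "((1 - s) ^ (N - 1) / fact (N - 1)) *\<^sub>R D N s = real N * (1 - s) ^ (N - 1) *
      (\<Sum>\<alpha>\<in>multi_indices N. mi_power u \<alpha> / mi_fact \<alpha> * mderiv \<alpha> h (x + s *\<^sub>R u))" for s
    using N by (cases N) (auto simp: D_def field_simps)
  moreover have "((1 - 0) ^ i / fact i) *\<^sub>R D i 0 = (\<Sum>\<alpha>\<in>multi_indices i. mi_power u \<alpha> / mi_fact \<alpha> * mderiv \<alpha> h x)"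
    for i by (simp add: D_def)
  ultimately show ?thesis by (simp add: zero)
qed

definition Taylor_polynomial :: "nat \<Rightarrow> (real ^ 'p::{finite,linorder} \<Rightarrow> real) \<Rightarrow> real ^ 'p::{finite,linorder} \<Rightarrow> real ^ 'p::{finite,linorder} \<Rightarrow> real" where
  "Taylor_polynomial N h x u = (\<Sum>k<N. \<Sum>\<alpha>\<in>multi_indices k. mi_power u \<alpha> / mi_fact \<alpha> * mderiv \<alpha> h x)"

lemma Taylor_remainder_bound:
  fixes h :: "real ^ 'p::{finite,linorder} \<Rightarrow> real"
  assumes N: "0 < N" and h: "cont_diff N h" and e: "0 \<le> e"
    and bound: "\<And>\<alpha> s. \<alpha> \<in> multi_indices N \<Longrightarrow> s \<in> {0..1} \<Longrightarrow> \<bar>mderiv \<alpha> h (x + s *\<^sub>R u)\<bar> \<le> e"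
  shows "\<bar>h (x + u) - Taylor_polynomial N h x u\<bar> \<le> real N * (\<Sum>\<alpha>\<in>multi_indices N. \<bar>mi_power u \<alpha>\<bar> / mi_fact \<alpha>) * e"
proof -
  let ?C = "\<Sum>\<alpha>\<in>multi_indices N. \<bar>mi_power u \<alpha>\<bar> / mi_fact \<alpha>"
  have pos: "0 \<le> mi_fact \<alpha>" for \<alpha> :: "nat ^ 'p::{finite,linorder}" using mi_fact_pos[of \<alpha>] by simp
  have C: "0 \<le> ?C" using pos by (intro sum_nonneg divide_nonneg_nonneg) auto
  have "norm (h (x + u) - Taylor_polynomial N h x u) \<le> (real N * ?C * e) * measure lborel (cbox 0 (1 :: real))"
  proof (rule has_integral_bound)
    show "((\<lambda>s. real N * (1 - s) ^ (N - 1) *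
      (\<Sum>\<alpha>\<in>multi_indices N. mi_power u \<alpha> / mi_fact \<alpha> * mderiv \<alpha> h (x + s *\<^sub>R u))) has_integral
      h (x + u) - Taylor_polynomial N h x u) (cbox 0 1)"
      using multivariate_Taylor[OF N h, of u x] by (simp add: Taylor_polynomial_def)
    show "0 \<le> real N * ?C * e" using C e by simp
    fix s :: real assume "s \<in> cbox 0 1"
    then have s: "s \<in> {0..1}" by simp
    have "\<bar>\<Sum>\<alpha>\<in>multi_indices N. mi_power u \<alpha> / mi_fact \<alpha> * mderiv \<alpha> h (x + s *\<^sub>R u)\<bar> \<le> ?C * e"
      unfolding sum_distrib_right
    proof (rule order_trans[OF sum_abs], rule sum_mono)
      fix \<alpha> :: "nat ^ 'p::{finite,linorder}" assume "\<alpha> \<in> multi_indices N"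
      from mult_left_mono[OF bound[OF this s], of "\<bar>mi_power u \<alpha>\<bar> / mi_fact \<alpha>"] pos[of \<alpha>]
      show "\<bar>mi_power u \<alpha> / mi_fact \<alpha> * mderiv \<alpha> h (x + s *\<^sub>R u)\<bar> \<le> \<bar>mi_power u \<alpha>\<bar> / mi_fact \<alpha> * e"
        by (simp add: abs_mult)
    qed
    moreover have "\<bar>real N * (1 - s) ^ (N - 1)\<bar> \<le> real N"
      using s by (simp add: abs_mult power_abs mult_left_le power_le_one)
    ultimately have "\<bar>real N * (1 - s) ^ (N - 1)\<bar> *
        \<bar>\<Sum>\<alpha>\<in>multi_indices N. mi_power u \<alpha> / mi_fact \<alpha> * mderiv \<alpha> h (x + s *\<^sub>R u)\<bar> \<le> real N * (?C * e)"
      by (intro mult_mono) auto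
    then show "norm (real N * (1 - s) ^ (N - 1) *
      (\<Sum>\<alpha>\<in>multi_indices N. mi_power u \<alpha> / mi_fact \<alpha> * mderiv \<alpha> h (x + s *\<^sub>R u))) \<le> real N * ?C * e"
      by (simp only: real_norm_def abs_mult mult.assoc)
  qed
  then show ?thesis by simp
qed


section \<open>The remainder as a linear functional\<close>

definition R_kernel :: "nat \<Rightarrow> (real ^ 'p::finite \<Rightarrow> real) \<Rightarrow> nat ^ 'p \<Rightarrow> real \<Rightarrow> real ^ 'p \<Rightarrow> real" where
  "R_kernel m \<phi> \<alpha> s v = mi_power v \<alpha> *
     (\<Sum>j \<in> {1 .. (\<chi> r. m)}. gam_vec m j * mi_power (rvec j) (\<alpha> + 1) *
        \<phi> (\<chi> r. s * real (j $ r) * v $ r / 2))"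

text \<open>
The remainder as a functional of the family \<open>\<Phi> \<alpha>\<close>, which stands in place of the lattice series of
\<open>mderiv \<alpha> h\<close>. In this form its linearity and continuity can be stated, and it can be applied to
partial sums as well.
\<close>

definition R_functional :: "nat \<Rightarrow> (nat ^ 'p::finite \<Rightarrow> real ^ 'p \<Rightarrow> real) \<Rightarrow> real" where
  "R_functional m \<Phi> = real m / 2 ^ (2 * m + CARD('p) - 1) *
     (\<Sum>\<alpha> \<in> multi_indices (2 * m). 1 / mi_fact \<alpha> *
        integral {0..1} (\<lambda>s. (1 - s) ^ (2 * m - 1) *
          integral (cbox (- 1) 1) (R_kernel m (\<Phi> \<alpha>) \<alpha> s)))"

definition R_defined :: "nat \<Rightarrow> (nat ^ 'p::finite \<Rightarrow> real ^ 'p \<Rightarrow> real) \<Rightarrow> bool" where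
  "R_defined m \<Phi> \<longleftrightarrow> (\<forall>\<alpha> \<in> multi_indices (2 * m).
     (\<forall>s \<in> {0..1}. R_kernel m (\<Phi> \<alpha>) \<alpha> s integrable_on cbox (- 1) 1) \<and>
     (\<lambda>s. (1 - s) ^ (2 * m - 1) * integral (cbox (- 1) 1) (R_kernel m (\<Phi> \<alpha>) \<alpha> s)) integrable_on {0..1})"

lemma R_inf_eq_functional: "R_inf m h = R_functional m (\<lambda>\<alpha>. lattice_series (mderiv \<alpha> h))"
proof -
  have "R_integrand m h \<alpha> = R_kernel m (lattice_series (mderiv \<alpha> h)) \<alpha>" for \<alpha>
    by (intro ext) (simp add: R_integrand_def R_kernel_def)
  then show ?thesis by (simp add: R_inf_def R_functional_def)
qed

lemma R_inf_exists_imp_defined: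
  "R_inf_exists m h \<Longrightarrow> R_defined m (\<lambda>\<alpha>. lattice_series (mderiv \<alpha> h))"
proof -
  have "R_integrand m h \<alpha> = R_kernel m (lattice_series (mderiv \<alpha> h)) \<alpha>" for \<alpha>
    by (intro ext) (simp add: R_integrand_def R_kernel_def)
  then show "R_inf_exists m h \<Longrightarrow> R_defined m (\<lambda>\<alpha>. lattice_series (mderiv \<alpha> h))"
    by (simp add: R_inf_exists_def R_defined_def)
qed

text \<open>
The arguments at which the remainder evaluates \<open>\<Phi> \<alpha>\<close> stay in \<open>half_cube m\<close>; hence only the values there
matter.
\<close>

lemma node_in_half_cube:
  assumes "j \<in> {1 .. (\<chi> r. m)}" "s \<in> {0..1}" "v \<in> cbox (- 1) 1"
  shows "(\<chi> r. s * real (j $ r) * v $ r / 2) \<in> half_cube m"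
  unfolding half_cube_def mem_box_cart
proof
  fix r
  have j: "real (j $ r) \<le> real m" using assms(1) by (simp add: less_eq_vec_def)
  have v: "\<bar>v $ r\<bar> \<le> 1" using assms(3) by (auto simp: mem_box_cart abs_le_iff)
  have "\<bar>s * real (j $ r) * v $ r\<bar> \<le> 1 * real m * 1"
    unfolding abs_mult using assms(2) j v by (intro mult_mono) auto
  then show "(\<chi> r. - real m / 2) $ r \<le> (\<chi> r. s * real (j $ r) * v $ r / 2) $ r \<and>
      (\<chi> r. s * real (j $ r) * v $ r / 2) $ r \<le> (\<chi> r. real m / 2) $ r"
    by (auto simp: abs_le_iff)
qed

lemma R_kernel_cong:
  assumes "\<And>u. u \<in> half_cube m \<Longrightarrow> \<phi> u = \<psi> u" "s \<in> {0..1}" "v \<in> cbox (- 1) 1"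
  shows "R_kernel m \<phi> \<alpha> s v = R_kernel m \<psi> \<alpha> s v"
  unfolding R_kernel_def
  by (intro sum.cong refl arg_cong2[where f = "(*)"] assms(1) node_in_half_cube assms(2,3))

lemma R_functional_cong:
  assumes "\<And>\<alpha> u. \<alpha> \<in> multi_indices (2 * m) \<Longrightarrow> u \<in> half_cube m \<Longrightarrow> \<Phi> \<alpha> u = \<Psi> \<alpha> u"
  shows "R_functional m \<Phi> = R_functional m \<Psi>"
  unfolding R_functional_def using assms
  by (intro sum.cong refl arg_cong2[where f = "(*)"] Henstock_Kurzweil_Integration.integral_cong
      R_kernel_cong) auto

lemma R_kernel_sum:
  "R_kernel m (\<lambda>u. \<Sum>i\<in>I. c i * \<phi> i u) \<alpha> s v = (\<Sum>i\<in>I. c i * R_kernel m (\<phi> i) \<alpha> s v)"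
  unfolding R_kernel_def sum_distrib_left by (subst sum.swap) (simp add: mult_ac)

lemma integrable_on_real_cmult:
  fixes f :: "'a::euclidean_space \<Rightarrow> real"
  shows "f integrable_on S \<Longrightarrow> (\<lambda>x. c * f x) integrable_on S"
  using integrable_cmul[of f S c] by simp

lemma
  fixes \<Phi> :: "'i \<Rightarrow> nat ^ 'p::finite \<Rightarrow> real ^ 'p \<Rightarrow> real"
  assumes I: "finite I" and def: "\<And>i. i \<in> I \<Longrightarrow> R_defined m (\<Phi> i)"
  shows R_defined_sum: "R_defined m (\<lambda>\<alpha> u. \<Sum>i\<in>I. c i * \<Phi> i \<alpha> u)"
    and R_functional_sum:
      "R_functional m (\<lambda>\<alpha> u. \<Sum>i\<in>I. c i * \<Phi> i \<alpha> u) = (\<Sum>i\<in>I. c i * R_functional m (\<Phi> i))"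
proof -
  let ?g = "\<lambda>i \<alpha> s. (1 - s) ^ (2 * m - 1) * integral (cbox (- 1) 1) (R_kernel m (\<Phi> i \<alpha>) \<alpha> s)"
  let ?k = "\<lambda>\<alpha>. R_kernel m (\<lambda>u. \<Sum>i\<in>I. c i * \<Phi> i \<alpha> u) \<alpha>"
  have inner: "R_kernel m (\<Phi> i \<alpha>) \<alpha> s integrable_on cbox (- 1) 1"
    if "i \<in> I" "s \<in> {0..1}" "\<alpha> \<in> multi_indices (2 * m)" for i s \<alpha>
    using def[OF that(1)] that by (simp add: R_defined_def)
  have outer: "?g i \<alpha> integrable_on {0..1}" if "i \<in> I" "\<alpha> \<in> multi_indices (2 * m)" for i \<alpha>
    using def[OF that(1)] that by (simp add: R_defined_def)
  have eq: "(1 - s) ^ (2 * m - 1) * integral (cbox (- 1) 1) (?k \<alpha> s) = (\<Sum>i\<in>I. c i * ?g i \<alpha> s)"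
    if "s \<in> {0..1}" "\<alpha> \<in> multi_indices (2 * m)" for s \<alpha>
  proof -
    have "integral (cbox (- 1) 1) (?k \<alpha> s) =
        (\<Sum>i\<in>I. integral (cbox (- 1) 1) (\<lambda>v. c i * R_kernel m (\<Phi> i \<alpha>) \<alpha> s v))"
      unfolding R_kernel_sum[abs_def]
      by (intro integral_sum I integrable_on_real_cmult inner that)
    then show ?thesis by (simp add: sum_distrib_left mult_ac)
  qed
  show "R_defined m (\<lambda>\<alpha> u. \<Sum>i\<in>I. c i * \<Phi> i \<alpha> u)"
    unfolding R_defined_def
  proof (intro ballI conjI)
    fix \<alpha> :: "nat ^ 'p" assume \<alpha>: "\<alpha> \<in> multi_indices (2 * m)"
    show "?k \<alpha> s integrable_on cbox (- 1) 1" if "s \<in> {0..1}" for s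
      unfolding R_kernel_sum[abs_def]
      by (intro integrable_sum I integrable_on_real_cmult inner that \<alpha>)
    have "(\<lambda>s. \<Sum>i\<in>I. c i * ?g i \<alpha> s) integrable_on {0..1}"
      by (intro integrable_sum I integrable_on_real_cmult outer \<alpha>)
    then show "(\<lambda>s. (1 - s) ^ (2 * m - 1) * integral (cbox (- 1) 1) (?k \<alpha> s)) integrable_on {0..1}"
      by (rule integrable_eq) (simp only: eq[OF _ \<alpha>])
  qed
  have one: "integral {0..1} (\<lambda>s. (1 - s) ^ (2 * m - 1) * integral (cbox (- 1) 1) (?k \<alpha> s)) =
      (\<Sum>i\<in>I. c i * integral {0..1} (?g i \<alpha>))" if \<alpha>: "\<alpha> \<in> multi_indices (2 * m)" for \<alpha>
  proof -
    have "integral {0..1} (\<lambda>s. (1 - s) ^ (2 * m - 1) * integral (cbox (- 1) 1) (?k \<alpha> s)) =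
      integral {0..1} (\<lambda>s. \<Sum>i\<in>I. c i * ?g i \<alpha> s)"
      by (rule Henstock_Kurzweil_Integration.integral_cong) (rule eq[OF _ \<alpha>])
    also have "\<dots> = (\<Sum>i\<in>I. integral {0..1} (\<lambda>s. c i * ?g i \<alpha> s))"
      by (intro integral_sum I integrable_on_real_cmult outer \<alpha>)
    finally show ?thesis by simp
  qed
  show "R_functional m (\<lambda>\<alpha> u. \<Sum>i\<in>I. c i * \<Phi> i \<alpha> u) = (\<Sum>i\<in>I. c i * R_functional m (\<Phi> i))"
  proof -
    let ?w = "real m / 2 ^ (2 * m + CARD('p) - 1)"
    have "R_functional m (\<lambda>\<alpha> u. \<Sum>i\<in>I. c i * \<Phi> i \<alpha> u) =
        ?w * (\<Sum>\<alpha>\<in>multi_indices (2 * m). 1 / mi_fact \<alpha> * (\<Sum>i\<in>I. c i * integral {0..1} (?g i \<alpha>)))"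
      unfolding R_functional_def by (intro sum.cong refl arg_cong2[where f = "(*)"] one)
    also have "\<dots> = (\<Sum>\<alpha>\<in>multi_indices (2 * m). \<Sum>i\<in>I. c i * (?w * (1 / mi_fact \<alpha> * integral {0..1} (?g i \<alpha>))))"
      by (simp only: sum_distrib_left mult.left_commute)
    also have "\<dots> = (\<Sum>i\<in>I. c i * R_functional m (\<Phi> i))"
      unfolding R_functional_def sum_distrib_left by (rule sum.swap)
    finally show ?thesis .
  qed
qed

lemma
  fixes \<Phi> \<Psi> :: "nat ^ 'p::finite \<Rightarrow> real ^ 'p \<Rightarrow> real"
  assumes def: "R_defined m \<Phi>" "R_defined m \<Psi>"
  shows R_defined_diff: "R_defined m (\<lambda>\<alpha> u. \<Phi> \<alpha> u - \<Psi> \<alpha> u)"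
    and R_functional_diff:
      "R_functional m (\<lambda>\<alpha> u. \<Phi> \<alpha> u - \<Psi> \<alpha> u) = R_functional m \<Phi> - R_functional m \<Psi>"
proof -
  define X where "X b = (if b then \<Phi> else \<Psi>)" for b
  define c :: "bool \<Rightarrow> real" where "c b = (if b then 1 else -1)" for b
  have X: "R_defined m (X b)" for b using def by (simp add: X_def)
  have diff: "(\<lambda>\<alpha> u. \<Sum>b\<in>UNIV. c b * X b \<alpha> u) = (\<lambda>\<alpha> u. \<Phi> \<alpha> u - \<Psi> \<alpha> u)"
    by (simp add: UNIV_bool X_def c_def)
  show "R_defined m (\<lambda>\<alpha> u. \<Phi> \<alpha> u - \<Psi> \<alpha> u)"
    using R_defined_sum[of UNIV m X c] X unfolding diff by simp
  show "R_functional m (\<lambda>\<alpha> u. \<Phi> \<alpha> u - \<Psi> \<alpha> u) = R_functional m \<Phi> - R_functional m \<Psi>"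
    using R_functional_sum[of UNIV m X c] X unfolding diff by (simp add: UNIV_bool X_def c_def)
qed

lemma continuous_on_mi_power [continuous_intros]:
  "continuous_on S f \<Longrightarrow> continuous_on S (\<lambda>x. mi_power (f x) \<alpha>)"
  unfolding mi_power_def by (intro continuous_intros)

lemma continuous_on_node:
  assumes "continuous_on (half_cube m) \<phi>" "j \<in> {1 .. (\<chi> r. m)}"
  shows "continuous_on ({0..1} \<times> cbox (- 1) 1) (\<lambda>(s, v). \<phi> (\<chi> r. s * real (j $ r) * v $ r / 2))"
  unfolding case_prod_beta
  by (rule continuous_on_compose2[OF assms(1)])
    (use node_in_half_cube[OF assms(2)] in \<open>auto intro!: continuous_intros\<close>)

lemma continuous_on_R_kernel:
  assumes "continuous_on (half_cube m) \<phi>"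
  shows "continuous_on ({0..1} \<times> cbox (- 1) 1) (\<lambda>(s, v). R_kernel m \<phi> \<alpha> s v)"
  unfolding R_kernel_def case_prod_beta
  by (intro continuous_intros continuous_on_node[OF assms, unfolded case_prod_beta])

lemma continuous_on_slice:
  assumes "continuous_on (A \<times> B) (\<lambda>(s, v). f s v)" "s \<in> A"
  shows "continuous_on B (f s)"
proof -
  have "continuous_on B (\<lambda>v. (s, v))" by (intro continuous_intros)
  then show ?thesis
    using continuous_on_compose2[OF assms(1), of B "\<lambda>v. (s, v)"] assms(2) by auto
qed

lemma R_defined_continuous:
  fixes \<Phi> :: "nat ^ 'p::finite \<Rightarrow> real ^ 'p \<Rightarrow> real"
  assumes "\<And>\<alpha>. \<alpha> \<in> multi_indices (2 * m) \<Longrightarrow> continuous_on (half_cube m) (\<Phi> \<alpha>)"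
  shows "R_defined m \<Phi>"
  unfolding R_defined_def
proof (intro ballI conjI)
  fix \<alpha> :: "nat ^ 'p" assume "\<alpha> \<in> multi_indices (2 * m)"
  note cont = continuous_on_R_kernel[OF assms[OF this], of \<alpha>]
  show "R_kernel m (\<Phi> \<alpha>) \<alpha> s integrable_on cbox (- 1) 1" if "s \<in> {0..1}" for s
    using continuous_on_slice[OF cont that] by (rule integrable_continuous)
  show "(\<lambda>s. (1 - s) ^ (2 * m - 1) * integral (cbox (- 1) 1) (R_kernel m (\<Phi> \<alpha>) \<alpha> s)) integrable_on {0..1}"
    by (intro integrable_continuous_interval continuous_intros integral_continuous_on_param cont)
qed

lemma abs_mi_power_le_1: "v \<in> cbox (- 1) 1 \<Longrightarrow> \<bar>mi_power v \<alpha>\<bar> \<le> 1"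
  unfolding mi_power_def abs_prod power_abs
  by (intro prod_le_1 conjI power_le_one) (auto simp: mem_box_cart abs_le_iff intro: minus_le_iff[THEN iffD1])

text \<open>
The constant is independent of \<open>\<Phi>\<close>; this is what allows passing to uniform limits.
\<close>

lemma R_functional_bound:
  "\<exists>C\<ge>0. \<forall>\<Phi> e. R_defined m \<Phi> \<longrightarrow> 0 \<le> e \<longrightarrow>
     (\<forall>\<alpha>\<in>multi_indices (2 * m). \<forall>u\<in>half_cube m. \<bar>\<Phi> \<alpha> u\<bar> \<le> e) \<longrightarrow>
     \<bar>R_functional m (\<Phi> :: nat ^ 'p::finite \<Rightarrow> _)\<bar> \<le> C * e"
proof -
  define K where "K \<alpha> = (\<Sum>j \<in> {1 .. (\<chi> r. m)}. \<bar>gam_vec m j * mi_power (rvec j) (\<alpha> + 1)\<bar>)" for \<alpha> :: "nat ^ 'p"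
  define V where "V = measure lborel (cbox (- 1) 1 :: (real ^ 'p) set)"
  define C where "C = real m / 2 ^ (2 * m + CARD('p) - 1) * (\<Sum>\<alpha> \<in> multi_indices (2 * m). 1 / mi_fact \<alpha> * (K \<alpha> * V))"
  have K: "K \<alpha> \<ge> 0" for \<alpha> by (simp add: K_def sum_nonneg)
  have V: "V \<ge> 0" by (simp add: V_def)
  have "\<bar>R_functional m \<Phi>\<bar> \<le> C * e"
    if def: "R_defined m \<Phi>" and e: "0 \<le> e"
      and \<Phi>: "\<And>\<alpha> u. \<alpha> \<in> multi_indices (2 * m) \<Longrightarrow> u \<in> half_cube m \<Longrightarrow> \<bar>\<Phi> \<alpha> u\<bar> \<le> e"
    for \<Phi> :: "nat ^ 'p \<Rightarrow> real ^ 'p \<Rightarrow> real" and e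
  proof -
    have one: "\<bar>integral {0..1} (\<lambda>s. (1 - s) ^ (2 * m - 1) * integral (cbox (- 1) 1) (R_kernel m (\<Phi> \<alpha>) \<alpha> s))\<bar>
        \<le> K \<alpha> * V * e" if \<alpha>: "\<alpha> \<in> multi_indices (2 * m)" for \<alpha>
    proof -
      have kern: "norm (R_kernel m (\<Phi> \<alpha>) \<alpha> s v) \<le> K \<alpha> * e" if "s \<in> {0..1}" "v \<in> cbox (- 1) 1" for s v
      proof -
        have "\<bar>\<Sum>j \<in> {1 .. (\<chi> r. m)}. gam_vec m j * mi_power (rvec j) (\<alpha> + 1) *
            \<Phi> \<alpha> (\<chi> r. s * real (j $ r) * v $ r / 2)\<bar> \<le> K \<alpha> * e"
          unfolding K_def sum_distrib_right
          by (rule order_trans[OF sum_abs], rule sum_mono, subst abs_mult)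
            (intro mult_left_mono \<Phi> \<alpha> node_in_half_cube that, auto)
        then have "norm (R_kernel m (\<Phi> \<alpha>) \<alpha> s v) \<le> 1 * (K \<alpha> * e)"
          unfolding R_kernel_def real_norm_def abs_mult
          using abs_mi_power_le_1[OF that(2)] by (intro mult_mono) auto
        then show ?thesis by simp
      qed
      have inner: "norm (integral (cbox (- 1) 1) (R_kernel m (\<Phi> \<alpha>) \<alpha> s)) \<le> K \<alpha> * e * V" if "s \<in> {0..1}" for s
        unfolding V_def using def \<alpha> that K e kern[OF that]
        by (intro integrable_bound) (auto simp: R_defined_def)
      have "norm (integral (cbox 0 1) (\<lambda>s. (1 - s) ^ (2 * m - 1) * integral (cbox (- 1) 1) (R_kernel m (\<Phi> \<alpha>) \<alpha> s)))
          \<le> K \<alpha> * e * V * measure lborel (cbox 0 (1 :: real))"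
      proof (rule integrable_bound)
        show "0 \<le> K \<alpha> * e * V" using K V e by simp
        show "(\<lambda>s. (1 - s) ^ (2 * m - 1) * integral (cbox (- 1) 1) (R_kernel m (\<Phi> \<alpha>) \<alpha> s)) integrable_on cbox 0 1"
          using def \<alpha> by (simp add: R_defined_def)
        fix s :: real assume s: "s \<in> cbox 0 1"
        have "norm ((1 - s) ^ (2 * m - 1) * integral (cbox (- 1) 1) (R_kernel m (\<Phi> \<alpha>) \<alpha> s)) \<le> 1 * (K \<alpha> * e * V)"
          unfolding norm_mult using s inner[of s]
          by (intro mult_mono) (auto intro!: power_le_one simp: power_abs)
        then show "norm ((1 - s) ^ (2 * m - 1) * integral (cbox (- 1) 1) (R_kernel m (\<Phi> \<alpha>) \<alpha> s)) \<le> K \<alpha> * e * V"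
          by simp
      qed
      then show ?thesis by (simp add: mult_ac)
    qed
    have "\<bar>R_functional m \<Phi>\<bar> \<le> real m / 2 ^ (2 * m + CARD('p) - 1) *
        (\<Sum>\<alpha> \<in> multi_indices (2 * m). 1 / mi_fact \<alpha> * (K \<alpha> * V * e))"
      unfolding R_functional_def abs_mult[of "real m / _"]
      using one less_imp_le[OF mi_fact_pos]
      by (intro mult_mono order_trans[OF sum_abs] sum_mono) (auto simp: abs_mult abs_of_pos[OF mi_fact_pos] intro!: mult_mono divide_right_mono sum_nonneg)
    also have "\<dots> = C * e"
      by (simp add: C_def sum_distrib_right sum_distrib_left mult_ac)
    finally show ?thesis .
  qed
  moreover have "C \<ge> 0"
    unfolding C_def using K V less_imp_le[OF mi_fact_pos]
    by (intro mult_nonneg_nonneg sum_nonneg) auto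
  ultimately show ?thesis by blast
qed

lemma R_functional_tendsto:
  fixes \<Phi> :: "'a \<Rightarrow> nat ^ 'p::finite \<Rightarrow> real ^ 'p \<Rightarrow> real"
  assumes def: "\<And>n. R_defined m (\<Phi> n)" "R_defined m \<Psi>"
    and lim: "\<And>\<alpha>. \<alpha> \<in> multi_indices (2 * m) \<Longrightarrow> uniform_limit (half_cube m) (\<lambda>n. \<Phi> n \<alpha>) (\<Psi> \<alpha>) F"
  shows "((\<lambda>n. R_functional m (\<Phi> n)) \<longlongrightarrow> R_functional m \<Psi>) F"
proof (rule tendstoI)
  fix e :: real assume e: "e > 0"
  obtain C where C: "C \<ge> 0" "\<And>(\<Phi> :: nat ^ 'p \<Rightarrow> real ^ 'p \<Rightarrow> real) e. R_defined m \<Phi> \<Longrightarrow> 0 \<le> e \<Longrightarrow>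
     (\<forall>\<alpha>\<in>multi_indices (2 * m). \<forall>u\<in>half_cube m. \<bar>\<Phi> \<alpha> u\<bar> \<le> e) \<Longrightarrow> \<bar>R_functional m \<Phi>\<bar> \<le> C * e"
    using R_functional_bound[of m] by blast
  define d where "d = e / (C + 1)"
  have d: "d > 0" "C * d < e" using e C(1) by (auto simp: d_def field_simps)
  have "\<forall>\<^sub>F n in F. \<forall>\<alpha>\<in>multi_indices (2 * m). \<forall>u\<in>half_cube m. dist (\<Phi> n \<alpha> u) (\<Psi> \<alpha> u) < d"
    using lim d(1) finite_multi_indices by (intro eventually_ball_finite) (auto simp: uniform_limit_iff)
  then show "\<forall>\<^sub>F n in F. dist (R_functional m (\<Phi> n)) (R_functional m \<Psi>) < e"
  proof eventually_elim
    case (elim n)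
    have "R_defined m (\<lambda>\<alpha> u. \<Phi> n \<alpha> u - \<Psi> \<alpha> u)"
      by (rule R_defined_diff[OF def])
    then have "\<bar>R_functional m (\<lambda>\<alpha> u. \<Phi> n \<alpha> u - \<Psi> \<alpha> u)\<bar> \<le> C * d"
      using elim d(1) by (intro C(2)) (auto simp: dist_real_def intro: less_imp_le)
    then show ?case using d(2) by (simp add: R_functional_diff[OF def] dist_real_def)
  qed
qed

text \<open>
For continuous arguments the sum over \<open>j\<close> may be taken out of the integrals, term by term, which is the form
in which the Taylor remainders of the nodes appear.
\<close>

lemma R_functional_expand:
  fixes \<Phi> :: "nat ^ 'p::finite \<Rightarrow> real ^ 'p \<Rightarrow> real"
  assumes "\<And>\<alpha>. \<alpha> \<in> multi_indices (2 * m) \<Longrightarrow> continuous_on (half_cube m) (\<Phi> \<alpha>)"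
  shows "R_functional m \<Phi> = real m / 2 ^ (2 * m + CARD('p) - 1) *
    (\<Sum>\<alpha> \<in> multi_indices (2 * m). 1 / mi_fact \<alpha> *
      (\<Sum>j \<in> {1 .. (\<chi> r. m)}. gam_vec m j * mi_power (rvec j) (\<alpha> + 1) *
        integral {0..1} (\<lambda>s. (1 - s) ^ (2 * m - 1) *
          integral (cbox (- 1) 1) (\<lambda>v. mi_power v \<alpha> * \<Phi> \<alpha> (\<chi> r. s * real (j $ r) * v $ r / 2)))))"
  unfolding R_functional_def
proof (intro sum.cong refl arg_cong2[where f = "(*)"])
  fix \<alpha> :: "nat ^ 'p" assume "\<alpha> \<in> multi_indices (2 * m)"
  note cont = continuous_on_node[OF assms[OF this]]
  let ?I = "{1 .. (\<chi> r. m)} :: (nat ^ 'p) set"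
  let ?c = "\<lambda>j. gam_vec m j * mi_power (rvec j) (\<alpha> + 1)"
  let ?f = "\<lambda>j s v. mi_power v \<alpha> * \<Phi> \<alpha> (\<chi> r. s * real (j $ r) * v $ r / 2)"
  have f: "continuous_on ({0..1} \<times> cbox (- 1) 1) (\<lambda>(s, v). ?f j s v)" if "j \<in> ?I" for j
    using cont[OF that] unfolding case_prod_beta by (intro continuous_intros)
  have inner: "?f j s integrable_on cbox (- 1) 1" if "j \<in> ?I" "s \<in> {0..1}" for j s
    by (rule integrable_continuous, rule continuous_on_slice[OF f[OF that(1)] that(2)])
  have outer: "(\<lambda>s. (1 - s) ^ (2 * m - 1) * integral (cbox (- 1) 1) (?f j s)) integrable_on {0..1}"
    if "j \<in> ?I" for j
    by (intro integrable_continuous_interval continuous_intros integral_continuous_on_param f that)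
  have "integral {0..1} (\<lambda>s. (1 - s) ^ (2 * m - 1) * integral (cbox (- 1) 1) (R_kernel m (\<Phi> \<alpha>) \<alpha> s)) =
      integral {0..1} (\<lambda>s. \<Sum>j\<in>?I. ?c j * ((1 - s) ^ (2 * m - 1) * integral (cbox (- 1) 1) (?f j s)))"
  proof (rule Henstock_Kurzweil_Integration.integral_cong)
    fix s :: real assume s: "s \<in> {0..1}"
    have "R_kernel m (\<Phi> \<alpha>) \<alpha> s = (\<lambda>v. \<Sum>j\<in>?I. ?c j * ?f j s v)"
      by (simp add: fun_eq_iff R_kernel_def sum_distrib_left mult_ac)
    then have "integral (cbox (- 1) 1) (R_kernel m (\<Phi> \<alpha>) \<alpha> s) =
        (\<Sum>j\<in>?I. integral (cbox (- 1) 1) (\<lambda>v. ?c j * ?f j s v))"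
      by (simp only:) (intro integral_sum finite_nat_vec_interval integrable_on_real_cmult inner s)
    then have "integral (cbox (- 1) 1) (R_kernel m (\<Phi> \<alpha>) \<alpha> s) =
        (\<Sum>j\<in>?I. ?c j * integral (cbox (- 1) 1) (?f j s))"
      by (simp only: integral_mult_right)
    then show "(1 - s) ^ (2 * m - 1) * integral (cbox (- 1) 1) (R_kernel m (\<Phi> \<alpha>) \<alpha> s) =
        (\<Sum>j\<in>?I. ?c j * ((1 - s) ^ (2 * m - 1) * integral (cbox (- 1) 1) (?f j s)))"
      by (simp only: sum_distrib_left mult.left_commute[of "(1 - s) ^ (2 * m - 1)"])
  qed
  also have "\<dots> = (\<Sum>j\<in>?I. integral {0..1} (\<lambda>s. ?c j * ((1 - s) ^ (2 * m - 1) * integral (cbox (- 1) 1) (?f j s))))"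
    by (intro integral_sum finite_nat_vec_interval integrable_on_real_cmult outer)
  finally show "integral {0..1} (\<lambda>s. (1 - s) ^ (2 * m - 1) * integral (cbox (- 1) 1) (R_kernel m (\<Phi> \<alpha>) \<alpha> s)) =
      (\<Sum>j\<in>?I. ?c j * integral {0..1} (\<lambda>s. (1 - s) ^ (2 * m - 1) * integral (cbox (- 1) 1) (?f j s)))"
    by simp
qed


section \<open>The central quadrature\<close>

text \<open>
Reflection in the coordinate \<open>r\<close> changes the sign of the integral.
\<close>

lemma integral_mi_power_odd:
  fixes \<alpha> :: "nat ^ 'p::finite"
  assumes "odd (\<alpha> $ r)"
  shows "integral (cbox (- 1) 1) (\<lambda>v. mi_power v \<alpha>) = 0"
proof -
  let ?f = "\<lambda>v :: real ^ 'p. mi_power v \<alpha>"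
  define e :: "'p \<Rightarrow> real" where "e k = (if k = r then -1 else 1)" for k
  define I where "I = integral (cbox (- 1) 1) ?f"
  have "(?f has_integral I) (cbox (- 1) 1)"
    unfolding I_def by (intro integrable_integral integrable_continuous continuous_intros)
  then have "((\<lambda>x. ?f (\<chi> k. e k * x $ k)) has_integral I /\<^sub>R \<bar>prod e UNIV\<bar>)
      ((\<lambda>x. \<chi> k. x $ k / e k) ` cbox (- 1) 1)"
    by (rule has_integral_stretch_cart) (simp add: e_def)
  moreover have "(\<lambda>x :: real ^ 'p. \<chi> k. x $ k / e k) ` cbox (- 1) 1 = cbox (- 1) 1"
  proof (intro equalityI subsetI)
    fix x :: "real ^ 'p" assume "x \<in> cbox (- 1) 1"
    then have x: "- 1 \<le> x $ k" "x $ k \<le> 1" for k by (simp_all add: mem_box_cart)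
    have "- 1 \<le> e k * x $ k \<and> e k * x $ k \<le> 1" for k
      using x[of k] by (cases "k = r") (auto simp: e_def)
    then have "(\<chi> k. e k * x $ k) \<in> cbox (- 1) 1"
      by (simp add: mem_box_cart)
    moreover have "x = (\<lambda>x. \<chi> k. x $ k / e k) (\<chi> k. e k * x $ k)"
      by (auto simp: vec_eq_iff e_def)
    ultimately show "x \<in> (\<lambda>x. \<chi> k. x $ k / e k) ` cbox (- 1) 1" by blast
  next
    fix x :: "real ^ 'p" assume "x \<in> (\<lambda>x. \<chi> k. x $ k / e k) ` cbox (- 1) 1"
    then obtain y where y: "y \<in> cbox (- 1) 1" "x = (\<chi> k. y $ k / e k)" by blast
    then have yk: "- 1 \<le> y $ k" "y $ k \<le> 1" for k by (simp_all add: mem_box_cart)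
    have "- 1 \<le> y $ k / e k \<and> y $ k / e k \<le> 1" for k
      using yk[of k] by (cases "k = r") (auto simp: e_def)
    then show "x \<in> cbox (- 1) 1"
      by (simp add: mem_box_cart y(2))
  qed
  moreover have "\<bar>prod e UNIV\<bar> = 1"
    unfolding abs_prod by (intro prod.neutral) (simp add: e_def)
  moreover have "?f (\<chi> k. e k * x $ k) = - ?f x" for x
  proof -
    have "?f (\<chi> k. e k * x $ k) = (\<Prod>k\<in>UNIV. (if k = r then -1 else 1) * (x $ k) ^ (\<alpha> $ k))"
      unfolding mi_power_def using assms by (intro prod.cong) (auto simp: e_def)
    then show ?thesis by (simp add: prod.distrib mi_power_def)
  qed
  ultimately have "((\<lambda>x. - ?f x) has_integral I) (cbox (- 1) 1)" by simp
  then have "(?f has_integral - I) (cbox (- 1) 1)"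
    using has_integral_neg[of "\<lambda>x. - ?f x" I] by simp
  then have "I = - I" unfolding I_def by (rule integral_unique)
  then show ?thesis by (simp add: I_def)
qed

lemma sum_gam_vec_prod:
  "(\<Sum>j \<in> {1 .. (\<chi> r. m) :: nat ^ 'p::finite}. gam_vec m j * (\<Prod>r\<in>UNIV. g r (j $ r))) =
    (\<Prod>r\<in>UNIV. \<Sum>i=1..m. gam m i * g r i)"
  using sum_vec_box_prod[of "\<lambda>_ :: 'p. {1..m}" "\<lambda>r i. gam m i * g r i"]
  by (simp add: vec_atLeastAtMost_eq gam_vec_def prod.distrib)

text \<open>
Exactness of the quadrature on the monomial \<open>\<alpha>\<close>. If some exponent is odd, the integral vanishes;
otherwise all exponents are even and the weights factor into odd moments of \<open>gam\<close>, one of which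
vanishes unless \<open>\<alpha> = 0\<close>.
\<close>

lemma gam_vec_moment:
  fixes \<alpha> :: "nat ^ 'p::finite"
  assumes \<alpha>: "mi_norm \<alpha> < 2 * m"
  shows "(\<Sum>j \<in> {1 .. (\<chi> r. m)}. gam_vec m j * mi_power (rvec j) (\<alpha> + 1)) *
    integral (cbox (- 1) 1) (\<lambda>v. mi_power v \<alpha>) = of_bool (\<alpha> = 0) * 2 ^ CARD('p)"
proof (cases "\<exists>r. odd (\<alpha> $ r)")
  case True
  then have "\<alpha> \<noteq> 0" by auto
  then show ?thesis using True integral_mi_power_odd by auto
next
  case False
  have one: "(\<Sum>i=1..m. gam m i * real i ^ (\<alpha> $ r + 1)) = of_bool (\<alpha> $ r = 0)" for r
  proof -
    obtain i where i: "\<alpha> $ r = 2 * i" using False by (meson evenE)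
    have "\<alpha> $ r \<le> mi_norm \<alpha>" by (simp add: mi_norm_def member_le_sum)
    then show ?thesis using gam_odd_moment[of i m] \<alpha> i by simp
  qed
  have "(\<Sum>j \<in> {1 .. (\<chi> r. m)}. gam_vec m j * mi_power (rvec j) (\<alpha> + 1)) =
      (\<Prod>r\<in>UNIV. of_bool (\<alpha> $ r = 0))"
    using sum_gam_vec_prod[of m "\<lambda>r i. real i ^ (\<alpha> $ r + 1)"]
    by (simp only: one) (simp add: mi_power_def rvec_def)
  also have "\<dots> = of_bool (\<alpha> = 0)"
  proof (cases "\<alpha> = 0")
    case False
    then obtain r where "\<alpha> $ r \<noteq> 0" by (auto simp: vec_eq_iff)
    then have "(\<Prod>r\<in>UNIV. of_bool (\<alpha> $ r = 0) :: real) = 0" by (intro prod_zero) auto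
    then show ?thesis using False by simp
  qed simp
  finally have eq: "(\<Sum>j \<in> {1 .. (\<chi> r. m)}. gam_vec m j * mi_power (rvec j) (\<alpha> + 1)) = of_bool (\<alpha> = 0)" .
  have "measure lborel (cbox (- 1) 1 :: (real ^ 'p) set) = 2 ^ CARD('p)"
    by (subst content_cbox_cart) (auto simp: interval_ne_empty_cart)
  then show ?thesis unfolding eq by (simp add: mi_power_def)
qed

lemma mi_power_node:
  "mi_power (\<chi> r. real (j $ r) * v $ r / 2) \<alpha> = mi_power (rvec j) \<alpha> * mi_power v \<alpha> / 2 ^ mi_norm \<alpha>"
  by (simp add: mi_power_def rvec_def mi_norm_def power_divide power_mult_distrib prod.distrib
      prod_dividef power_sum)

lemma prod_half_mult_mi_power:
  "(\<Prod>r\<in>UNIV. real (j $ r) / 2) * mi_power (rvec j) \<alpha> = mi_power (rvec j) (\<alpha> + 1) / 2 ^ CARD('p)"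
  for j :: "nat ^ 'p::finite"
  by (simp add: mi_power_def rvec_def prod.distrib prod_dividef)

text \<open>
Taylor's formula at \<open>0\<close>, evaluated at \<open>j v / 2\<close> and integrated over \<open>v\<close>; in the remainder the
integrals over \<open>s\<close> and \<open>v\<close> are interchanged.
\<close>

lemma integral_Taylor_node:
  fixes g :: "real ^ 'p::{finite,linorder} \<Rightarrow> real"
  assumes m: "0 < m" and g: "cont_diff (2 * m) g"
  shows "integral (cbox (- 1) 1) (\<lambda>v. g (\<chi> r. real (j $ r) * v $ r / 2)) =
    (\<Sum>k<2 * m. \<Sum>\<alpha>\<in>multi_indices k. mderiv \<alpha> g 0 / mi_fact \<alpha> / 2 ^ k * mi_power (rvec j) \<alpha> *
        integral (cbox (- 1) 1) (\<lambda>v. mi_power v \<alpha>)) +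
    (\<Sum>\<alpha>\<in>multi_indices (2 * m). real (2 * m) / 2 ^ (2 * m) / mi_fact \<alpha> * mi_power (rvec j) \<alpha> *
        integral {0..1} (\<lambda>s. (1 - s) ^ (2 * m - 1) *
          integral (cbox (- 1) 1) (\<lambda>v. mi_power v \<alpha> * mderiv \<alpha> g (\<chi> r. s * real (j $ r) * v $ r / 2))))"
proof -
  define u where "u v = (\<chi> r. real (j $ r) * v $ r / 2)" for v :: "real ^ 'p::{finite,linorder}"
  have su: "(\<chi> r. s * real (j $ r) * v $ r / 2) = s *\<^sub>R u v" for s v
    by (simp add: u_def vec_eq_iff)
  define a where "a \<alpha> = mderiv \<alpha> g 0 / mi_fact \<alpha> / 2 ^ mi_norm \<alpha> * mi_power (rvec j) \<alpha>" for \<alpha> :: "nat ^ 'p::{finite,linorder}"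
  define c where "c \<alpha> = real (2 * m) / 2 ^ (2 * m) / mi_fact \<alpha> * mi_power (rvec j) \<alpha>" for \<alpha> :: "nat ^ 'p::{finite,linorder}"
  define P where "P v = (\<Sum>k<2 * m. \<Sum>\<alpha>\<in>multi_indices k. a \<alpha> * mi_power v \<alpha>)" for v
  define h where "h \<alpha> s v = mi_power v \<alpha> * mderiv \<alpha> g (s *\<^sub>R u v)" for \<alpha> :: "nat ^ 'p::{finite,linorder}" and s v
  define K where "K s v = (\<Sum>\<alpha>\<in>multi_indices (2 * m). c \<alpha> * ((1 - s) ^ (2 * m - 1) * h \<alpha> s v))" for s v
  have contd: "continuous_on S (mderiv \<alpha> g)" if "\<alpha> \<in> multi_indices (2 * m)" for \<alpha> S
    using that g cont_diff_mderiv[of \<alpha> 0 g] cont_diff_continuous[of 0 "mderiv \<alpha> g" S]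
    by (simp add: multi_indices_def)
  have contu: "continuous_on S u" for S
    unfolding u_def by (intro continuous_intros) auto
  have h: "continuous_on ({0..1} \<times> cbox (- 1) 1) (\<lambda>(s, v). h \<alpha> s v)" if "\<alpha> \<in> multi_indices (2 * m)" for \<alpha>
    unfolding h_def case_prod_beta
    by (intro continuous_intros continuous_on_compose2[OF contd[OF that, of UNIV]]
        continuous_on_compose2[OF contu[of UNIV]]) auto
  have K: "continuous_on (cbox (0, - 1) (1, 1)) (\<lambda>(s, v). K s v)"
  proof -
    have "cbox (0 :: real, - 1 :: real ^ 'p::{finite,linorder}) (1, 1) = {0..1} \<times> cbox (- 1) 1"
      by (simp add: cbox_Pair_eq)
    then show ?thesis
      using h unfolding K_def case_prod_beta by (simp only:) (intro continuous_intros, auto)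
  qed
  have Taylor: "g (u v) = P v + integral (cbox 0 1) (\<lambda>s. K s v)" for v
  proof -
    have "((\<lambda>s. real (2 * m) * (1 - s) ^ (2 * m - 1) *
        (\<Sum>\<alpha>\<in>multi_indices (2 * m). mi_power (u v) \<alpha> / mi_fact \<alpha> * mderiv \<alpha> g (0 + s *\<^sub>R u v))) has_integral
      g (0 + u v) - (\<Sum>k<2 * m. \<Sum>\<alpha>\<in>multi_indices k. mi_power (u v) \<alpha> / mi_fact \<alpha> * mderiv \<alpha> g 0)) {0..1}"
      using m by (intro multivariate_Taylor g) simp
    moreover have "real (2 * m) * (1 - s) ^ (2 * m - 1) *
        (\<Sum>\<alpha>\<in>multi_indices (2 * m). mi_power (u v) \<alpha> / mi_fact \<alpha> * mderiv \<alpha> g (0 + s *\<^sub>R u v)) = K s v" for s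
      unfolding K_def sum_distrib_left
      by (intro sum.cong) (auto simp: u_def mi_power_node multi_indices_def c_def h_def)
    moreover have "(\<Sum>k<2 * m. \<Sum>\<alpha>\<in>multi_indices k. mi_power (u v) \<alpha> / mi_fact \<alpha> * mderiv \<alpha> g 0) = P v"
      unfolding P_def u_def mi_power_node by (intro sum.cong) (auto simp: multi_indices_def a_def mult_ac)
    ultimately have "((\<lambda>s. K s v) has_integral (g (u v) - P v)) (cbox 0 1)" by simp
    from integral_unique[OF this] show ?thesis by simp
  qed
  have Pint: "P integrable_on cbox (- 1) 1" "integral (cbox (- 1) 1) P =
      (\<Sum>k<2 * m. \<Sum>\<alpha>\<in>multi_indices k. a \<alpha> * integral (cbox (- 1) 1) (\<lambda>v. mi_power v \<alpha>))"
  proof -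
    have int: "(\<lambda>v. mi_power v \<alpha>) integrable_on cbox (- 1) 1" for \<alpha> :: "nat ^ 'p::{finite,linorder}"
      by (intro integrable_continuous continuous_intros)
    show "P integrable_on cbox (- 1) 1"
      unfolding P_def
      by (intro integrable_sum integrable_on_real_cmult finite_multi_indices int finite_lessThan)
    have "integral (cbox (- 1) 1) P =
        (\<Sum>k<2 * m. integral (cbox (- 1) 1) (\<lambda>v. \<Sum>\<alpha>\<in>multi_indices k. a \<alpha> * mi_power v \<alpha>))"
      unfolding P_def
      by (intro integral_sum integrable_sum integrable_on_real_cmult finite_multi_indices int finite_lessThan)
    also have "\<dots> = (\<Sum>k<2 * m. \<Sum>\<alpha>\<in>multi_indices k. integral (cbox (- 1) 1) (\<lambda>v. a \<alpha> * mi_power v \<alpha>))"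
      by (intro sum.cong refl integral_sum integrable_on_real_cmult finite_multi_indices int)
    finally show "integral (cbox (- 1) 1) P =
      (\<Sum>k<2 * m. \<Sum>\<alpha>\<in>multi_indices k. a \<alpha> * integral (cbox (- 1) 1) (\<lambda>v. mi_power v \<alpha>))" by simp
  qed
  have K': "continuous_on (cbox (- 1) 1 \<times> cbox 0 1) (\<lambda>(v, s). K s v)"
    unfolding case_prod_beta
    by (rule continuous_on_compose2[OF K[unfolded case_prod_beta], where f = "\<lambda>p. (snd p, fst p)", simplified fst_conv snd_conv])
      (auto simp: cbox_Pair_eq intro!: continuous_intros)
  have "integral (cbox (- 1) 1) (\<lambda>v. g (u v)) =
      integral (cbox (- 1) 1) P + integral (cbox (- 1) 1) (\<lambda>v. integral (cbox 0 1) (\<lambda>s. K s v))"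
    unfolding Taylor
    by (intro integral_add Pint(1) integrable_continuous integral_continuous_on_param K')
  also have "integral (cbox (- 1) 1) (\<lambda>v. integral (cbox 0 1) (\<lambda>s. K s v)) =
      integral (cbox 0 1) (\<lambda>s. integral (cbox (- 1) 1) (K s))"
    by (rule integral_swap_continuous[OF K, symmetric])
  also have "\<dots> = integral {0..1} (\<lambda>s. \<Sum>\<alpha>\<in>multi_indices (2 * m). c \<alpha> * ((1 - s) ^ (2 * m - 1) *
      integral (cbox (- 1) 1) (h \<alpha> s)))"
    unfolding box_real(2)
  proof (rule Henstock_Kurzweil_Integration.integral_cong)
    fix s :: real assume s: "s \<in> {0..1}"
    have "integral (cbox (- 1) 1) (K s) = (\<Sum>\<alpha>\<in>multi_indices (2 * m).
        integral (cbox (- 1) 1) (\<lambda>v. c \<alpha> * ((1 - s) ^ (2 * m - 1) * h \<alpha> s v)))"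
      unfolding K_def[abs_def]
      by (intro integral_sum finite_multi_indices integrable_on_real_cmult integrable_continuous
          continuous_on_slice[OF h s])
    then show "integral (cbox (- 1) 1) (K s) = (\<Sum>\<alpha>\<in>multi_indices (2 * m). c \<alpha> * ((1 - s) ^ (2 * m - 1) *
        integral (cbox (- 1) 1) (h \<alpha> s)))" by simp
  qed
  also have "\<dots> = (\<Sum>\<alpha>\<in>multi_indices (2 * m). integral {0..1} (\<lambda>s. c \<alpha> * ((1 - s) ^ (2 * m - 1) *
      integral (cbox (- 1) 1) (h \<alpha> s))))"
    by (intro integral_sum finite_multi_indices integrable_on_real_cmult integrable_continuous_interval
        continuous_intros integral_continuous_on_param h)
  also have "integral (cbox (- 1) 1) P = (\<Sum>k<2 * m. \<Sum>\<alpha>\<in>multi_indices k.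
      mderiv \<alpha> g 0 / mi_fact \<alpha> / 2 ^ k * mi_power (rvec j) \<alpha> * integral (cbox (- 1) 1) (\<lambda>v. mi_power v \<alpha>))"
    unfolding Pint(2) by (intro sum.cong refl) (simp add: a_def multi_indices_def)
  finally show ?thesis
    by (simp add: su u_def[symmetric] c_def h_def[abs_def])
qed

text \<open>
The polynomial part of Taylor's formula collapses to \<open>g 0\<close> by exactness, and the Taylor
remainders of the nodes, weighted and summed over \<open>j\<close>, are the expansion of the remainder
functional at the derivatives of \<open>g\<close>.
\<close>

lemma central_quadrature:
  fixes g :: "real ^ 'p::{finite,linorder} \<Rightarrow> real"
  assumes m: "0 < m" and g: "cont_diff (2 * m) g"
  shows "(\<Sum>j \<in> {1 .. (\<chi> r. m)}. gam_vec m j * ((\<Prod>r\<in>UNIV. real (j $ r) / 2) *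
      integral (cbox (- 1) 1) (\<lambda>v. g (\<chi> r. real (j $ r) * v $ r / 2)))) =
    g 0 + R_functional m (\<lambda>\<alpha>. mderiv \<alpha> g)"
proof -
  let ?I = "{1 .. (\<chi> r. m)} :: (nat ^ 'p::{finite,linorder}) set"
  let ?M = "\<lambda>\<alpha>. integral (cbox (- 1) 1) (\<lambda>v. mi_power v \<alpha>)"
  define T where "T j \<alpha> = integral {0..1} (\<lambda>s. (1 - s) ^ (2 * m - 1) *
          integral (cbox (- 1) 1) (\<lambda>v. mi_power v \<alpha> * mderiv \<alpha> g (\<chi> r. s * real (j $ r) * v $ r / 2)))"
    for j \<alpha> :: "nat ^ 'p::{finite,linorder}"
  define d where "d \<alpha> = mderiv \<alpha> g 0 / mi_fact \<alpha>" for \<alpha> :: "nat ^ 'p::{finite,linorder}"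
  have prod: "(\<Prod>r\<in>UNIV. real (j $ r) / 2) * (y * mi_power (rvec j) \<alpha> * z) =
      y * (mi_power (rvec j) (\<alpha> + 1) / 2 ^ CARD('p)) * z" for j \<alpha> :: "nat ^ 'p::{finite,linorder}" and y z
    by (simp add: prod_half_mult_mi_power[symmetric] mult_ac)
  have "(\<Sum>j \<in> ?I. gam_vec m j * ((\<Prod>r\<in>UNIV. real (j $ r) / 2) *
      integral (cbox (- 1) 1) (\<lambda>v. g (\<chi> r. real (j $ r) * v $ r / 2)))) =
    (\<Sum>j\<in>?I. gam_vec m j * (\<Sum>k<2 * m. \<Sum>\<alpha>\<in>multi_indices k.
        d \<alpha> / 2 ^ k * (mi_power (rvec j) (\<alpha> + 1) / 2 ^ CARD('p)) * ?M \<alpha>)) +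
    (\<Sum>j\<in>?I. gam_vec m j * (\<Sum>\<alpha>\<in>multi_indices (2 * m).
        real (2 * m) / 2 ^ (2 * m) / mi_fact \<alpha> * (mi_power (rvec j) (\<alpha> + 1) / 2 ^ CARD('p)) * T j \<alpha>))"
    unfolding integral_Taylor_node[OF m g] T_def[symmetric] d_def[symmetric]
    by (simp only: distrib_left sum.distrib sum_distrib_left prod)
  also have "(\<Sum>j\<in>?I. gam_vec m j * (\<Sum>k<2 * m. \<Sum>\<alpha>\<in>multi_indices k.
        d \<alpha> / 2 ^ k * (mi_power (rvec j) (\<alpha> + 1) / 2 ^ CARD('p)) * ?M \<alpha>)) =
      (\<Sum>k<2 * m. \<Sum>\<alpha>\<in>multi_indices k. d \<alpha> / 2 ^ k / 2 ^ CARD('p) *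
        ((\<Sum>j\<in>?I. gam_vec m j * mi_power (rvec j) (\<alpha> + 1)) * ?M \<alpha>))"
    unfolding sum_distrib_left sum_distrib_right
    by (subst sum.swap, rule sum.cong[OF refl], subst sum.swap) (simp add: mult_ac)
  also have "\<dots> = (\<Sum>k<2 * m. \<Sum>\<alpha>\<in>multi_indices k. if \<alpha> = (0 :: nat ^ 'p::{finite,linorder}) then g 0 else 0)"
  proof (intro sum.cong refl)
    fix k \<alpha> assume "k \<in> {..<2 * m}" and \<alpha>: "\<alpha> \<in> (multi_indices k :: (nat ^ 'p::{finite,linorder}) set)"
    then have "mi_norm \<alpha> < 2 * m" by (simp add: multi_indices_def)
    note moment = gam_vec_moment[OF this]
    show "d \<alpha> / 2 ^ k / 2 ^ CARD('p) *
        ((\<Sum>j\<in>?I. gam_vec m j * mi_power (rvec j) (\<alpha> + 1)) * ?M \<alpha>) = (if \<alpha> = 0 then g 0 else 0)"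
    proof (cases "\<alpha> = 0")
      case True
      have "directions (0 :: nat ^ 'p::{finite,linorder}) = []"
        using length_directions[of "0 :: nat ^ 'p::{finite,linorder}"] by (simp add: mi_norm_def)
      then have "d \<alpha> = g 0" by (simp add: d_def True mderiv_def mi_fact_def)
      moreover have "k = 0" using \<alpha> True by (simp add: multi_indices_def mi_norm_def)
      ultimately show ?thesis unfolding moment using True by simp
    qed (simp add: moment)
  qed
  also have "\<dots> = (\<Sum>k<2 * m. if k = 0 then g 0 else 0)"
  proof (rule sum.cong)
    fix k
    have "(0 :: nat ^ 'p::{finite,linorder}) \<in> multi_indices k \<longleftrightarrow> k = 0"
      by (auto simp: multi_indices_def mi_norm_def)
    then show "(\<Sum>\<alpha>\<in>multi_indices k. if \<alpha> = (0 :: nat ^ 'p::{finite,linorder}) then g 0 else 0) =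
        (if k = 0 then g 0 else 0)"
      by (simp add: finite_multi_indices)
  qed simp
  also have "\<dots> = g 0" using m by (simp add: sum.delta)
  also have "(\<Sum>j\<in>?I. gam_vec m j * (\<Sum>\<alpha>\<in>multi_indices (2 * m).
        real (2 * m) / 2 ^ (2 * m) / mi_fact \<alpha> * (mi_power (rvec j) (\<alpha> + 1) / 2 ^ CARD('p)) * T j \<alpha>)) =
      real (2 * m) / 2 ^ (2 * m) / 2 ^ CARD('p) * (\<Sum>\<alpha>\<in>multi_indices (2 * m). 1 / mi_fact \<alpha> *
        (\<Sum>j\<in>?I. gam_vec m j * mi_power (rvec j) (\<alpha> + 1) * T j \<alpha>))"
    unfolding sum_distrib_left by (subst sum.swap) (simp add: mult_ac)
  also have "real (2 * m) / 2 ^ (2 * m) / 2 ^ CARD('p) = real m / 2 ^ (2 * m + CARD('p) - 1)"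
  proof -
    obtain q where "2 * m + CARD('p) = Suc q" using m by (cases "2 * m + CARD('p)") auto
    then show ?thesis by (simp flip: power_add)
  qed
  also have "\<dots> * (\<Sum>\<alpha>\<in>multi_indices (2 * m). 1 / mi_fact \<alpha> *
        (\<Sum>j\<in>?I. gam_vec m j * mi_power (rvec j) (\<alpha> + 1) * T j \<alpha>)) = R_functional m (\<lambda>\<alpha>. mderiv \<alpha> g)"
    unfolding T_def
  proof (rule R_functional_expand[symmetric])
    show "continuous_on (half_cube m) (mderiv \<alpha> g)" if "\<alpha> \<in> multi_indices (2 * m)" for \<alpha>
      using that g cont_diff_mderiv[of \<alpha> 0 g] cont_diff_continuous[of 0 "mderiv \<alpha> g"]
      by (simp add: multi_indices_def)
  qed
  finally show ?thesis .
qed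


section \<open>The finite summation formula\<close>

lemma partial_shift: "partial r (shift h a) = shift (partial r h) a"
  by (simp add: partial_def shift_def fun_eq_iff add_ac)

lemma has_partial_shift: "has_partial r h \<Longrightarrow> has_partial r (shift h a)"
proof -
  assume "has_partial r h"
  then have "(\<lambda>t. h (x + a + t *\<^sub>R axis r 1)) differentiable (at 0)" for x
    by (simp add: has_partial_def)
  then show ?thesis by (simp add: has_partial_def shift_def add_ac)
qed

lemma iter_partial_shift: "iter_partial rs (shift h a) = shift (iter_partial rs h) a"
  by (induction rs) (auto simp: partial_shift)

lemma has_iter_partial_shift: "has_iter_partial rs h \<Longrightarrow> has_iter_partial rs (shift h a)"
  by (induction rs) (auto simp: iter_partial_shift has_partial_shift)

lemma mderiv_shift: "mderiv \<alpha> (shift h a) = shift (mderiv \<alpha> h) a"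
  by (simp add: mderiv_def iter_partial_shift)

lemma continuous_on_shift: "continuous_on UNIV h \<Longrightarrow> continuous_on S (shift h a)"
  unfolding shift_def by (rule continuous_on_compose2[of UNIV]) (auto intro!: continuous_intros)

lemma cont_diff_shift: "cont_diff k h \<Longrightarrow> cont_diff k (shift h a)"
  by (induction k arbitrary: h) (auto simp: continuous_on_shift partial_shift has_partial_shift)

text \<open>
The substitution \<open>x = d v\<close> turns the integral over the cube into an integral over the box with half
widths \<open>d\<close>.
\<close>

lemma integral_antiderivative:
  fixes f :: "real ^ 'p::{finite,linorder} \<Rightarrow> real"
  assumes F: "antiderivative F f" and f: "continuous_on UNIV f" and d: "\<And>r. 0 < d r"
  shows "(\<Prod>r\<in>UNIV. d r) * integral (cbox (- 1) 1) (\<lambda>v. f (\<chi> r. d r * v $ r)) =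
    box_diff UNIV (\<chi> r. - d r) (\<chi> r. d r) F 0"
proof -
  let ?a = "\<chi> r. - d r" and ?b = "\<chi> r. d r"
  have f_eq: "f = iter_partial (directions 1) F" and part: "has_iter_partial (directions 1) F"
    using F by (auto simp: antiderivative_def mderiv_def)
  have "(f has_integral box_diff UNIV ?a ?b F 0) (cbox ?a ?b)"
    unfolding f_eq
    by (rule has_integral_iter_partial[OF directions_1 part])
      (use f d less_imp_le[OF d] in \<open>auto simp: f_eq[symmetric] intro: continuous_on_subset order_trans[of _ 0]\<close>)
  then have "((\<lambda>v. f (\<chi> r. d r * v $ r)) has_integral box_diff UNIV ?a ?b F 0 /\<^sub>R \<bar>prod d UNIV\<bar>)
      ((\<lambda>x. \<chi> r. x $ r / d r) ` cbox ?a ?b)"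
    by (rule has_integral_stretch_cart) (use d in \<open>simp add: less_imp_neq[THEN not_sym]\<close>)
  moreover have "(\<lambda>x. \<chi> r. x $ r / d r) ` cbox ?a ?b = cbox (- 1) 1"
  proof (intro equalityI subsetI)
    fix x :: "real ^ 'p::{finite,linorder}" assume "x \<in> cbox (- 1) 1"
    then have x: "- 1 \<le> x $ r \<and> x $ r \<le> 1" for r by (simp add: mem_box_cart)
    have "- d r \<le> d r * x $ r \<and> d r * x $ r \<le> d r" for r
      using x[of r] d[of r] mult_left_mono[of "-1" "x $ r" "d r"] mult_left_mono[of "x $ r" 1 "d r"] by simp
    then have "(\<chi> r. d r * x $ r) \<in> cbox ?a ?b" by (simp add: mem_box_cart)
    moreover have "x = (\<lambda>x. \<chi> r. x $ r / d r) (\<chi> r. d r * x $ r)"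
      using d less_imp_neq[OF d] by (simp add: vec_eq_iff)
    ultimately show "x \<in> (\<lambda>x. \<chi> r. x $ r / d r) ` cbox ?a ?b" by blast
  next
    fix x assume "x \<in> (\<lambda>x. \<chi> r. x $ r / d r) ` cbox ?a ?b"
    then obtain y where y: "y \<in> cbox ?a ?b" "x = (\<chi> r. y $ r / d r)" by blast
    then have "- d r \<le> y $ r \<and> y $ r \<le> d r" for r by (simp add: mem_box_cart)
    then show "x \<in> cbox (- 1) 1"
      using d by (simp add: mem_box_cart y(2) field_simps)
  qed
  ultimately have "integral (cbox (- 1) 1) (\<lambda>v. f (\<chi> r. d r * v $ r)) =
      box_diff UNIV ?a ?b F 0 /\<^sub>R \<bar>prod d UNIV\<bar>"
    by (simp add: integral_unique)
  moreover have "prod d UNIV > 0" using d by (simp add: prod_pos)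
  moreover from this have "prod d UNIV \<noteq> 0" by linarith
  ultimately show ?thesis by simp
qed

text \<open>
On a product function both sides factor into one-dimensional sums, where the identity is the
telescoping of central differences; product functions suffice.
\<close>

lemma sum_central_box_diffs:
  fixes F :: "real ^ 'p::finite \<Rightarrow> real"
  shows "(\<Sum>k\<in>box_below n. \<Sum>j \<in> {1 .. (\<chi> r. m)}. gam_vec m j *
      box_diff UNIV (\<chi> r. - (real (j $ r) / 2)) (\<chi> r. real (j $ r) / 2) (shift F (rvec k)) 0) =
    (\<Sum>J\<in>UNIV. (-1) ^ (CARD('p) - card J) * A_J m F J n)"
proof -
  let ?I = "{1 .. (\<chi> r. m)} :: (nat ^ 'p) set" and ?B = "{(\<chi> r. 1 - int m) .. (\<chi> r. int m - 1)} :: (int ^ 'p) set"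
  have card: "card (UNIV - J) = CARD('p) - card J" for J :: "'p set"
    by (rule card_Diff_subset) auto
  have finB: "finite ?B" unfolding vec_atLeastAtMost_eq by (rule finite_vec_box) simp
  have subsets: "(\<Sum>J\<in>UNIV. (-1) ^ (CARD('p) - card J) * (\<Prod>r\<in>UNIV. if r \<in> J then x r else y r)) =
      (\<Prod>r\<in>UNIV. x r - y r)" for x y :: "'p \<Rightarrow> real"
    using sum_signed_subsets_prod[of UNIV x y] by (simp add: card)
  define W :: "(nat ^ 'p) \<times> (nat ^ 'p) \<times> 'p set \<Rightarrow> real" where "W = (\<lambda>(k, j, J). gam_vec m j * (-1) ^ (CARD('p) - card J))"
  define P :: "(nat ^ 'p) \<times> (nat ^ 'p) \<times> 'p set \<Rightarrow> real ^ 'p" where "P = (\<lambda>(k, j, J).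
      (\<chi> r. real (k $ r) + (if r \<in> J then real (j $ r) / 2 else - (real (j $ r) / 2))))"
  define W' where "W' = (\<lambda>(J :: 'p set, \<beta> :: int ^ 'p).
      (-1) ^ (CARD('p) - card J) * tau_vec m (\<chi> r. 1 + nat \<bar>\<beta> $ r\<bar>))"
  define P' :: "'p set \<times> (int ^ 'p) \<Rightarrow> real ^ 'p" where "P' = (\<lambda>(J, \<beta>). (\<chi> r. real (restr n J $ r) - 1 / 2 - of_int (\<beta> $ r) / 2))"
  have "(\<Sum>k\<in>box_below n. \<Sum>j\<in>?I. gam_vec m j *
      box_diff UNIV (\<chi> r. - (real (j $ r) / 2)) (\<chi> r. real (j $ r) / 2) (shift F (rvec k)) 0) =
      (\<Sum>a\<in>box_below n \<times> ?I \<times> (UNIV :: 'p set set). W a * F (P a))"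
  proof -
    have "shift F (rvec k) (\<chi> r. if r \<in> J then (\<chi> r. real (j $ r) / 2) $ r else if r \<in> UNIV
        then (\<chi> r. - (real (j $ r) / 2)) $ r else 0 $ r) = F (P (k, j, J))" for k j J
      unfolding shift_def P_def
      by (auto intro!: arg_cong[where f = F] simp: vec_eq_iff rvec_def)
    then show ?thesis
      unfolding box_diff_def W_def
      by (simp add: sum.cartesian_product' card sum_distrib_left mult_ac cong: sum.cong)
  qed
  also have "\<dots> = (\<Sum>b\<in>(UNIV :: 'p set set) \<times> ?B. W' b * F (P' b))"
  proof (rule product_functions_suffice)
    fix G :: "'p \<Rightarrow> real \<Rightarrow> real"
    define X where "X r x = (\<Sum>b\<in>{1 - int m..int m - 1}. tau m (1 + nat \<bar>b\<bar>) * G r (x - 1 / 2 - of_int b / 2))"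
      for r x
    have "(\<Sum>a\<in>box_below n \<times> ?I \<times> (UNIV :: 'p set set). W a * (\<Prod>r\<in>UNIV. G r (P a $ r))) =
        (\<Sum>k\<in>box_below n. \<Sum>j\<in>?I. gam_vec m j * (\<Sum>J\<in>UNIV. (-1) ^ (CARD('p) - card J) *
          (\<Prod>r\<in>UNIV. if r \<in> J then G r (real (k $ r) + real (j $ r) / 2)
             else G r (real (k $ r) - real (j $ r) / 2))))"
      by (simp add: sum.cartesian_product' W_def P_def sum_distrib_left mult_ac if_distrib[of "G _"]
          if_distrib[of "(+) _"] cong: sum.cong if_cong prod.cong)
    also have "\<dots> = (\<Sum>k\<in>box_below n. \<Prod>r\<in>UNIV. \<Sum>i=1..m. gam m i *
        (G r (real (k $ r) + real i / 2) - G r (real (k $ r) - real i / 2)))"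
      unfolding subsets
      by (simp only: sum_gam_vec_prod[of m "\<lambda>r i. G r (real (k $ r) + real i / 2) - G r (real (k $ r) - real i / 2)" for k])
    also have "\<dots> = (\<Prod>r\<in>UNIV. \<Sum>k<n $ r. \<Sum>i=1..m. gam m i * (G r (real k + real i / 2) - G r (real k - real i / 2)))"
      using sum_vec_box_prod[of "\<lambda>r. {..<n $ r}" "\<lambda>r k. \<Sum>i=1..m. gam m i * (G r (real k + real i / 2) - G r (real k - real i / 2))"]
      by (simp add: box_below_def)
    also have "\<dots> = (\<Prod>r\<in>UNIV. X r (real (n $ r)) - X r 0)"
      unfolding sum_central_differences_telescope X_def
      by (simp add: right_diff_distrib sum_subtractf)
    also have "\<dots> = (\<Sum>J\<in>UNIV. (-1) ^ (CARD('p) - card J) *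
        (\<Prod>r\<in>UNIV. if r \<in> J then X r (real (n $ r)) else X r 0))"
      by (rule subsets[symmetric])
    also have "\<dots> = (\<Sum>J\<in>UNIV. (-1) ^ (CARD('p) - card J) * (\<Sum>\<beta>\<in>?B. tau_vec m (\<chi> r. 1 + nat \<bar>\<beta> $ r\<bar>) *
        (\<Prod>r\<in>UNIV. G r (real (restr n J $ r) - 1 / 2 - of_int (\<beta> $ r) / 2))))"
    proof (intro sum.cong refl arg_cong2[where f = "(*)"])
      fix J :: "'p set"
      have "(\<Prod>r\<in>UNIV. if r \<in> J then X r (real (n $ r)) else X r 0) = (\<Prod>r\<in>UNIV. X r (real (restr n J $ r)))"
        by (intro prod.cong) (auto simp: restr_def)
      also have "\<dots> = (\<Sum>\<beta>\<in>?B. \<Prod>r\<in>UNIV. tau m (1 + nat \<bar>\<beta> $ r\<bar>) *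
          G r (real (restr n J $ r) - 1 / 2 - of_int (\<beta> $ r) / 2))"
        unfolding X_def vec_atLeastAtMost_eq
        by (subst sum_vec_box_prod[of "\<lambda>_. {1 - int m..int m - 1}", symmetric]) auto
      finally show "(\<Prod>r\<in>UNIV. if r \<in> J then X r (real (n $ r)) else X r 0) =
          (\<Sum>\<beta>\<in>?B. tau_vec m (\<chi> r. 1 + nat \<bar>\<beta> $ r\<bar>) *
            (\<Prod>r\<in>UNIV. G r (real (restr n J $ r) - 1 / 2 - of_int (\<beta> $ r) / 2)))"
        by (simp add: tau_vec_def prod.distrib)
    qed
    also have "\<dots> = (\<Sum>b\<in>(UNIV :: 'p set set) \<times> ?B. W' b * (\<Prod>r\<in>UNIV. G r (P' b $ r)))"
      by (simp add: sum.cartesian_product' W'_def P'_def sum_distrib_left mult_ac cong: sum.cong)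
    finally show "(\<Sum>a\<in>box_below n \<times> ?I \<times> (UNIV :: 'p set set). W a * (\<Prod>r\<in>UNIV. G r (P a $ r))) =
        (\<Sum>b\<in>(UNIV :: 'p set set) \<times> ?B. W' b * (\<Prod>r\<in>UNIV. G r (P' b $ r)))" .
  qed (intro finite_cartesian_product finite_box_below finite_nat_vec_interval finB finite)+
  also have "\<dots> = (\<Sum>J\<in>UNIV. (-1) ^ (CARD('p) - card J) * A_J m F J n)"
    by (simp add: sum.cartesian_product' W'_def P'_def A_J_def sum_distrib_left mult_ac cong: sum.cong)
  finally show ?thesis .
qed

lemma continuous_on_lattice_sum:
  assumes "continuous_on UNIV g"
  shows "continuous_on S (lattice_sum g n)"
proof -
  have "lattice_sum g n = (\<lambda>u. \<Sum>k\<in>box_below n. shift g (rvec k) u)"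
    by (simp add: fun_eq_iff lattice_sum_def shift_def add.commute)
  then show ?thesis using continuous_on_shift[OF assms] by (auto intro!: continuous_intros)
qed

text \<open>
The quadrature applied to the shift of \<open>f\<close> by each \<open>k\<close>. The remainders add up by linearity, the integrals
become corner differences of \<open>F\<close> and telescope.
\<close>

lemma finite_summation_formula:
  fixes f F :: "real ^ 'p::{finite,linorder} \<Rightarrow> real"
  assumes m: "0 < m" and f: "cont_diff (2 * m) f" and F: "antiderivative F f"
  shows "(\<Sum>k\<in>box_below n. f (rvec k)) + R_functional m (\<lambda>\<alpha>. lattice_sum (mderiv \<alpha> f) n) =
    (\<Sum>J\<in>UNIV. (-1) ^ (CARD('p) - card J) * A_J m F J n)"
proof -
  let ?I = "{1 .. (\<chi> r. m)} :: (nat ^ 'p::{finite,linorder}) set"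
  have node: "(\<Sum>j\<in>?I. gam_vec m j *
      box_diff UNIV (\<chi> r. - (real (j $ r) / 2)) (\<chi> r. real (j $ r) / 2) (shift F (rvec k)) 0) =
    f (rvec k) + R_functional m (\<lambda>\<alpha>. shift (mderiv \<alpha> f) (rvec k))" for k
  proof -
    have anti: "antiderivative (shift F (rvec k)) (shift f (rvec k))"
      using F by (auto simp: antiderivative_def mderiv_shift has_iter_partial_shift)
    have cont: "continuous_on UNIV (shift f (rvec k))"
      using f cont_diff_continuous continuous_on_shift by blast
    have "(\<Prod>r\<in>UNIV. real (j $ r) / 2) *
        integral (cbox (- 1) 1) (\<lambda>v. shift f (rvec k) (\<chi> r. real (j $ r) * v $ r / 2)) =
        box_diff UNIV (\<chi> r. - (real (j $ r) / 2)) (\<chi> r. real (j $ r) / 2) (shift F (rvec k)) 0"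
      if "j \<in> ?I" for j
    proof -
      have "0 < real (j $ r) / 2" for r using that by (auto simp: less_eq_vec_def Suc_le_eq)
      from integral_antiderivative[OF anti cont this] show ?thesis by simp
    qed
    then have "(\<Sum>j\<in>?I. gam_vec m j *
        box_diff UNIV (\<chi> r. - (real (j $ r) / 2)) (\<chi> r. real (j $ r) / 2) (shift F (rvec k)) 0) =
      (\<Sum>j\<in>?I. gam_vec m j * ((\<Prod>r\<in>UNIV. real (j $ r) / 2) *
        integral (cbox (- 1) 1) (\<lambda>v. shift f (rvec k) (\<chi> r. real (j $ r) * v $ r / 2))))"
      by (intro sum.cong) auto
    also have "\<dots> = shift f (rvec k) 0 + R_functional m (\<lambda>\<alpha>. mderiv \<alpha> (shift f (rvec k)))"
      by (intro central_quadrature m cont_diff_shift f)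
    finally show ?thesis by (simp add: mderiv_shift) (simp add: shift_def)
  qed
  have def: "R_defined m (\<lambda>\<alpha>. shift (mderiv \<alpha> f) (rvec k))" for k
    by (intro R_defined_continuous continuous_on_shift continuous_on_mderiv[OF f])
  have "R_functional m (\<lambda>\<alpha>. lattice_sum (mderiv \<alpha> f) n) =
      R_functional m (\<lambda>\<alpha> u. \<Sum>k\<in>box_below n. 1 * shift (mderiv \<alpha> f) (rvec k) u)"
    by (simp add: lattice_sum_def[abs_def] shift_def add.commute)
  also have "\<dots> = (\<Sum>k\<in>box_below n. 1 * R_functional m (\<lambda>\<alpha>. shift (mderiv \<alpha> f) (rvec k)))"
    by (rule R_functional_sum[OF finite_box_below def])
  finally show ?thesis
    unfolding sum_central_box_diffs[symmetric] node by (simp add: sum.distrib)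
qed


section \<open>Dependence on the order of the formula\<close>

lemma eventually_min_at_top:
  "eventually P (min_at_top :: (nat ^ 'p::finite) filter) \<longleftrightarrow> (\<exists>N. \<forall>n. (\<forall>r. N \<le> n $ r) \<longrightarrow> P n)"
  by (simp add: min_at_top_def eventually_filtercomap_at_top_linorder)

lemma min_at_top_neq_bot: "(min_at_top :: (nat ^ 'p::finite) filter) \<noteq> bot"
proof
  assume "(min_at_top :: (nat ^ 'p) filter) = bot"
  then have "eventually (\<lambda>_. False) (min_at_top :: (nat ^ 'p) filter)" by simp
  then obtain N where "\<forall>n :: nat ^ 'p. (\<forall>r. N \<le> n $ r) \<longrightarrow> False"
    unfolding eventually_min_at_top by blast
  from this[rule_format, of "\<chi> r. N"] show False by simp
qed

lemma eventually_max_at_top: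
  assumes "eventually P (max_at_top :: (real ^ 'p::finite) filter)"
  shows "\<exists>B. \<forall>x r. B \<le> x $ r \<longrightarrow> P x"
proof -
  obtain B where "\<And>x :: real ^ 'p. B \<le> Max (range (\<lambda>r. x $ r)) \<Longrightarrow> P x"
    using assms unfolding max_at_top_def eventually_filtercomap_at_top_linorder by blast
  moreover have "x $ r \<le> Max (range (\<lambda>r. x $ r))" for x :: "real ^ 'p" and r
    by (rule Max_ge) auto
  ultimately show ?thesis by (meson order_trans)
qed

text \<open>
A monomial of total degree below \<open>2 * m\<close> has each single exponent below \<open>2 * m\<close>, so the
moments agree factor by factor.
\<close>

lemma tau_vec_moment_independent:
  fixes \<alpha> :: "nat ^ 'p::finite"
  assumes "mi_norm \<alpha> < 2 * m" "mi_norm \<alpha> < 2 * m'"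
  shows "(\<Sum>\<beta>\<in>{(\<chi> r. 1 - int m)..(\<chi> r. int m - 1)}. tau_vec m (\<chi> r. 1 + nat \<bar>\<beta> $ r\<bar>) *
      mi_power (\<chi> r. - of_int (\<beta> $ r) / 2) \<alpha>) =
    (\<Sum>\<beta>\<in>{(\<chi> r. 1 - int m')..(\<chi> r. int m' - 1)}. tau_vec m' (\<chi> r. 1 + nat \<bar>\<beta> $ r\<bar>) *
      mi_power (\<chi> r. - of_int (\<beta> $ r) / 2) \<alpha>)"
proof -
  have prod: "(\<Sum>\<beta>\<in>{(\<chi> r. 1 - int k)..(\<chi> r. int k - 1)}. tau_vec k (\<chi> r. 1 + nat \<bar>\<beta> $ r\<bar>) *
      mi_power (\<chi> r. - of_int (\<beta> $ r) / 2) \<alpha>) =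
    (\<Prod>r\<in>UNIV. \<Sum>b\<in>{1 - int k..int k - 1}. tau k (1 + nat \<bar>b\<bar>) * (- of_int b / 2) ^ (\<alpha> $ r))" for k
    unfolding vec_atLeastAtMost_eq
    by (subst sum_vec_box_prod[of "\<lambda>_. {1 - int k..int k - 1}", symmetric])
      (auto simp: tau_vec_def mi_power_def prod.distrib)
  have "\<alpha> $ r \<le> mi_norm \<alpha>" for r by (simp add: mi_norm_def member_le_sum)
  then have "\<alpha> $ r < 2 * m" "\<alpha> $ r < 2 * m'" for r using assms by (meson le_less_trans)+
  then show ?thesis unfolding prod by (intro prod.cong refl tau_moment_independent)
qed

text \<open>
As \<open>J\<close> is nonempty, some coordinate of the whole segment of Taylor's formula tends to infinity with
\<open>n\<close>, and there the derivatives of order \<open>N\<close> are small.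
\<close>

lemma Taylor_remainder_tendsto_0:
  fixes h :: "real ^ 'p::{finite,linorder} \<Rightarrow> real"
  assumes N: "0 < N" and h: "cont_diff N h" and J: "J \<noteq> {}"
    and lim: "\<And>\<alpha>. mi_norm \<alpha> = N \<Longrightarrow> (mderiv \<alpha> h \<longlongrightarrow> 0) max_at_top"
  shows "((\<lambda>n. h ((\<chi> r. real (restr n J $ r) - 1 / 2) + u) -
    Taylor_polynomial N h (\<chi> r. real (restr n J $ r) - 1 / 2) u) \<longlongrightarrow> 0) min_at_top"
proof (rule tendstoI)
  fix e :: real assume e: "e > 0"
  let ?x = "\<lambda>n :: nat ^ 'p::{finite,linorder}. \<chi> r. real (restr n J $ r) - 1 / 2"
  obtain q where q: "q \<in> J" using J by auto
  define C where "C = real N * (\<Sum>\<alpha>\<in>multi_indices N. \<bar>mi_power u \<alpha>\<bar> / mi_fact \<alpha>)"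
  have C: "0 \<le> C" unfolding C_def using less_imp_le[OF mi_fact_pos]
    by (intro mult_nonneg_nonneg sum_nonneg divide_nonneg_nonneg) auto
  define d where "d = e / (C + 1)"
  have d: "d > 0" "C * d < e" using e C by (auto simp: d_def field_simps)
  have "eventually (\<lambda>x. \<forall>\<alpha>\<in>multi_indices N. dist (mderiv \<alpha> h x) 0 < d) max_at_top"
    by (intro eventually_ball_finite finite_multi_indices ballI tendstoD[OF lim d(1)])
      (simp add: multi_indices_def)
  then obtain B where B: "\<And>x r. B \<le> x $ r \<Longrightarrow> \<forall>\<alpha>\<in>multi_indices N. dist (mderiv \<alpha> h x) 0 < d"
    using eventually_max_at_top by blast
  obtain M where M: "B + 1 / 2 + \<bar>u $ q\<bar> \<le> real M" using real_arch_simple by blast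
  show "eventually (\<lambda>n. dist (h (?x n + u) - Taylor_polynomial N h (?x n) u) 0 < e) min_at_top"
    unfolding eventually_min_at_top
  proof (intro exI[of _ M] allI impI)
    fix n :: "nat ^ 'p::{finite,linorder}" assume n: "\<forall>r. M \<le> n $ r"
    have far: "B \<le> (?x n + s *\<^sub>R u) $ q" if s: "s \<in> {0..1}" for s
    proof -
      have "\<bar>s * u $ q\<bar> \<le> 1 * \<bar>u $ q\<bar>"
        unfolding abs_mult using s by (intro mult_right_mono) auto
      moreover have "real M \<le> real (n $ q)" using n by simp
      ultimately show ?thesis using M q by (simp add: restr_def)
    qed
    have "\<bar>h (?x n + u) - Taylor_polynomial N h (?x n) u\<bar> \<le> C * d"
      unfolding C_def
      using B[OF far] d(1) by (intro Taylor_remainder_bound N h) (auto intro: less_imp_le)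
    then show "dist (h (?x n + u) - Taylor_polynomial N h (?x n) u) 0 < e"
      using d(2) by simp
  qed
qed

text \<open>
After expanding \<open>F\<close> about the common centre \<open>restr n J - 1 / 2\<close> to order \<open>2 * m0\<close>, the Taylor polynomials
contribute the same to both sums, because the two systems of weights have the same moments.
\<close>

lemma A_J_difference_tendsto_0:
  fixes F :: "real ^ 'p::{finite,linorder} \<Rightarrow> real"
  assumes m: "0 < m0" "m0 \<le> m" and F: "cont_diff (2 * m0) F" and J: "J \<noteq> {}"
    and lim: "\<And>\<alpha>. mi_norm \<alpha> = 2 * m0 \<Longrightarrow> (mderiv \<alpha> F \<longlongrightarrow> 0) max_at_top"
  shows "((\<lambda>n. A_J m F J n - A_J m0 F J n) \<longlongrightarrow> 0) min_at_top"
proof -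
  let ?B = "\<lambda>k. {(\<chi> r. 1 - int k)..(\<chi> r. int k - 1)} :: (int ^ 'p::{finite,linorder}) set"
  let ?t = "\<lambda>k (\<beta> :: int ^ 'p::{finite,linorder}). tau_vec k (\<chi> r. 1 + nat \<bar>\<beta> $ r\<bar>)"
  define x :: "nat ^ 'p::{finite,linorder} \<Rightarrow> real ^ 'p::{finite,linorder}"
    where "x n = (\<chi> r. real (restr n J $ r) - 1 / 2)" for n
  define u :: "int ^ 'p::{finite,linorder} \<Rightarrow> real ^ 'p::{finite,linorder}"
    where "u \<beta> = (\<chi> r. - of_int (\<beta> $ r) / 2)" for \<beta>
  define R where "R n \<beta> = F (x n + u \<beta>) - Taylor_polynomial (2 * m0) F (x n) (u \<beta>)" for n \<beta>
  have R: "((\<lambda>n. R n \<beta>) \<longlongrightarrow> 0) min_at_top" for \<beta>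
    unfolding R_def x_def using m by (intro Taylor_remainder_tendsto_0 F J lim) auto
  have A: "A_J k F J n = (\<Sum>\<beta>\<in>?B k. ?t k \<beta> * R n \<beta>) +
      (\<Sum>d<2 * m0. \<Sum>\<alpha>\<in>multi_indices d. mderiv \<alpha> F (x n) / mi_fact \<alpha> * (\<Sum>\<beta>\<in>?B k. ?t k \<beta> * mi_power (u \<beta>) \<alpha>))"
    for k n
  proof -
    have "(\<chi> r. real (restr n J $ r) - 1 / 2 - of_int (\<beta> $ r) / 2) = x n + u \<beta>" for \<beta>
      by (simp add: x_def u_def vec_eq_iff)
    then have "A_J k F J n = (\<Sum>\<beta>\<in>?B k. ?t k \<beta> * (R n \<beta> + Taylor_polynomial (2 * m0) F (x n) (u \<beta>)))"
      by (simp add: A_J_def R_def)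
    also have "\<dots> = (\<Sum>\<beta>\<in>?B k. ?t k \<beta> * R n \<beta>) + (\<Sum>\<beta>\<in>?B k. ?t k \<beta> * Taylor_polynomial (2 * m0) F (x n) (u \<beta>))"
      by (simp only: distrib_left sum.distrib)
    also have "(\<Sum>\<beta>\<in>?B k. ?t k \<beta> * Taylor_polynomial (2 * m0) F (x n) (u \<beta>)) =
      (\<Sum>d<2 * m0. \<Sum>\<alpha>\<in>multi_indices d. mderiv \<alpha> F (x n) / mi_fact \<alpha> * (\<Sum>\<beta>\<in>?B k. ?t k \<beta> * mi_power (u \<beta>) \<alpha>))"
      unfolding Taylor_polynomial_def sum_distrib_left
      by (subst sum.swap, rule sum.cong[OF refl], subst sum.swap) (simp add: mult_ac)
    finally show ?thesis .
  qed
  have moments: "(\<Sum>\<beta>\<in>?B m. ?t m \<beta> * mi_power (u \<beta>) \<alpha>) = (\<Sum>\<beta>\<in>?B m0. ?t m0 \<beta> * mi_power (u \<beta>) \<alpha>)"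
    if "d < 2 * m0" "\<alpha> \<in> multi_indices d" for d \<alpha>
    unfolding u_def using that m by (intro tau_vec_moment_independent) (auto simp: multi_indices_def)
  have "A_J m F J n - A_J m0 F J n = (\<Sum>\<beta>\<in>?B m. ?t m \<beta> * R n \<beta>) - (\<Sum>\<beta>\<in>?B m0. ?t m0 \<beta> * R n \<beta>)" for n
  proof -
    have "(\<Sum>d<2 * m0. \<Sum>\<alpha>\<in>multi_indices d. mderiv \<alpha> F (x n) / mi_fact \<alpha> * (\<Sum>\<beta>\<in>?B m. ?t m \<beta> * mi_power (u \<beta>) \<alpha>)) =
        (\<Sum>d<2 * m0. \<Sum>\<alpha>\<in>multi_indices d. mderiv \<alpha> F (x n) / mi_fact \<alpha> * (\<Sum>\<beta>\<in>?B m0. ?t m0 \<beta> * mi_power (u \<beta>) \<alpha>))"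
      by (rule sum.cong[OF refl], rule sum.cong[OF refl], subst moments) auto
    then show ?thesis unfolding A by simp
  qed
  moreover have "((\<lambda>n. (\<Sum>\<beta>\<in>?B m. ?t m \<beta> * R n \<beta>) - (\<Sum>\<beta>\<in>?B m0. ?t m0 \<beta> * R n \<beta>)) \<longlongrightarrow>
      (\<Sum>\<beta>\<in>?B m. ?t m \<beta> * 0) - (\<Sum>\<beta>\<in>?B m0. ?t m0 \<beta> * 0)) min_at_top"
    by (intro tendsto_diff tendsto_sum tendsto_mult_left R)
  ultimately show ?thesis by simp
qed

lemma A_tilde_split:
  fixes F :: "real ^ 'p::finite \<Rightarrow> real"
  shows "(\<Sum>J\<in>UNIV. (-1) ^ (CARD('p) - card J) * A_J m F J n) =
    A_tilde m F n + (-1) ^ CARD('p) * A_J m F {} 0"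
proof -
  have "A_J m F {} n = A_J m F {} 0" by (simp add: A_J_def restr_def)
  then show ?thesis by (simp add: A_tilde_def sum_split_empty_set)
qed


section \<open>Shifted series\<close>

text \<open>
Inclusion and exclusion: the set of all \<open>k\<close> in the box with \<open>k $ r \<ge> c $ r\<close> for \<open>r \<in> J\<close> has the indicator
\<open>\<Prod>r\<in>J. [c $ r \<le> k $ r]\<close>, and the alternating sum of these products over all \<open>J\<close> is
\<open>\<Prod>r. (1 - [c $ r \<le> k $ r])\<close>, the indicator of \<open>k < c\<close>.
\<close>

lemma sum_signed_orthants:
  fixes g :: "nat ^ 'p::finite \<Rightarrow> real"
  assumes cn: "\<And>r. c $ r \<le> n $ r"
  shows "(\<Sum>J\<in>{J. J \<noteq> {}}. (-1) ^ card J * (\<Sum>k\<in>box_below (n - restr c J). g (k + restr c J))) =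
    (\<Sum>k\<in>box_below c. g k) - (\<Sum>k\<in>box_below n. g k)"
proof -
  define b where "b r k = (of_bool (c $ r \<le> k $ r) :: real)" for r and k :: "nat ^ 'p"
  have orthant: "(\<Sum>k\<in>box_below (n - restr c J). g (k + restr c J)) =
      (\<Sum>k\<in>box_below n. g k * (\<Prod>r\<in>UNIV. if r \<in> - J then 1 else b r k))" for J
  proof -
    have "(\<Sum>k\<in>box_below (n - restr c J). g (k + restr c J)) =
        (\<Sum>k | k \<in> box_below n \<and> (\<forall>r\<in>J. c $ r \<le> k $ r). g k)"
      by (rule sum.reindex_bij_witness[where i = "\<lambda>k. k - restr c J" and j = "\<lambda>k. k + restr c J"])
        (auto simp: box_below_def restr_def vec_eq_iff less_diff_conv split: if_splits
          intro: diff_less_mono)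
    also have "\<dots> = (\<Sum>k\<in>box_below n. if \<forall>r\<in>J. c $ r \<le> k $ r then g k else 0)"
      using sum.inter_filter[OF finite_box_below] by simp
    also have "\<dots> = (\<Sum>k\<in>box_below n. g k * (\<Prod>r\<in>UNIV. if r \<in> - J then 1 else b r k))"
    proof (intro sum.cong refl)
      fix k
      show "(if \<forall>r\<in>J. c $ r \<le> k $ r then g k else 0) = g k * (\<Prod>r\<in>UNIV. if r \<in> - J then 1 else b r k)"
      proof (cases "\<forall>r\<in>J. c $ r \<le> k $ r")
        case True
        then have "(\<Prod>r\<in>UNIV. if r \<in> - J then 1 else b r k) = 1"
          by (intro prod.neutral) (auto simp: b_def)
        then show ?thesis unfolding if_P[OF True] by simp
      next
        case False
        then have "(\<Prod>r\<in>UNIV. if r \<in> - J then 1 else b r k) = 0"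
          by (intro prod_zero) (auto simp: b_def)
        then show ?thesis unfolding if_not_P[OF False] by simp
      qed
    qed
    finally show ?thesis .
  qed
  have below: "(\<Sum>J\<in>UNIV. (-1) ^ card J * (\<Prod>r\<in>UNIV. if r \<in> - J then 1 else b r k)) =
      of_bool (k \<in> box_below c)" for k
  proof -
    have "(\<Sum>J\<in>UNIV. (-1) ^ card J * (\<Prod>r\<in>UNIV. if r \<in> - J then 1 else b r k)) =
        (\<Sum>J\<in>Pow UNIV. (-1) ^ card (UNIV - J) * (\<Prod>r\<in>UNIV. if r \<in> J then 1 else b r k))"
      by (rule sum.reindex_bij_witness[where i = uminus and j = uminus]) (auto simp: Compl_eq_Diff_UNIV double_diff)
    also have "\<dots> = (\<Prod>r\<in>UNIV. 1 - b r k)"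
      by (rule sum_signed_subsets_prod) simp
    also have "\<dots> = of_bool (k \<in> box_below c)"
    proof (cases "k \<in> box_below c")
      case True
      then have "(\<Prod>r\<in>UNIV. 1 - b r k) = 1"
        by (intro prod.neutral) (auto simp: b_def box_below_def not_le[symmetric])
      then show ?thesis using True by simp
    next
      case False
      then have "(\<Prod>r\<in>UNIV. 1 - b r k) = 0"
        by (intro prod_zero) (auto simp: b_def box_below_def not_less)
      then show ?thesis using False by simp
    qed
    finally show ?thesis .
  qed
  have "(\<Sum>J\<in>UNIV. (-1) ^ card J * (\<Sum>k\<in>box_below (n - restr c J). g (k + restr c J))) =
      (\<Sum>k\<in>box_below n. g k * (\<Sum>J\<in>UNIV. (-1) ^ card J * (\<Prod>r\<in>UNIV. if r \<in> - J then 1 else b r k)))"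
    unfolding orthant sum_distrib_left by (subst sum.swap) (simp add: mult_ac)
  also have "\<dots> = (\<Sum>k\<in>box_below n. if k \<in> box_below c then g k else 0)"
    unfolding below by (intro sum.cong) auto
  also have "\<dots> = (\<Sum>k | k \<in> box_below n \<and> k \<in> box_below c. g k)"
    by (rule sum.inter_filter[OF finite_box_below, symmetric])
  also have "{k. k \<in> box_below n \<and> k \<in> box_below c} = box_below c"
    using cn by (auto simp: box_below_def intro: less_le_trans)
  finally have all: "(\<Sum>J\<in>UNIV. (-1) ^ card J * (\<Sum>k\<in>box_below (n - restr c J). g (k + restr c J))) =
      (\<Sum>k\<in>box_below c. g k)" .
  have "restr c {} = 0" by (simp add: restr_def vec_eq_iff)
  then show ?thesis using all by (simp add: sum_split_empty_set)
qed

lemma filterlim_diff_min_at_top: "filterlim (\<lambda>n. n - a) min_at_top (min_at_top :: (nat ^ 'p::finite) filter)"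
  unfolding filterlim_iff
proof (intro allI impI)
  fix P assume "eventually P (min_at_top :: (nat ^ 'p) filter)"
  then obtain N where N: "\<And>n :: nat ^ 'p. (\<forall>r. N \<le> n $ r) \<Longrightarrow> P n"
    unfolding eventually_min_at_top by blast
  define M where "M = Max (range (\<lambda>r. a $ r))"
  have M: "a $ r \<le> M" for r unfolding M_def by (rule Max_ge) auto
  show "eventually (\<lambda>n. P (n - a)) min_at_top"
    unfolding eventually_min_at_top
  proof (intro exI[of _ "N + M"] allI impI N)
    fix n :: "nat ^ 'p" and r assume "\<forall>r. N + M \<le> n $ r"
    then have "N + M \<le> n $ r" by blast
    with M[of r] show "N \<le> (n - a) $ r" by simp
  qed
qed

text \<open>
The limit of the preceding identity. The shifted partial sum for \<open>J\<close> is taken over the box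
\<open>n - restr c J\<close>, which does not affect its limit but makes all the sums parts of one sum over the box
\<open>n\<close>.
\<close>

lemma lattice_series_signed_orthants:
  fixes g :: "real ^ 'p::finite \<Rightarrow> real"
  assumes S: "((\<lambda>n. lattice_sum g n u) \<longlongrightarrow> S) min_at_top"
    and ex: "\<And>J. J \<noteq> {} \<Longrightarrow> \<exists>l. ((\<lambda>n. lattice_sum (shift g (rvec (restr c J))) n u) \<longlongrightarrow> l) min_at_top"
  shows "(\<Sum>J\<in>{J. J \<noteq> {}}. (-1) ^ card J * lattice_series (shift g (rvec (restr c J))) u) = lattice_sum g c u - S"
proof (rule tendsto_unique[OF min_at_top_neq_bot])
  let ?L = "\<lambda>n. \<Sum>J\<in>{J. J \<noteq> {}}. (-1) ^ card J * lattice_sum (shift g (rvec (restr c J))) (n - restr c J) u"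
  show "(?L \<longlongrightarrow> (\<Sum>J\<in>{J. J \<noteq> {}}. (-1) ^ card J * lattice_series (shift g (rvec (restr c J))) u)) min_at_top"
  proof (intro tendsto_sum tendsto_mult_left)
    fix J :: "'p set" assume "J \<in> {J. J \<noteq> {}}"
    then obtain l where l: "((\<lambda>n. lattice_sum (shift g (rvec (restr c J))) n u) \<longlongrightarrow> l) min_at_top"
      using ex by blast
    then have "lattice_series (shift g (rvec (restr c J))) u = l"
      unfolding lattice_series_def by (intro tendsto_Lim min_at_top_neq_bot)
    with l show "((\<lambda>n. lattice_sum (shift g (rvec (restr c J))) (n - restr c J) u) \<longlongrightarrow>
        lattice_series (shift g (rvec (restr c J))) u) min_at_top"
      using filterlim_compose[OF l filterlim_diff_min_at_top] by simp
  qed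
  \<comment> \<open>The identity of sums holds once the box \<open>n\<close> contains the box \<open>c\<close>.\<close>
  have eq: "?L n = lattice_sum g c u - lattice_sum g n u" if "\<And>r. c $ r \<le> n $ r" for n
  proof -
    have "shift g (rvec (restr c J)) (rvec k + u) = g (rvec (k + restr c J) + u)" for J k
      unfolding shift_def by (intro arg_cong[where f = g]) (simp add: vec_eq_iff rvec_def)
    then show ?thesis
      unfolding lattice_sum_def using sum_signed_orthants[OF that, of "\<lambda>k. g (rvec k + u)"] by simp
  qed
  have "eventually (\<lambda>n. ?L n = lattice_sum g c u - lattice_sum g n u) min_at_top"
    unfolding eventually_min_at_top
  proof (intro exI[of _ "Max (range (\<lambda>r. c $ r))"] allI impI eq)
    fix n :: "nat ^ 'p" and r assume "\<forall>r. Max (range (\<lambda>r. c $ r)) \<le> n $ r"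
    then show "c $ r \<le> n $ r" by (meson Max_ge finite finite_imageI order_trans rangeI)
  qed
  moreover have "((\<lambda>n. lattice_sum g c u - lattice_sum g n u) \<longlongrightarrow> lattice_sum g c u - S) min_at_top"
    by (intro tendsto_diff tendsto_const S)
  ultimately show "(?L \<longlongrightarrow> lattice_sum g c u - S) min_at_top"
    using tendsto_cong by fastforce
qed


section \<open>The generalized sum\<close>

theorem theorem3p2:
  fixes m m0 :: nat
    and f F :: "real ^ 'p::{finite,linorder} \<Rightarrow> real"
    and c :: "nat ^ 'p::{finite,linorder}"
  assumes "m0 \<ge> 1" and "m \<ge> m0"
    and "cont_diff (2 * m) f"
    and "antiderivative F f"
    and "cont_diff (2 * m0) F"
    and "\<And>\<alpha>. mi_norm \<alpha> = 2 * m0 \<Longrightarrow> (mderiv \<alpha> F \<longlongrightarrow> 0) max_at_top"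
    and "\<And>\<alpha>. mi_norm \<alpha> = 2 * m \<Longrightarrow>
           \<exists>S. uniform_limit (half_cube m) (lattice_sum (mderiv \<alpha> f)) S min_at_top"
  shows "(\<exists>L. (alt_partial m0 F f \<longlongrightarrow> L) min_at_top) \<and>
         (R_shifted_exists m f c \<longrightarrow>
            alt_sum m0 F f =
              (\<Sum>k \<in> box_below c. f (rvec k)) - A_tilde m F c - R_shifted m f c)"
proof -
  have m: "0 < m0" "0 < m" using assms(1,2) by auto
  \<comment> \<open>The contribution of the empty set \<open>J\<close>, which is the same for all \<open>n\<close>.\<close>
  define A0 where "A0 = (-1) ^ CARD('p) * A_J m F {} 0"
  obtain S where S: "\<And>\<alpha>. \<alpha> \<in> multi_indices (2 * m) \<Longrightarrow>
      uniform_limit (half_cube m) (lattice_sum (mderiv \<alpha> f)) (S \<alpha>) min_at_top"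
    using assms(7) unfolding multi_indices_def mem_Collect_eq by metis
  have defn: "R_defined m (\<lambda>\<alpha>. lattice_sum (mderiv \<alpha> f) n)" for n
    by (intro R_defined_continuous continuous_on_lattice_sum continuous_on_mderiv[OF assms(3)])
  have defS: "R_defined m S"
  proof (rule R_defined_continuous)
    fix \<alpha> :: "nat ^ 'p::{finite,linorder}" assume \<alpha>: "\<alpha> \<in> multi_indices (2 * m)"
    show "continuous_on (half_cube m) (S \<alpha>)"
      by (rule uniform_limit_theorem[OF _ S[OF \<alpha>] min_at_top_neq_bot], rule always_eventually)
        (auto intro: continuous_on_lattice_sum continuous_on_mderiv[OF assms(3) \<alpha>])
  qed
  have sum_f: "(\<Sum>k\<in>box_below n. f (rvec k)) =
      A_tilde m F n + A0 - R_functional m (\<lambda>\<alpha>. lattice_sum (mderiv \<alpha> f) n)" for n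
    using finite_summation_formula[OF m(2) assms(3,4), of n] by (simp add: A_tilde_split A0_def)
  have "((\<lambda>n. A_tilde m F n - A_tilde m0 F n) \<longlongrightarrow> 0) min_at_top"
  proof -
    have "((\<lambda>n. \<Sum>J\<in>{J. J \<noteq> {}}. (-1) ^ (CARD('p) - card J) * (A_J m F J n - A_J m0 F J n)) \<longlongrightarrow>
        (\<Sum>J\<in>{J :: 'p set. J \<noteq> {}}. (-1) ^ (CARD('p) - card J) * 0)) min_at_top"
      using A_J_difference_tendsto_0[OF m(1) assms(2,5) _ assms(6)]
      by (intro tendsto_sum tendsto_mult_left) auto
    then show ?thesis
      by (simp add: A_tilde_def right_diff_distrib sum_subtractf)
  qed
  moreover have "((\<lambda>n. R_functional m (\<lambda>\<alpha>. lattice_sum (mderiv \<alpha> f) n)) \<longlongrightarrow> R_functional m S) min_at_top"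
    by (rule R_functional_tendsto[OF defn defS S])
  ultimately have "((\<lambda>n. A0 - R_functional m (\<lambda>\<alpha>. lattice_sum (mderiv \<alpha> f) n) +
      (A_tilde m F n - A_tilde m0 F n)) \<longlongrightarrow> A0 - R_functional m S + 0) min_at_top"
    by (intro tendsto_add tendsto_diff tendsto_const)
  moreover have "alt_partial m0 F f = (\<lambda>n. A0 - R_functional m (\<lambda>\<alpha>. lattice_sum (mderiv \<alpha> f) n) +
      (A_tilde m F n - A_tilde m0 F n))"
    by (simp add: fun_eq_iff alt_partial_def sum_f)
  ultimately have lim: "(alt_partial m0 F f \<longlongrightarrow> A0 - R_functional m S) min_at_top"
    by simp
  then have alt: "alt_sum m0 F f = A0 - R_functional m S"
    unfolding alt_sum_def by (intro tendsto_Lim min_at_top_neq_bot)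
  have "R_shifted m f c = R_functional m S - R_functional m (\<lambda>\<alpha>. lattice_sum (mderiv \<alpha> f) c)"
    if ex: "R_shifted_exists m f c"
  proof -
    let ?T = "\<lambda>J \<alpha>. lattice_series (mderiv \<alpha> (shift f (rvec (restr c J))))"
    have J: "R_inf_exists m (shift f (rvec (restr c J)))" if "J \<noteq> {}" for J
      using ex that by (simp add: R_shifted_exists_def)
    have "(\<Sum>J\<in>{J. J \<noteq> {}}. (-1) ^ card J * R_inf m (shift f (rvec (restr c J)))) =
        R_functional m (\<lambda>\<alpha> u. \<Sum>J\<in>{J. J \<noteq> {}}. (-1) ^ card J * ?T J \<alpha> u)"
      unfolding R_inf_eq_functional
      by (rule R_functional_sum[symmetric]) (auto intro: R_inf_exists_imp_defined J)
    also have "\<dots> = R_functional m (\<lambda>\<alpha> u. lattice_sum (mderiv \<alpha> f) c u - S \<alpha> u)"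
    proof (rule R_functional_cong)
      fix \<alpha> :: "nat ^ 'p::{finite,linorder}" and u :: "real ^ 'p::{finite,linorder}"
      assume \<alpha>: "\<alpha> \<in> multi_indices (2 * m)" and u: "u \<in> half_cube m"
      show "(\<Sum>J\<in>{J. J \<noteq> {}}. (-1) ^ card J * ?T J \<alpha> u) = lattice_sum (mderiv \<alpha> f) c u - S \<alpha> u"
        unfolding mderiv_shift
      proof (rule lattice_series_signed_orthants)
        show "((\<lambda>n. lattice_sum (mderiv \<alpha> f) n u) \<longlongrightarrow> S \<alpha> u) min_at_top"
          by (rule tendsto_uniform_limitI[OF S[OF \<alpha>] u])
        show "\<exists>l. ((\<lambda>n. lattice_sum (shift (mderiv \<alpha> f) (rvec (restr c J))) n u) \<longlongrightarrow> l) min_at_top"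
          if "J \<noteq> {}" for J
          using J[OF that] \<alpha> u by (auto simp: R_inf_exists_def mderiv_shift)
      qed
    qed
    also have "\<dots> = R_functional m (\<lambda>\<alpha>. lattice_sum (mderiv \<alpha> f) c) - R_functional m S"
      by (rule R_functional_diff[OF defn defS])
    finally show ?thesis by (simp add: R_shifted_def)
  qed
  then show ?thesis
    using lim alt sum_f[of c] by auto
qed

end
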